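(* Let $H$ be a Hopf algebra with invertible antipode over a field $\Bbbk$. For any bicovariant bimodules $M,M',N,N'$ over $H$, the tensor product of rational morphisms $$\otimes_\sigma\colon \mathrm{HOM}(M,M')\otimes\mathrm{HOM}(N,N')\to\mathrm{HOM}(M\otimes N,M'\otimes N'),$$ $$(\phi\otimes_\sigma\psi)(m\otimes n)=\phi(\psi_{-2}m_0S(\psi_{-1}m_1))\otimes\psi_0(m_2n),$$ is a (well-defined) morphism of bicovariant bimodules. Furthermore, for all $\phi\in\mathrm{HOM}(M,M')$ and $\psi\in\mathrm{HOM}(N,N')$ it decomposes as $$\phi\otimes_\sigma\psi=(\phi\otimes_\sigma\mathrm{id}_{N'})\circ(\mathrm{id}_M\otimes_\sigma\psi),$$ and it is associative: for bicovariant bimodules $O,O'$ and $\chi\in\mathrm{HOM}(O,O')$, $$(\phi\otimes_\sigma\psi)\otimes_\sigma\chi=\phi\otimes_\sigma(\psi\otimes_\sigma\chi).$$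
   Context: $\Bbbk$ is a field, $\otimes=\otimes_\Bbbk$, and $H$ is a Hopf algebra with coproduct $\Delta(h)=h_1\otimes h_2$, counit $\epsilon$ and invertible antipode $S$ with inverse $\overline S$. Right coactions are written $m\mapsto m_0\otimes m_1\in M\otimes H$, left coactions $m\mapsto m_{-1}\otimes m_0\in H\otimes M$; iterated coactions are $m_0\otimes m_1\otimes m_2$, $m_{-2}\otimes m_{-1}\otimes m_0$, etc. (Sweedler notation). A bicovariant bimodule is an $H$-bimodule $M$ with commuting right and left $H$-coactions $\delta_M,\lambda_M$ such that $\delta_M(amb)=\Delta(a)\delta_M(m)\Delta(b)$ and $\lambda_M(amb)=\Delta(a)\lambda_M(m)\Delta(b)$; morphisms of bicovariant bimodules are $H$-bilinear, left and right $H$-colinear maps. For bicovariant bimodules $M,N$ the space $M\otimes N$ carries the $H$-actions $a(m\otimes n)b=am\otimes nb$ and the diagonal coactions $m\otimes n\mapsto m_0\otimes n_0\otimes m_1n_1$ and $m\otimes n\mapsto m_{-1}n_{-1}\otimes m_0\otimes n_0$. Rational morphisms: for $\phi\in\mathrm{Hom}_\Bbbk(M,N)$ put $\delta^{\mathrm{Ad}}(\phi)(m)=\phi(m_0)_0\otimes\phi(m_0)_1S(m_1)\in N\otimes H$ and $\lambda^{\mathrm{Ad}}(\phi)(m)=\phi(m_0)_{-1}\overline S(m_{-1})\otimes\phi(m_0)_0\in H\otimes N$. Regard $\mathrm{Hom}_\Bbbk(M,N)\otimes H\subseteq \mathrm{Hom}_\Bbbk(M,N\otimes H)$ and $H\otimes\mathrm{Hom}_\Bbbk(M,N)\subseteq\mathrm{Hom}_\Bbbk(M,H\otimes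 N)$. Then $\mathrm{HOM}(M,N)$ is the space of all $\phi$ with $\delta^{\mathrm{Ad}}(\phi)\in\mathrm{Hom}_\Bbbk(M,N)\otimes H$ and $\lambda^{\mathrm{Ad}}(\phi)\in H\otimes\mathrm{Hom}_\Bbbk(M,N)$. One writes $\delta^{\mathrm{Ad}}(\phi)=\phi_0\otimes\phi_1$ and $\lambda^{\mathrm{Ad}}(\phi)=\phi_{-1}\otimes\phi_0$, with iterations $\phi_{-2}\otimes\phi_{-1}\otimes\phi_0$. $\mathrm{HOM}(M,N)$ is a bicovariant bimodule with coactions $\delta^{\mathrm{Ad}},\lambda^{\mathrm{Ad}}$ and actions $(a\cdot\phi\cdot b)(m)=a\,\phi(bm)$. *)

theory Defs
  imports Complex_Main "HOL-Library.Function_Algebras"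
begin

section \<open>Vector spaces and tensor products over a field\<close>

text \<open>
  A vector space is a subspace \<open>carr V\<close> of an ambient type which is itself a vector space under
  \<open>scl V\<close>; addition is that of the ambient type.  Spaces of linear maps and tensor products
  then live in function types with their pointwise structure.
\<close>

record ('k, 'v) vs =
  carr :: "'v set"
  scl :: "'k \<Rightarrow> 'v \<Rightarrow> 'v"

definition is_vs :: "('k::field, 'v::ab_group_add, 'z) vs_scheme \<Rightarrow> bool" where
  "is_vs V \<longleftrightarrow> vector_space (scl V) \<and> module.subspace (scl V) (carr V)"

definition lin :: "('k::field, 'a::ab_group_add, 'y) vs_scheme
    \<Rightarrow> ('k, 'b::ab_group_add, 'z) vs_scheme \<Rightarrow> ('a \<Rightarrow> 'b) \<Rightarrow> bool" where
  "lin V W f \<longleftrightarrow>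
     (\<forall>x\<in>carr V. f x \<in> carr W) \<and>
     (\<forall>x\<in>carr V. \<forall>y\<in>carr V. f (x + y) = f x + f y) \<and>
     (\<forall>c. \<forall>x\<in>carr V. f (scl V c x) = scl W c (f x))"

definition bilin :: "('k::field, 'a::ab_group_add, 'x) vs_scheme
    \<Rightarrow> ('k, 'b::ab_group_add, 'y) vs_scheme \<Rightarrow> ('k, 'c::ab_group_add, 'z) vs_scheme
    \<Rightarrow> ('a \<Rightarrow> 'b \<Rightarrow> 'c) \<Rightarrow> bool" where
  "bilin A B W f \<longleftrightarrow>
     (\<forall>a\<in>carr A. lin B W (f a)) \<and> (\<forall>b\<in>carr B. lin A W (\<lambda>a. f a b))"

text \<open>
  Elements of \<open>Hom(V,W)\<close> are normalised to be \<open>0\<close> outside the carrier of \<open>V\<close>, so that equality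
  of linear maps is equality of functions.
\<close>

definition ext0 :: "('k, 'a, 'z) vs_scheme \<Rightarrow> ('a \<Rightarrow> 'b::zero) \<Rightarrow> 'a \<Rightarrow> 'b" where
  "ext0 V f = (\<lambda>x. if x \<in> carr V then f x else 0)"

definition Hom :: "('k::field, 'a::ab_group_add, 'y) vs_scheme
    \<Rightarrow> ('k, 'b::ab_group_add, 'z) vs_scheme \<Rightarrow> ('k, 'a \<Rightarrow> 'b) vs" where
  "Hom V W = \<lparr> carr = {f. lin V W f \<and> (\<forall>x. x \<notin> carr V \<longrightarrow> f x = 0)},
               scl = (\<lambda>c f x. scl W c (f x)) \<rparr>"

definition base_field :: "('k::field, 'k) vs" where
  "base_field = \<lparr> carr = UNIV, scl = (*) \<rparr>"

text \<open>
  The tensor product of \<open>A\<close> and \<open>B\<close> is the space spanned, inside the dual of the space of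
  bilinear forms on \<open>A \<times> B\<close>, by the evaluations \<open>a \<otimes> b = (\<beta> \<mapsto> \<beta> a b)\<close>.  Over a field this is a
  tensor product: its universal property is lemma \<open>tensor_universal\<close> below.
\<close>

type_synonym ('k, 'a, 'b) tens = "('a \<Rightarrow> 'b \<Rightarrow> 'k) \<Rightarrow> 'k"

definition ptens :: "'a \<Rightarrow> ('k::field, 'a::ab_group_add, 'y) vs_scheme
    \<Rightarrow> ('k, 'b::ab_group_add, 'z) vs_scheme \<Rightarrow> 'b \<Rightarrow> ('k, 'a, 'b) tens"
    ("(_ \<otimes>\<^bsub>_,_\<^esub> _)" [71, 0, 0, 71] 70) where
  "a \<otimes>\<^bsub>A,B\<^esub> b = (\<lambda>\<beta>. if bilin A B base_field \<beta> then \<beta> a b else 0)"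

definition tensor :: "('k::field, 'a::ab_group_add, 'y) vs_scheme
    \<Rightarrow> ('k, 'b::ab_group_add, 'z) vs_scheme \<Rightarrow> ('k, ('k, 'a, 'b) tens) vs"
    (infixr "\<otimes>\<^sub>v" 70) where
  "A \<otimes>\<^sub>v B = \<lparr> carr = module.span (\<lambda>c t \<beta>. c * t \<beta>) {a \<otimes>\<^bsub>A,B\<^esub> b | a b. a \<in> carr A \<and> b \<in> carr B},
              scl = (\<lambda>c t \<beta>. c * t \<beta>) \<rparr>"

text \<open>
  \<open>sw A B W t f\<close> is the value at \<open>t\<close> of the linear map \<open>A \<otimes> B \<rightarrow> W\<close> induced by the bilinear map
  \<open>f\<close>.  It is read as Sweedler notation: for \<open>t = t\<^sub>0 \<otimes> t\<^sub>1\<close> (summation understood),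
  \<open>sw A B W t (\<lambda>t\<^sub>0 t\<^sub>1. E)\<close> is the element \<open>E\<close> of \<open>W\<close>.
\<close>

definition sw :: "('k::field, 'a::ab_group_add, 'x) vs_scheme
    \<Rightarrow> ('k, 'b::ab_group_add, 'y) vs_scheme \<Rightarrow> ('k, 'c::ab_group_add, 'z) vs_scheme
    \<Rightarrow> ('k, 'a, 'b) tens \<Rightarrow> ('a \<Rightarrow> 'b \<Rightarrow> 'c) \<Rightarrow> 'c" where
  "sw A B W t f =
     (THE g. g \<in> carr (Hom (A \<otimes>\<^sub>v B) W) \<and>
             (\<forall>a\<in>carr A. \<forall>b\<in>carr B. g (a \<otimes>\<^bsub>A,B\<^esub> b) = f a b)) t"

lemma vector_space_pointwise:
  "vector_space (\<lambda>(c::'k::field) (t::'x \<Rightarrow> 'k) \<beta>. c * t \<beta>)"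
  by unfold_locales (auto simp: fun_eq_iff algebra_simps)

lemma vector_space_field: "vector_space ((*) :: 'k::field \<Rightarrow> 'k \<Rightarrow> 'k)"
  by unfold_locales (auto simp: algebra_simps)

lemma is_vs_tensor: "is_vs (A \<otimes>\<^sub>v B)"
proof -
  interpret vector_space "\<lambda>(c::'k::field) (t::'x \<Rightarrow> 'k) \<beta>. c * t \<beta>"
    by (rule vector_space_pointwise)
  show ?thesis
    by (simp add: is_vs_def tensor_def vector_space_pointwise subspace_span)
qed

lemma functional_separates:
  fixes s :: "'k::field \<Rightarrow> 'w::ab_group_add \<Rightarrow> 'w"
  assumes "vector_space s" and sep: "\<And>\<gamma>. Vector_Spaces.linear s (*) \<gamma> \<Longrightarrow> \<gamma> x = \<gamma> y"
  shows "x = y"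
proof (rule ccontr)
  assume ne: "x \<noteq> y"
  interpret V: vector_space s by fact
  interpret P: vector_space_pair s "(*) :: 'k \<Rightarrow> 'k \<Rightarrow> 'k"
    by (intro vector_space_pair.intro assms(1) vector_space_field)
  have "V.independent {x - y}" using ne by simp
  from P.linear_independent_extend[OF this, of "\<lambda>_. 1"]
  obtain \<gamma> where \<gamma>: "Vector_Spaces.linear s (*) \<gamma>" "\<gamma> (x - y) = 1" by auto
  interpret L: Vector_Spaces.linear s "(*)" \<gamma> by fact
  from sep[OF \<gamma>(1)] \<gamma>(2) show False by (simp add: L.diff)
qed

lemma tensor_universal:
  fixes A :: "('k::field, 'a::ab_group_add, 'x) vs_scheme"
    and B :: "('k, 'b::ab_group_add, 'y) vs_scheme"
    and W :: "('k, 'c::ab_group_add, 'z) vs_scheme"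
  assumes W: "is_vs W" and f: "bilin A B W f"
  shows "\<exists>!g. g \<in> carr (Hom (A \<otimes>\<^sub>v B) W) \<and>
              (\<forall>a\<in>carr A. \<forall>b\<in>carr B. g (a \<otimes>\<^bsub>A,B\<^esub> b) = f a b)"
proof -
  define sT where "sT = (\<lambda>(c::'k) (t::('k, 'a, 'b) tens) \<beta>. c * t \<beta>)"
  define P where "P = {a \<otimes>\<^bsub>A,B\<^esub> b | a b. a \<in> carr A \<and> b \<in> carr B}"
  have vT: "vector_space sT" unfolding sT_def by (rule vector_space_pointwise)
  have vW: "vector_space (scl W)" and subW: "module.subspace (scl W) (carr W)"
    using W by (auto simp: is_vs_def)
  interpret T: vector_space sT by fact
  interpret W: vector_space "scl W" by fact
  interpret TW: vector_space_pair sT "scl W" by (intro vector_space_pair.intro vT vW)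
  have carrT: "carr (A \<otimes>\<^sub>v B) = T.span P" and sclT: "scl (A \<otimes>\<^sub>v B) = sT"
    by (simp_all add: tensor_def P_def sT_def)
  obtain Bs where Bs: "Bs \<subseteq> P" "T.independent Bs" "P \<subseteq> T.span Bs"
    by (rule T.maximal_independent_subset)
  have "\<forall>p\<in>P. \<exists>ab. fst ab \<in> carr A \<and> snd ab \<in> carr B \<and> p = fst ab \<otimes>\<^bsub>A,B\<^esub> snd ab"
    by (auto simp: P_def)
  then obtain r where r: "\<And>p. p \<in> P \<Longrightarrow> fst (r p) \<in> carr A \<and> snd (r p) \<in> carr B
      \<and> p = fst (r p) \<otimes>\<^bsub>A,B\<^esub> snd (r p)" by metis
  from TW.linear_independent_extend[OF Bs(2), of "\<lambda>p. f (fst (r p)) (snd (r p))"]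
  obtain g where g: "Vector_Spaces.linear sT (scl W) g"
    and gB: "\<And>p. p \<in> Bs \<Longrightarrow> g p = f (fst (r p)) (snd (r p))" by auto
  interpret G: Vector_Spaces.linear sT "scl W" g by fact
  have gP: "g (a \<otimes>\<^bsub>A,B\<^esub> b) = f a b" if a: "a \<in> carr A" and b: "b \<in> carr B" for a b
  proof (rule functional_separates[OF vW])
    fix \<gamma> :: "'c \<Rightarrow> 'k" assume \<gamma>: "Vector_Spaces.linear (scl W) (*) \<gamma>"
    interpret L: Vector_Spaces.linear "scl W" "(*)" \<gamma> by fact
    have bil: "bilin A B base_field (\<lambda>a b. \<gamma> (f a b))"
      using f by (auto simp: bilin_def lin_def base_field_def L.add L.scale)
    have ev: "t (\<lambda>a b. \<gamma> (f a b)) = \<gamma> (g t)" if "t \<in> T.span Bs" for t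
      using that
    proof (induction rule: T.span_induct_alt)
      case base
      show ?case by (metis G.zero L.zero zero_fun_apply)
    next
      case (step c x y)
      have x: "x \<in> P" using step(1) Bs by auto
      have "x (\<lambda>a b. \<gamma> (f a b)) = \<gamma> (f (fst (r x)) (snd (r x)))"
        by (subst conjunct2[OF conjunct2[OF r[OF x]]]) (simp add: ptens_def bil)
      then have "(sT c x + y) (\<lambda>a b. \<gamma> (f a b)) = c * \<gamma> (g x) + \<gamma> (g y)"
        using step by (simp add: gB) (simp add: sT_def)
      moreover have "\<gamma> (g (sT c x + y)) = c * \<gamma> (g x) + \<gamma> (g y)"
        by (simp only: G.add G.scale L.add L.scale)
      ultimately show ?case by metis
    qed
    have "a \<otimes>\<^bsub>A,B\<^esub> b \<in> T.span Bs" using a b Bs(3) by (auto simp: P_def)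
    from ev[OF this] show "\<gamma> (g (a \<otimes>\<^bsub>A,B\<^esub> b)) = \<gamma> (f a b)"
      by (simp add: ptens_def bil)
  qed
  have gW: "g t \<in> carr W" if "t \<in> T.span P" for t
    using that
  proof (induction rule: T.span_induct_alt)
    case base
    show ?case using W.subspace_0[OF subW] by (simp only: G.zero)
  next
    case (step c x y)
    from step(1) obtain a b where ab: "x = a \<otimes>\<^bsub>A,B\<^esub> b" "a \<in> carr A" "b \<in> carr B"
      by (auto simp: P_def)
    then have "g x \<in> carr W" using f gP by (auto simp: bilin_def lin_def)
    then have "g (sT c x + y) \<in> carr W"
      using step W.subspace_add[OF subW] W.subspace_scale[OF subW] by (simp add: G.add G.scale)
    then show ?case .
  qed
  let ?g = "ext0 (A \<otimes>\<^sub>v B) g"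
  have PT: "a \<otimes>\<^bsub>A,B\<^esub> b \<in> T.span P" if "a \<in> carr A" "b \<in> carr B" for a b
    using that by (auto simp: P_def intro!: T.span_base)
  show ?thesis
  proof (rule ex1I[of _ ?g], intro conjI ballI)
    show "?g \<in> carr (Hom (A \<otimes>\<^sub>v B) W)"
      by (auto simp: Hom_def lin_def ext0_def carrT sclT gW G.add G.scale T.span_add T.span_scale)
    show "?g (a \<otimes>\<^bsub>A,B\<^esub> b) = f a b" if "a \<in> carr A" "b \<in> carr B" for a b
      using that by (simp add: ext0_def carrT PT gP)
  next
    fix h
    assume h: "h \<in> carr (Hom (A \<otimes>\<^sub>v B) W) \<and>
      (\<forall>a\<in>carr A. \<forall>b\<in>carr B. h (a \<otimes>\<^bsub>A,B\<^esub> b) = f a b)"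
    then have hl: "lin (A \<otimes>\<^sub>v B) W h" and h0: "\<And>t. t \<notin> T.span P \<Longrightarrow> h t = 0"
      by (auto simp: Hom_def carrT)
    have "h (0 + 0) = h 0 + h 0"
      using hl T.span_zero[of P] unfolding lin_def carrT by blast
    then have hz: "h 0 = 0" by (metis add_0_right add_left_cancel)
    have "t \<in> T.span P \<and> h t = g t" if "t \<in> T.span P" for t
      using that
    proof (induction rule: T.span_induct_alt)
      case base
      show ?case by (simp only: hz G.zero T.span_zero simp_thms)
    next
      case (step c x y)
      from step(1) obtain a b where ab: "x = a \<otimes>\<^bsub>A,B\<^esub> b" "a \<in> carr A" "b \<in> carr B"
        by (auto simp: P_def)
      then have x: "x \<in> T.span P" "h x = g x" using h gP PT by auto
      then have "h (sT c x + y) = g (sT c x + y)"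
        using step hl T.span_scale[OF x(1), of c] by (simp add: lin_def carrT sclT G.add G.scale)
      moreover have "sT c x + y \<in> T.span P"
        using step x by (simp add: T.span_add T.span_scale)
      ultimately have "sT c x + y \<in> T.span P \<and> h (sT c x + y) = g (sT c x + y)" by blast
      then show ?case .
    qed
    then show "h = ?g" using h0 by (auto simp: fun_eq_iff ext0_def carrT)
  qed
qed

text \<open>\<open>tmap A B A' B' f g\<close> is \<open>f \<otimes> g : A \<otimes> B \<rightarrow> A' \<otimes> B'\<close>.\<close>

definition tmap where
  "tmap A B A' B' f g t = sw A B (A' \<otimes>\<^sub>v B') t (\<lambda>a b. f a \<otimes>\<^bsub>A',B'\<^esub> g b)"

text \<open>
  \<open>tprod A A' B B' C C' f g t u\<close> combines \<open>t \<in> A \<otimes> A'\<close> and \<open>u \<in> B \<otimes> B'\<close> factorwise: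
  \<open>(a \<otimes> a')(b \<otimes> b') = f a b \<otimes> g a' b'\<close>.
\<close>

definition tprod where
  "tprod A A' B B' C C' f g t u =
     sw A A' (C \<otimes>\<^sub>v C') t (\<lambda>a a'. sw B B' (C \<otimes>\<^sub>v C') u (\<lambda>b b'. f a b \<otimes>\<^bsub>C,C'\<^esub> g a' b'))"

definition tassoc where
  "tassoc A B C t = sw (A \<otimes>\<^sub>v B) C (A \<otimes>\<^sub>v (B \<otimes>\<^sub>v C)) t
     (\<lambda>s c. sw A B (A \<otimes>\<^sub>v (B \<otimes>\<^sub>v C)) s (\<lambda>a b. a \<otimes>\<^bsub>A,B \<otimes>\<^sub>v C\<^esub> (b \<otimes>\<^bsub>B,C\<^esub> c)))"

section \<open>Hopf algebras\<close>

text \<open>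
  The underlying ring of a Hopf algebra is the type \<open>'h\<close>; a Hopf algebra over a field is nonzero
  since \<open>\<epsilon> 1 = 1\<close>, so class \<open>ring_1\<close> is no restriction.
\<close>

record ('k, 'h) hopf = "('k, 'h) vs" +
  comult :: "'h \<Rightarrow> ('k, 'h, 'h) tens"
  counit :: "'h \<Rightarrow> 'k"
  antipode :: "'h \<Rightarrow> 'h"

locale hopf_algebra =
  fixes H :: "('k::field, 'h::ring_1) hopf"
  assumes vs_H: "is_vs H"
    and carr_H: "carr H = UNIV"
    and mult_bilin: "bilin H H H (*)"
    and comult_lin: "lin H (H \<otimes>\<^sub>v H) (comult H)"
    and counit_lin: "lin H base_field (counit H)"
    and antipode_lin: "lin H H (antipode H)"
    and coassoc: "tassoc H H H (tmap H H (H \<otimes>\<^sub>v H) H (comult H) id (comult H h))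
                  = tmap H H H (H \<otimes>\<^sub>v H) id (comult H) (comult H h)"
    and counit_left: "sw H H H (comult H h) (\<lambda>h\<^sub>1 h\<^sub>2. scl H (counit H h\<^sub>1) h\<^sub>2) = h"
    and counit_right: "sw H H H (comult H h) (\<lambda>h\<^sub>1 h\<^sub>2. scl H (counit H h\<^sub>2) h\<^sub>1) = h"
    and comult_mult: "comult H (h * h') = tprod H H H H H H (*) (*) (comult H h) (comult H h')"
    and comult_one: "comult H 1 = 1 \<otimes>\<^bsub>H,H\<^esub> 1"
    and counit_mult: "counit H (h * h') = counit H h * counit H h'"
    and counit_one: "counit H 1 = 1"
    and antipode_left:
      "sw H H H (comult H h) (\<lambda>h\<^sub>1 h\<^sub>2. antipode H h\<^sub>1 * h\<^sub>2) = scl H (counit H h) 1"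
    and antipode_right:
      "sw H H H (comult H h) (\<lambda>h\<^sub>1 h\<^sub>2. h\<^sub>1 * antipode H h\<^sub>2) = scl H (counit H h) 1"

definition antipode_inv :: "('k, 'h) hopf \<Rightarrow> 'h \<Rightarrow> 'h" where
  "antipode_inv H = inv (antipode H)"

section \<open>Bicovariant bimodules\<close>

record ('k, 'h, 'm) bimod = "('k, 'm) vs" +
  lact :: "'h \<Rightarrow> 'm \<Rightarrow> 'm"
  ract :: "'m \<Rightarrow> 'h \<Rightarrow> 'm"
  rcoact :: "'m \<Rightarrow> ('k, 'm, 'h) tens"
  lcoact :: "'m \<Rightarrow> ('k, 'h, 'm) tens"

locale bicovariant_bimodule = hopf_algebra H
  for H :: "('k::field, 'h::ring_1) hopf" and M :: "('k, 'h, 'm::ab_group_add) bimod" +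
  assumes vs_M: "is_vs M"
    and lact_bilin: "bilin H M M (lact M)"
    and ract_bilin: "bilin M H M (ract M)"
    and lact_one: "m \<in> carr M \<Longrightarrow> lact M 1 m = m"
    and lact_mult: "m \<in> carr M \<Longrightarrow> lact M (a * b) m = lact M a (lact M b m)"
    and ract_one: "m \<in> carr M \<Longrightarrow> ract M m 1 = m"
    and ract_mult: "m \<in> carr M \<Longrightarrow> ract M m (a * b) = ract M (ract M m a) b"
    and lact_ract: "m \<in> carr M \<Longrightarrow> ract M (lact M a m) b = lact M a (ract M m b)"
    and rcoact_lin: "lin M (M \<otimes>\<^sub>v H) (rcoact M)"
    and lcoact_lin: "lin M (H \<otimes>\<^sub>v M) (lcoact M)"
    and rcoact_coassoc: "m \<in> carr M \<Longrightarrow>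
      tassoc M H H (tmap M H (M \<otimes>\<^sub>v H) H (rcoact M) id (rcoact M m))
      = tmap M H M (H \<otimes>\<^sub>v H) id (comult H) (rcoact M m)"
    and rcoact_counit: "m \<in> carr M \<Longrightarrow>
      sw M H M (rcoact M m) (\<lambda>m\<^sub>0 m\<^sub>1. scl M (counit H m\<^sub>1) m\<^sub>0) = m"
    and lcoact_coassoc: "m \<in> carr M \<Longrightarrow>
      tassoc H H M (tmap H M (H \<otimes>\<^sub>v H) M (comult H) id (lcoact M m))
      = tmap H M H (H \<otimes>\<^sub>v M) id (lcoact M) (lcoact M m)"
    and lcoact_counit: "m \<in> carr M \<Longrightarrow>
      sw H M M (lcoact M m) (\<lambda>m\<^sub>1 m\<^sub>0. scl M (counit H m\<^sub>1) m\<^sub>0) = m"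
    and coact_commute: "m \<in> carr M \<Longrightarrow>
      tassoc H M H (tmap M H (H \<otimes>\<^sub>v M) H (lcoact M) id (rcoact M m))
      = tmap H M H (M \<otimes>\<^sub>v H) id (rcoact M) (lcoact M m)"
    and rcoact_bimod: "m \<in> carr M \<Longrightarrow>
      rcoact M (ract M (lact M a m) b)
      = tprod M H H H M H (ract M) (*)
          (tprod H H M H M H (lact M) (*) (comult H a) (rcoact M m)) (comult H b)"
    and lcoact_bimod: "m \<in> carr M \<Longrightarrow>
      lcoact M (ract M (lact M a m) b)
      = tprod H M H H H M (*) (ract M)
          (tprod H H H M H M (*) (lact M) (comult H a) (lcoact M m)) (comult H b)"

locale bicovariant_morphism =
  M: bicovariant_bimodule H M + N: bicovariant_bimodule H N
  for H :: "('k::field, 'h::ring_1) hopf" and M :: "('k, 'h, 'm::ab_group_add) bimod"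
    and N :: "('k, 'h, 'n::ab_group_add) bimod" +
  fixes f :: "'m \<Rightarrow> 'n"
  assumes lin_f: "lin M N f"
    and f_lact: "m \<in> carr M \<Longrightarrow> f (lact M a m) = lact N a (f m)"
    and f_ract: "m \<in> carr M \<Longrightarrow> f (ract M m a) = ract N (f m) a"
    and f_rcoact: "m \<in> carr M \<Longrightarrow> rcoact N (f m) = tmap M H N H f id (rcoact M m)"
    and f_lcoact: "m \<in> carr M \<Longrightarrow> lcoact N (f m) = tmap H M H N id f (lcoact M m)"

definition bitensor :: "('k::field, 'h::ring_1) hopf \<Rightarrow> ('k, 'h, 'm::ab_group_add) bimod
    \<Rightarrow> ('k, 'h, 'n::ab_group_add) bimod \<Rightarrow> ('k, 'h, ('k, 'm, 'n) tens) bimod" where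
  "bitensor H M N =
     \<lparr> carr = carr (M \<otimes>\<^sub>v N),
       scl = scl (M \<otimes>\<^sub>v N),
       lact = (\<lambda>a. tmap M N M N (lact M a) id),
       ract = (\<lambda>t b. tmap M N M N id (\<lambda>n. ract N n b) t),
       rcoact = (\<lambda>t. sw M N ((M \<otimes>\<^sub>v N) \<otimes>\<^sub>v H) t (\<lambda>m n.
         tprod M H N H (M \<otimes>\<^sub>v N) H (\<lambda>m\<^sub>0 n\<^sub>0. m\<^sub>0 \<otimes>\<^bsub>M,N\<^esub> n\<^sub>0) (*) (rcoact M m) (rcoact N n))),
       lcoact = (\<lambda>t. sw M N (H \<otimes>\<^sub>v (M \<otimes>\<^sub>v N)) t (\<lambda>m n.
         tprod H M H N H (M \<otimes>\<^sub>v N) (*) (\<lambda>m\<^sub>0 n\<^sub>0. m\<^sub>0 \<otimes>\<^bsub>M,N\<^esub> n\<^sub>0) (lcoact M m) (lcoact N n))) \<rparr>"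

section \<open>Rational morphisms\<close>

text \<open>Left coactions are written \<open>m \<mapsto> l \<otimes> m\<^sub>0\<close>, with \<open>l\<close> standing for the Sweedler factor of index \<open>-1\<close>.\<close>

definition right_ad :: "('k::field, 'h::ring_1) hopf \<Rightarrow> ('k, 'h, 'm::ab_group_add) bimod
    \<Rightarrow> ('k, 'h, 'n::ab_group_add) bimod \<Rightarrow> ('m \<Rightarrow> 'n) \<Rightarrow> 'm \<Rightarrow> ('k, 'n, 'h) tens" where
  "right_ad H M N \<phi> m =
     sw M H (N \<otimes>\<^sub>v H) (rcoact M m) (\<lambda>m\<^sub>0 m\<^sub>1.
       sw N H (N \<otimes>\<^sub>v H) (rcoact N (\<phi> m\<^sub>0)) (\<lambda>n\<^sub>0 n\<^sub>1. n\<^sub>0 \<otimes>\<^bsub>N,H\<^esub> (n\<^sub>1 * antipode H m\<^sub>1)))"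

definition left_ad :: "('k::field, 'h::ring_1) hopf \<Rightarrow> ('k, 'h, 'm::ab_group_add) bimod
    \<Rightarrow> ('k, 'h, 'n::ab_group_add) bimod \<Rightarrow> ('m \<Rightarrow> 'n) \<Rightarrow> 'm \<Rightarrow> ('k, 'h, 'n) tens" where
  "left_ad H M N \<phi> m =
     sw H M (H \<otimes>\<^sub>v N) (lcoact M m) (\<lambda>l m\<^sub>0.
       sw H N (H \<otimes>\<^sub>v N) (lcoact N (\<phi> m\<^sub>0)) (\<lambda>l' n\<^sub>0. (l' * antipode_inv H l) \<otimes>\<^bsub>H,N\<^esub> n\<^sub>0))"

text \<open>
  For a subspace \<open>X\<close> of \<open>Hom(M,N)\<close>, the embeddings of \<open>X \<otimes> H\<close> into \<open>Hom(M, N \<otimes> H)\<close> and of \<open>H \<otimes> X\<close>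
  into \<open>Hom(M, H \<otimes> N)\<close>.
\<close>

definition right_emb :: "('k::field, 'h::ring_1) hopf \<Rightarrow> ('k, 'h, 'n::ab_group_add) bimod
    \<Rightarrow> ('k, 'm::ab_group_add \<Rightarrow> 'n) vs \<Rightarrow> ('k, 'm \<Rightarrow> 'n, 'h) tens \<Rightarrow> 'm \<Rightarrow> ('k, 'n, 'h) tens" where
  "right_emb H N X t m = sw X H (N \<otimes>\<^sub>v H) t (\<lambda>\<phi> h. \<phi> m \<otimes>\<^bsub>N,H\<^esub> h)"

definition left_emb :: "('k::field, 'h::ring_1) hopf \<Rightarrow> ('k, 'h, 'n::ab_group_add) bimod
    \<Rightarrow> ('k, 'm::ab_group_add \<Rightarrow> 'n) vs \<Rightarrow> ('k, 'h, 'm \<Rightarrow> 'n) tens \<Rightarrow> 'm \<Rightarrow> ('k, 'h, 'n) tens" where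
  "left_emb H N X t m = sw H X (H \<otimes>\<^sub>v N) t (\<lambda>h \<phi>. h \<otimes>\<^bsub>H,N\<^esub> \<phi> m)"

definition HOM_space :: "('k::field, 'h::ring_1) hopf \<Rightarrow> ('k, 'h, 'm::ab_group_add) bimod
    \<Rightarrow> ('k, 'h, 'n::ab_group_add) bimod \<Rightarrow> ('k, 'm \<Rightarrow> 'n) vs" where
  "HOM_space H M N =
     \<lparr> carr = {\<phi> \<in> carr (Hom M N).
          (\<exists>t \<in> carr (Hom M N \<otimes>\<^sub>v H). \<forall>m\<in>carr M. right_emb H N (Hom M N) t m = right_ad H M N \<phi> m) \<and>
          (\<exists>t \<in> carr (H \<otimes>\<^sub>v Hom M N). \<forall>m\<in>carr M. left_emb H N (Hom M N) t m = left_ad H M N \<phi> m)},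
       scl = scl (Hom M N) \<rparr>"

definition HOM :: "('k::field, 'h::ring_1) hopf \<Rightarrow> ('k, 'h, 'm::ab_group_add) bimod
    \<Rightarrow> ('k, 'h, 'n::ab_group_add) bimod \<Rightarrow> ('k, 'h, 'm \<Rightarrow> 'n) bimod" where
  "HOM H M N =
     \<lparr> carr = carr (HOM_space H M N),
       scl = scl (HOM_space H M N),
       lact = (\<lambda>a \<phi>. ext0 M (\<lambda>m. lact N a (\<phi> m))),
       ract = (\<lambda>\<phi> b. ext0 M (\<lambda>m. \<phi> (lact M b m))),
       rcoact = (\<lambda>\<phi>. THE t. t \<in> carr (HOM_space H M N \<otimes>\<^sub>v H) \<and>
         (\<forall>m\<in>carr M. right_emb H N (HOM_space H M N) t m = right_ad H M N \<phi> m)),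
       lcoact = (\<lambda>\<phi>. THE t. t \<in> carr (H \<otimes>\<^sub>v HOM_space H M N) \<and>
         (\<forall>m\<in>carr M. left_emb H N (HOM_space H M N) t m = left_ad H M N \<phi> m)) \<rparr>"

section \<open>The tensor product of rational morphisms\<close>

text \<open>
  \<open>\<phi>(\<psi>\<^sub>-\<^sub>2 m\<^sub>0 S(\<psi>\<^sub>-\<^sub>1 m\<^sub>1)) \<otimes> \<psi>\<^sub>0(m\<^sub>2 n)\<close>, with \<open>p \<otimes> q \<otimes> \<psi>\<^sub>0\<close> standing for the iterated left coaction of \<open>\<psi>\<close>.
\<close>

definition sigma_formula :: "('k::field, 'h::ring_1) hopf
    \<Rightarrow> ('k, 'h, 'm::ab_group_add) bimod \<Rightarrow> ('k, 'h, 'm'::ab_group_add) bimod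
    \<Rightarrow> ('k, 'h, 'n::ab_group_add) bimod \<Rightarrow> ('k, 'h, 'n'::ab_group_add) bimod
    \<Rightarrow> ('m \<Rightarrow> 'm') \<Rightarrow> ('n \<Rightarrow> 'n') \<Rightarrow> 'm \<Rightarrow> 'n \<Rightarrow> ('k, 'm', 'n') tens" where
  "sigma_formula H M M' N N' \<phi> \<psi> m n =
     sw H (HOM H N N') (M' \<otimes>\<^sub>v N') (lcoact (HOM H N N') \<psi>) (\<lambda>p \<psi>'.
     sw H (HOM H N N') (M' \<otimes>\<^sub>v N') (lcoact (HOM H N N') \<psi>') (\<lambda>q \<psi>\<^sub>0.
     sw M H (M' \<otimes>\<^sub>v N') (rcoact M m) (\<lambda>m' m\<^sub>2.
     sw M H (M' \<otimes>\<^sub>v N') (rcoact M m') (\<lambda>m\<^sub>0 m\<^sub>1.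
       \<phi> (ract M (lact M p m\<^sub>0) (antipode H (q * m\<^sub>1))) \<otimes>\<^bsub>M',N'\<^esub> \<psi>\<^sub>0 (lact N m\<^sub>2 n)))))"

definition sigma_tensor :: "('k::field, 'h::ring_1) hopf
    \<Rightarrow> ('k, 'h, 'm::ab_group_add) bimod \<Rightarrow> ('k, 'h, 'm'::ab_group_add) bimod
    \<Rightarrow> ('k, 'h, 'n::ab_group_add) bimod \<Rightarrow> ('k, 'h, 'n'::ab_group_add) bimod
    \<Rightarrow> ('m \<Rightarrow> 'm') \<Rightarrow> ('n \<Rightarrow> 'n') \<Rightarrow> ('k, 'm, 'n) tens \<Rightarrow> ('k, 'm', 'n') tens" where
  "sigma_tensor H M M' N N' \<phi> \<psi> t = sw M N (M' \<otimes>\<^sub>v N') t (sigma_formula H M M' N N' \<phi> \<psi>)"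

text \<open>The induced linear map on \<open>HOM(M,M') \<otimes> HOM(N,N')\<close>.\<close>

definition sigma_map :: "('k::field, 'h::ring_1) hopf
    \<Rightarrow> ('k, 'h, 'm::ab_group_add) bimod \<Rightarrow> ('k, 'h, 'm'::ab_group_add) bimod
    \<Rightarrow> ('k, 'h, 'n::ab_group_add) bimod \<Rightarrow> ('k, 'h, 'n'::ab_group_add) bimod
    \<Rightarrow> ('k, 'm \<Rightarrow> 'm', 'n \<Rightarrow> 'n') tens \<Rightarrow> ('k, 'm, 'n) tens \<Rightarrow> ('k, 'm', 'n') tens" where
  "sigma_map H M M' N N' t =
     sw (HOM H M M') (HOM H N N') (HOM H (bitensor H M N) (bitensor H M' N')) t
       (sigma_tensor H M M' N N')"

end

theory Submission
  imports Defs
begin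

text \<open>
  Let \<open>P(m) = m\<^sub>0 S(m\<^sub>1)\<close>, the projection of a bicovariant bimodule onto its right coinvariants.  Since
  \<open>P(h m) = h\<^sub>1 m\<^sub>0 S(h\<^sub>2 m\<^sub>1)\<close>, the tensor product of rational morphisms is
  \<open>(\<phi> \<otimes>\<^sub>\<sigma> \<psi>)(m \<otimes> n) = \<phi>(P(\<psi>\<^sub>-\<^sub>1 m\<^sub>0)) \<otimes> \<psi>\<^sub>0(m\<^sub>1 n)\<close>.  The adjoint coactions are characterised without
  antipodes by \<open>\<phi>(m)\<^sub>0 \<otimes> \<phi>(m)\<^sub>1 = \<phi>\<^sub>0(m\<^sub>0) \<otimes> \<phi>\<^sub>1 m\<^sub>1\<close> and its left analogue.  Right colinearity, and with it
  the rationality of \<open>\<phi> \<otimes>\<^sub>\<sigma> \<psi>\<close>, follows because \<open>P(m)\<close> is right coinvariant; left colinearity follows from the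
  left coaction of \<open>P(m)\<close>, which is \<open>m\<^sub>-\<^sub>1 S(m\<^sub>1) \<otimes> P(m\<^sub>0)\<close>.  The decomposition amounts to \<open>P(P(m)) = P(m)\<close>, and
  associativity to left colinearity together with \<open>h\<^sub>1 P(m) S(h\<^sub>2) = P(h m)\<close>.
\<close>

section \<open>Sweedler sums\<close>

text \<open>The iterated coactions in the definitions are nested values of \<open>sw\<close>, a
  definite description that can be computed only once bilinearity in each pair of slots is known.
  The proof leaves \<open>sw\<close> early: each coaction is replaced by a finite list of pure
  tensors, and a Sweedler calculation becomes a manipulation of finite sums. The lists are arbitrary
  choices, so they are compared only through sums of multilinear scalar forms; this is why nearly
  every identity carries a functional. Two obstacles shape the rest. The coactions of
  \<open>HOM\<close> are given implicitly, so the coaction of a tensor product of morphisms is found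
  by exhibiting a candidate, the product of the coactions of the factors, and invoking uniqueness;
  the same check yields rationality. Moreover both sides are needed, yet the formula is not
  symmetric: it uses the left coaction of the second morphism and the right coaction of the first
  argument. The general theory is therefore proved for one side and transported to the co-opposite
  Hopf algebra, whereas the colinearity of the tensor product of morphisms takes a separate argument
  on each side.\<close>

text \<open>
  Identities are tested on scalar valued linear, bilinear and trilinear forms: linear forms separate
  points, and a tensor is by construction a functional on bilinear forms.
\<close>

definition lf :: "('k::field, 'a::ab_group_add, 'z) vs_scheme \<Rightarrow> ('a \<Rightarrow> 'k) \<Rightarrow> bool" where
  "lf V f \<longleftrightarrow> (\<forall>x\<in>carr V. \<forall>y\<in>carr V. f (x + y) = f x + f y)
     \<and> (\<forall>c. \<forall>x\<in>carr V. f (scl V c x) = c * f x)"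

definition bf :: "('k::field, 'a::ab_group_add, 'y) vs_scheme \<Rightarrow> ('k, 'b::ab_group_add, 'z) vs_scheme
    \<Rightarrow> ('a \<Rightarrow> 'b \<Rightarrow> 'k) \<Rightarrow> bool" where
  "bf A B f \<longleftrightarrow> (\<forall>a\<in>carr A. lf B (f a)) \<and> (\<forall>b\<in>carr B. lf A (\<lambda>a. f a b))"

definition tf :: "('k::field, 'a::ab_group_add, 'x) vs_scheme \<Rightarrow> ('k, 'b::ab_group_add, 'y) vs_scheme
    \<Rightarrow> ('k, 'c::ab_group_add, 'z) vs_scheme \<Rightarrow> ('a \<Rightarrow> 'b \<Rightarrow> 'c \<Rightarrow> 'k) \<Rightarrow> bool" where
  "tf A B C f \<longleftrightarrow> (\<forall>a\<in>carr A. bf B C (f a)) \<and> (\<forall>b\<in>carr B. \<forall>c\<in>carr C. lf A (\<lambda>a. f a b c))"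

lemmas mf_defs = lf_def bf_def tf_def

lemma bilin_iff_bf: "bilin A B base_field f \<longleftrightarrow> bf A B f"
  by (auto simp: bilin_def lin_def mf_defs base_field_def)

text \<open>
  The Sweedler sum of \<open>f\<close> over a list of pure tensors.  Pairs outside the carriers are skipped, so that
  \<open>SS_cong\<close> provides membership in the carriers without a side condition on the list.
\<close>

definition SS :: "('k, 'a, 'y) vs_scheme \<Rightarrow> ('k, 'b, 'z) vs_scheme \<Rightarrow> ('a \<times> 'b) list
    \<Rightarrow> ('a \<Rightarrow> 'b \<Rightarrow> 'c::comm_monoid_add) \<Rightarrow> 'c" where
  "SS A B xs f = (\<Sum>(a, b)\<leftarrow>xs. if a \<in> carr A \<and> b \<in> carr B then f a b else 0)"

lemma SS_Nil [simp]: "SS A B [] f = 0"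
  by (simp add: SS_def)

lemma SS_Cons: "SS A B ((a, b) # xs) f = (if a \<in> carr A \<and> b \<in> carr B then f a b else 0) + SS A B xs f"
  by (simp add: SS_def)

lemma SS_append [simp]: "SS A B (xs @ ys) f = SS A B xs f + SS A B ys f"
  by (simp add: SS_def)

lemma SS_single [simp]: "a \<in> carr A \<Longrightarrow> b \<in> carr B \<Longrightarrow> SS A B [(a, b)] f = f a b"
  by (simp add: SS_Cons)

lemma SS_cong [cong]:
  assumes "xs = ys" "\<And>a b. a \<in> carr A \<Longrightarrow> b \<in> carr B \<Longrightarrow> f a b = g a b"
  shows "SS A B xs f = SS A B ys g"
  unfolding SS_def using assms by (intro arg_cong[where f = sum_list] map_cong) auto

lemma SS_add [simp]: "SS A B xs (\<lambda>a b. f a b + g a b) = SS A B xs f + SS A B xs g"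
proof (induction xs)
  case (Cons p xs)
  then show ?case by (cases p) (auto simp: SS_Cons ac_simps)
qed simp

lemma SS_scale [simp]: "SS A B xs (\<lambda>a b. (c::'c::semiring_0) * f a b) = c * SS A B xs f"
proof (induction xs)
  case (Cons p xs)
  then show ?case by (cases p) (auto simp: SS_Cons distrib_left)
qed simp

lemma SS_zero [simp]: "SS A B xs (\<lambda>a b. 0) = 0"
  by (induction xs) (auto simp: SS_Cons)

lemma SS_swap: "SS A B xs (\<lambda>a b. SS C D ys (\<lambda>c d. f a b c d))
    = SS C D ys (\<lambda>c d. SS A B xs (\<lambda>a b. f a b c d))"
proof (induction xs)
  case (Cons p xs)
  obtain a b where p: "p = (a, b)" by (cases p)
  have "SS C D ys (\<lambda>c d. SS A B ((a, b) # xs) (\<lambda>a b. f a b c d))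
     = SS C D ys (\<lambda>c d. (if a \<in> carr A \<and> b \<in> carr B then f a b c d else 0))
       + SS C D ys (\<lambda>c d. SS A B xs (\<lambda>a b. f a b c d))"
    by (simp add: SS_Cons)
  then show ?case using Cons by (cases "a \<in> carr A \<and> b \<in> carr B") (auto simp: p SS_Cons)
qed simp

lemma SS_apply: "SS A B xs f x = SS A B xs (\<lambda>a b. f a b x)"
  by (induction xs) (auto simp: SS_Cons)

lemma SS_sum: "(\<Sum>i\<in>I. SS A B xs (f i)) = SS A B xs (\<lambda>a b. \<Sum>i\<in>I. f i a b)"
  by (induction I rule: infinite_finite_induct) simp_all

lemma SS_flip: "SS A B (map prod.swap xs) f = SS B A xs (\<lambda>b a. f a b)"
  by (induction xs) (auto simp: SS_Cons)

text \<open>List bind: it flattens a nested Sweedler sum into one list, which is needed wherever a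
  coaction has to be exhibited as a single witness.\<close>

definition sbind :: "('k, 'a, 'y) vs_scheme \<Rightarrow> ('k, 'b, 'z) vs_scheme \<Rightarrow> ('a \<times> 'b) list
    \<Rightarrow> ('a \<Rightarrow> 'b \<Rightarrow> 'd list) \<Rightarrow> 'd list" where
  "sbind A B xs k = concat (map (\<lambda>(a, b). if a \<in> carr A \<and> b \<in> carr B then k a b else []) xs)"

lemma SS_sbind [simp]: "SS C D (sbind A B xs k) f = SS A B xs (\<lambda>a b. SS C D (k a b) f)"
  by (induction xs) (auto simp: SS_Cons sbind_def)

lemma vs_module: "is_vs V \<Longrightarrow> module (scl V)"
  by (simp add: is_vs_def vector_space_def module_def)

lemma vs_subspace: "is_vs V \<Longrightarrow> module.subspace (scl V) (carr V)"
  by (simp add: is_vs_def)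

lemma vs_0: "is_vs V \<Longrightarrow> 0 \<in> carr V"
  by (rule module.subspace_0[OF vs_module vs_subspace])

lemma vs_add: "is_vs V \<Longrightarrow> x \<in> carr V \<Longrightarrow> y \<in> carr V \<Longrightarrow> x + y \<in> carr V"
  by (rule module.subspace_add[OF vs_module vs_subspace])

lemma vs_scl: "is_vs V \<Longrightarrow> x \<in> carr V \<Longrightarrow> scl V c x \<in> carr V"
  by (rule module.subspace_scale[OF vs_module vs_subspace])

lemma vs_scl_add: "is_vs V \<Longrightarrow> scl V c (x + y) = scl V c x + scl V c y"
  by (simp add: module.scale_right_distrib vs_module)

lemma vs_scl_scl: "is_vs V \<Longrightarrow> scl V c (scl V d x) = scl V (c * d) x"
  by (simp add: module.scale_scale vs_module)

lemmas vs_closed = vs_0 vs_add vs_scl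

lemma SS_closed: "is_vs W \<Longrightarrow> (\<And>a b. a \<in> carr A \<Longrightarrow> b \<in> carr B \<Longrightarrow> f a b \<in> carr W) \<Longrightarrow> SS A B xs f \<in> carr W"
  by (induction xs) (auto simp: SS_Cons vs_closed)

lemma add_hom_0: "(h::'a::ab_group_add \<Rightarrow> 'b::ab_group_add) (0 + 0) = h 0 + h 0 \<Longrightarrow> h 0 = 0"
  by simp

lemma SS_hom:
  fixes h :: "'c::ab_group_add \<Rightarrow> 'd::ab_group_add"
  assumes W: "is_vs W" and h: "\<And>x y. x \<in> carr W \<Longrightarrow> y \<in> carr W \<Longrightarrow> h (x + y) = h x + h y"
    and f: "\<And>a b. a \<in> carr A \<Longrightarrow> b \<in> carr B \<Longrightarrow> f a b \<in> carr W"
  shows "h (SS A B xs f) = SS A B xs (\<lambda>a b. h (f a b))"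
proof -
  have h0: "h 0 = 0" using h[OF vs_0[OF W] vs_0[OF W]] by (rule add_hom_0)
  show ?thesis
  proof (induction xs)
    case (Cons p xs)
    obtain a b where p: "p = (a, b)" by (cases p)
    have "SS A B xs f \<in> carr W" by (rule SS_closed[OF W f])
    then show ?case using Cons f vs_0[OF W] by (auto simp: p SS_Cons h h0)
  qed (simp add: h0)
qed

lemma SS_lf:
  assumes "is_vs W" "lf W \<gamma>" "\<And>a b. a \<in> carr A \<Longrightarrow> b \<in> carr B \<Longrightarrow> f a b \<in> carr W"
  shows "\<gamma> (SS A B xs f) = SS A B xs (\<lambda>a b. \<gamma> (f a b))"
  using assms by (intro SS_hom) (auto simp: lf_def)

lemma lf_add: "lf V f \<Longrightarrow> x \<in> carr V \<Longrightarrow> y \<in> carr V \<Longrightarrow> f (x + y) = f x + f y"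
  and lf_scl: "lf V f \<Longrightarrow> x \<in> carr V \<Longrightarrow> f (scl V c x) = c * f x"
  by (simp_all add: lf_def)

lemmas lfD = lf_add lf_scl

lemma bf_add1: "bf A B f \<Longrightarrow> x \<in> carr A \<Longrightarrow> y \<in> carr A \<Longrightarrow> b \<in> carr B \<Longrightarrow> f (x + y) b = f x b + f y b"
  and bf_scl1: "bf A B f \<Longrightarrow> x \<in> carr A \<Longrightarrow> b \<in> carr B \<Longrightarrow> f (scl A c x) b = c * f x b"
  and bf_add2: "bf A B f \<Longrightarrow> u \<in> carr B \<Longrightarrow> v \<in> carr B \<Longrightarrow> a \<in> carr A \<Longrightarrow> f a (u + v) = f a u + f a v"
  and bf_scl2: "bf A B f \<Longrightarrow> u \<in> carr B \<Longrightarrow> a \<in> carr A \<Longrightarrow> f a (scl B c u) = c * f a u"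
  by (simp_all add: mf_defs)

lemmas bfD = bf_add1 bf_scl1 bf_add2 bf_scl2

lemma tf_add1: "tf A B C f \<Longrightarrow> x \<in> carr A \<Longrightarrow> y \<in> carr A \<Longrightarrow> b \<in> carr B \<Longrightarrow> c \<in> carr C \<Longrightarrow> f (x + y) b c = f x b c + f y b c"
  and tf_scl1: "tf A B C f \<Longrightarrow> x \<in> carr A \<Longrightarrow> b \<in> carr B \<Longrightarrow> c \<in> carr C \<Longrightarrow> f (scl A r x) b c = r * f x b c"
  and tf_add2: "tf A B C f \<Longrightarrow> a \<in> carr A \<Longrightarrow> u \<in> carr B \<Longrightarrow> v \<in> carr B \<Longrightarrow> c \<in> carr C \<Longrightarrow> f a (u + v) c = f a u c + f a v c"
  and tf_scl2: "tf A B C f \<Longrightarrow> a \<in> carr A \<Longrightarrow> u \<in> carr B \<Longrightarrow> c \<in> carr C \<Longrightarrow> f a (scl B r u) c = r * f a u c"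
  and tf_add3: "tf A B C f \<Longrightarrow> a \<in> carr A \<Longrightarrow> b \<in> carr B \<Longrightarrow> w \<in> carr C \<Longrightarrow> z \<in> carr C \<Longrightarrow> f a b (w + z) = f a b w + f a b z"
  and tf_scl3: "tf A B C f \<Longrightarrow> a \<in> carr A \<Longrightarrow> b \<in> carr B \<Longrightarrow> w \<in> carr C \<Longrightarrow> f a b (scl C r w) = r * f a b w"
  by (simp_all add: mf_defs)

lemmas tfD = tf_add1 tf_scl1 tf_add2 tf_scl2 tf_add3 tf_scl3

lemma lf_sep:
  assumes "is_vs V" "\<And>\<gamma>. lf V \<gamma> \<Longrightarrow> \<gamma> x = \<gamma> y"
  shows "x = y"
proof (rule functional_separates)
  show "vector_space (scl V)" using assms(1) by (simp add: is_vs_def)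
  fix \<gamma> assume "Vector_Spaces.linear (scl V) (*) \<gamma>"
  then interpret L: Vector_Spaces.linear "scl V" "(*)" \<gamma> .
  show "\<gamma> x = \<gamma> y" by (rule assms(2)) (simp add: lf_def L.add L.scale)
qed

section \<open>Tensors, their lists, and the passage from \<open>sw\<close> to finite sums\<close>

lemma ptens_in [simp]: "a \<in> carr A \<Longrightarrow> b \<in> carr B \<Longrightarrow> a \<otimes>\<^bsub>A,B\<^esub> b \<in> carr (A \<otimes>\<^sub>v B)"
proof -
  interpret vector_space "\<lambda>(c::'k::field) (t::'x \<Rightarrow> 'k) \<beta>. c * t \<beta>"
    by (rule vector_space_pointwise)
  show "a \<in> carr A \<Longrightarrow> b \<in> carr B \<Longrightarrow> a \<otimes>\<^bsub>A,B\<^esub> b \<in> carr (A \<otimes>\<^sub>v B)"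
    by (auto simp: tensor_def intro!: span_base)
qed

lemma ptens_ev: "bf A B f \<Longrightarrow> (a \<otimes>\<^bsub>A,B\<^esub> b) f = f a b"
  by (simp add: ptens_def bilin_iff_bf)

lemma tensor_scl [simp]: "scl (A \<otimes>\<^sub>v B) c t f = c * t f"
  by (simp add: tensor_def)

lemma tensor_rep_ex:
  assumes A: "is_vs A" and t: "t \<in> carr (A \<otimes>\<^sub>v B)"
  shows "\<exists>xs. t = SS A B xs (\<lambda>a b. a \<otimes>\<^bsub>A,B\<^esub> b)"
proof -
  interpret T: vector_space "\<lambda>(c::'a) (t::('b \<Rightarrow> 'd \<Rightarrow> 'a) \<Rightarrow> 'a) \<beta>. c * t \<beta>"
    by (rule vector_space_pointwise)
  have "t \<in> T.span {a \<otimes>\<^bsub>A,B\<^esub> b | a b. a \<in> carr A \<and> b \<in> carr B}"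
    using t by (simp add: tensor_def)
  then show ?thesis
  proof (induction rule: T.span_induct_alt)
    case base
    show ?case by (rule exI[of _ "[]"]) simp
  next
    case (step c x y)
    then obtain a b xs where ab: "x = a \<otimes>\<^bsub>A,B\<^esub> b" "a \<in> carr A" "b \<in> carr B"
      and y: "y = SS A B xs (\<lambda>a b. a \<otimes>\<^bsub>A,B\<^esub> b)" by auto
    \<comment> \<open>A scalar is absorbed into the left factor of a pure tensor, so lists need no
      coefficients.\<close>
    have "(\<lambda>\<beta>. c * x \<beta>) = scl A c a \<otimes>\<^bsub>A,B\<^esub> b"
      using ab by (auto simp: ptens_def fun_eq_iff bilin_iff_bf bfD)
    then show ?case
      using ab vs_scl[OF A, of a c] by (intro exI[of _ "(scl A c a, b) # xs"]) (simp add: SS_Cons y)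
  qed
qed

text \<open>
  A list of pure tensors with sum \<open>t\<close>; it is arbitrary if \<open>t\<close> is not in the carrier.
\<close>

definition rep :: "('k::field, 'a::ab_group_add, 'y) vs_scheme \<Rightarrow> ('k, 'b::ab_group_add, 'z) vs_scheme
    \<Rightarrow> ('k, 'a, 'b) tens \<Rightarrow> ('a \<times> 'b) list" where
  "rep A B t = (SOME xs. t = SS A B xs (\<lambda>a b. a \<otimes>\<^bsub>A,B\<^esub> b))"

lemma rep: "is_vs A \<Longrightarrow> t \<in> carr (A \<otimes>\<^sub>v B) \<Longrightarrow> t = SS A B (rep A B t) (\<lambda>a b. a \<otimes>\<^bsub>A,B\<^esub> b)"
  unfolding rep_def using tensor_rep_ex by (rule someI_ex)

lemma SS_ptens_ev: "bf A B f \<Longrightarrow> SS A B xs (\<lambda>a b. a \<otimes>\<^bsub>A,B\<^esub> b) f = SS A B xs f"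
  by (simp add: SS_apply ptens_ev)

lemma SS_ptens_in [simp]: "SS A B xs (\<lambda>a b. a \<otimes>\<^bsub>A,B\<^esub> b) \<in> carr (A \<otimes>\<^sub>v B)"
  by (rule SS_closed) (simp_all add: is_vs_tensor)

text \<open>A tensor is itself a functional on bilinear forms, so evaluating it at \<open>f\<close>
  already gives the Sweedler sum of \<open>f\<close>. Hence the sum does not depend on the list
  chosen by \<open>rep\<close>.\<close>

lemma rep_ev: "is_vs A \<Longrightarrow> t \<in> carr (A \<otimes>\<^sub>v B) \<Longrightarrow> bf A B f \<Longrightarrow> SS A B (rep A B t) f = t f"
  using rep[of A t B] SS_ptens_ev[of A B f "rep A B t"] by simp

lemma rep_lf: "is_vs A \<Longrightarrow> t \<in> carr (A \<otimes>\<^sub>v B) \<Longrightarrow> lf (A \<otimes>\<^sub>v B) v \<Longrightarrow>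
    v t = SS A B (rep A B t) (\<lambda>a b. v (a \<otimes>\<^bsub>A,B\<^esub> b))"
  by (subst rep[of A t B], assumption+, subst SS_lf[where W = "A \<otimes>\<^sub>v B"]) (auto simp: is_vs_tensor)

lemma tensor_eqI:
  assumes A: "is_vs A" and t: "t \<in> carr (A \<otimes>\<^sub>v B)" and u: "u \<in> carr (A \<otimes>\<^sub>v B)"
    and eq: "\<And>f. bf A B f \<Longrightarrow> t f = u f"
  shows "t = u"
proof
  fix f
  \<comment> \<open>Pure tensors vanish by definition on forms that are not bilinear, and so does
    their span; only bilinear forms can tell two tensors apart.\<close>
  have "t f = 0" if "\<not> bf A B f" "t \<in> carr (A \<otimes>\<^sub>v B)" for t
    by (subst rep[OF A that(2)]) (use that(1) in \<open>simp add: SS_apply ptens_def bilin_iff_bf\<close>)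
  from this[OF _ t] this[OF _ u] show "t f = u f" using eq by (cases "bf A B f") auto
qed

lemma bilinI:
  assumes c: "\<And>a b. a \<in> carr A \<Longrightarrow> b \<in> carr B \<Longrightarrow> f a b \<in> carr W" and v: "is_vs A" "is_vs B" "is_vs W"
    and f: "\<And>\<gamma>. lf W \<gamma> \<Longrightarrow> bf A B (\<lambda>a b. \<gamma> (f a b))"
  shows "bilin A B W f"
  unfolding bilin_def lin_def
  by (auto intro!: c lf_sep[OF v(3)] simp: lfD c bfD[OF f] vs_closed v)

lemma linI:
  assumes c: "\<And>a. a \<in> carr A \<Longrightarrow> f a \<in> carr W" and v: "is_vs A" "is_vs W"
    and f: "\<And>\<gamma>. lf W \<gamma> \<Longrightarrow> lf A (\<lambda>a. \<gamma> (f a))"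
  shows "lin A W f"
  unfolding lin_def
  by (auto intro!: c lf_sep[OF v(2)] simp: lfD c lfD[OF f] vs_closed v)

text \<open>For values in a tensor product, evaluation at bilinear forms replaces testing against
  all linear functionals on that tensor product.\<close>

lemma bilinI_tensor:
  assumes "\<And>a b. a \<in> carr A \<Longrightarrow> b \<in> carr B \<Longrightarrow> f a b \<in> carr (C \<otimes>\<^sub>v D)" and v: "is_vs A" "is_vs B" "is_vs C"
    and f: "\<And>\<beta>. bf C D \<beta> \<Longrightarrow> bf A B (\<lambda>a b. f a b \<beta>)"
  shows "bilin A B (C \<otimes>\<^sub>v D) f"
  unfolding bilin_def lin_def
  by (auto intro!: assms(1) tensor_eqI[OF v(3)] vs_closed is_vs_tensor simp: bfD[OF f] assms(1) vs_closed v)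

lemma linI_tensor:
  assumes "\<And>a. a \<in> carr A \<Longrightarrow> f a \<in> carr (C \<otimes>\<^sub>v D)" and v: "is_vs A" "is_vs C"
    and f: "\<And>\<beta>. bf C D \<beta> \<Longrightarrow> lf A (\<lambda>a. f a \<beta>)"
  shows "lin A (C \<otimes>\<^sub>v D) f"
  unfolding lin_def
  by (auto intro!: assms(1) tensor_eqI[OF v(2)] vs_closed is_vs_tensor simp: lfD[OF f] assms(1) vs_closed v)

lemma sw_props:
  assumes "is_vs W" "bilin A B W f"
  shows "(\<lambda>t. sw A B W t f) \<in> carr (Hom (A \<otimes>\<^sub>v B) W)"
    and "a \<in> carr A \<Longrightarrow> b \<in> carr B \<Longrightarrow> sw A B W (a \<otimes>\<^bsub>A,B\<^esub> b) f = f a b"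
  using theI'[OF tensor_universal[OF assms]] unfolding sw_def by auto

text \<open>The exit from the definite description: the map given by \<open>sw\<close> is linear and
  agrees with \<open>f\<close> on pure tensors, so it can be computed along a list for
  \<open>t\<close>.\<close>

lemma sw_eq_SS:
  assumes A: "is_vs A" and W: "is_vs W" and f: "bilin A B W f" and t: "t \<in> carr (A \<otimes>\<^sub>v B)"
  shows "sw A B W t f = SS A B (rep A B t) f"
proof -
  have hom: "sw A B W (x + y) f = sw A B W x f + sw A B W y f"
    if "x \<in> carr (A \<otimes>\<^sub>v B)" "y \<in> carr (A \<otimes>\<^sub>v B)" for x y
    using sw_props(1)[OF W f] that unfolding Hom_def lin_def by simp
  have "sw A B W t f = sw A B W (SS A B (rep A B t) (\<lambda>a b. a \<otimes>\<^bsub>A,B\<^esub> b)) f"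
    using rep[OF A t] by simp
  also have "\<dots> = SS A B (rep A B t) (\<lambda>a b. sw A B W (a \<otimes>\<^bsub>A,B\<^esub> b) f)"
    by (rule SS_hom[where h = "\<lambda>t. sw A B W t f" and W = "A \<otimes>\<^sub>v B"]) (simp_all add: is_vs_tensor hom)
  also have "\<dots> = SS A B (rep A B t) f"
    by (simp add: sw_props(2)[OF W f])
  finally show ?thesis .
qed

lemma sw_closed: "is_vs W \<Longrightarrow> bilin A B W f \<Longrightarrow> t \<in> carr (A \<otimes>\<^sub>v B) \<Longrightarrow> sw A B W t f \<in> carr W"
  using sw_props(1)[of W A B f] by (auto simp: Hom_def lin_def)

lemma sw_lf:
  assumes "is_vs A" "is_vs W" "bilin A B W f" "t \<in> carr (A \<otimes>\<^sub>v B)" "lf W \<gamma>"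
  shows "\<gamma> (sw A B W t f) = SS A B (rep A B t) (\<lambda>a b. \<gamma> (f a b))"
  using assms by (subst sw_eq_SS) (auto simp: bilin_def lin_def intro!: SS_lf[where W = W])

text \<open>Take a basis of \<open>carr W\<close> and keep in \<open>B\<close> the finitely many
  basis vectors that occur in elements of \<open>Z\<close>; \<open>g b\<close> is the coordinate
  along \<open>b\<close>. The expansion of \<open>w\<close> is stated after applying a functional,
  which is how it is used.\<close>

lemma coordinates:
  fixes W :: "('k::field, 'w::ab_group_add, 'v) vs_scheme"
  assumes W: "is_vs W" and Z: "finite Z" "Z \<subseteq> carr W"
  obtains B g where "finite B" "B \<subseteq> carr W" "\<And>b. lf W (g b)"
    and "\<And>p w. lf W p \<Longrightarrow> w \<in> Z \<Longrightarrow> p w = (\<Sum>b\<in>B. g b w * p b)"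
proof -
  interpret W: vector_space "scl W" using W by (simp add: is_vs_def)
  obtain Bs where Bs: "Bs \<subseteq> carr W" "W.independent Bs" "carr W \<subseteq> W.span Bs"
    by (rule W.maximal_independent_subset)
  have sp: "W.span Bs = carr W"
    using Bs W W.span_minimal[of Bs "carr W"] by (auto simp: is_vs_def)
  define g where "g = (\<lambda>b w. W.representation Bs w b)"
  have g: "lf W (g b)" for b
    using Bs(2) by (auto simp: lf_def g_def sp W.representation_add W.representation_scale)
  define B where "B = (\<Union>w\<in>Z. {b. g b w \<noteq> 0})"
  have fin: "finite B"
    unfolding B_def using Z(1) by (auto simp: g_def W.finite_representation)
  have B: "B \<subseteq> carr W"
    using Bs(1) W.representation_ne_zero by (force simp: B_def g_def)
  have w: "w = (\<Sum>b\<in>B. scl W (g b w) b)" if "w \<in> Z" for w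
  proof -
    have "(\<Sum>b | g b w \<noteq> 0. scl W (g b w) b) = w"
      unfolding g_def using that Bs(2) sp Z(2) by (intro W.sum_nonzero_representation_eq) auto
    moreover have "(\<Sum>b | g b w \<noteq> 0. scl W (g b w) b) = (\<Sum>b\<in>B. scl W (g b w) b)"
      using that fin by (intro sum.mono_neutral_left) (auto simp: B_def)
    ultimately show ?thesis by simp
  qed
  have p_sum: "p (\<Sum>b\<in>C. scl W (r b) b) = (\<Sum>b\<in>C. r b * p b)"
    if p: "lf W p" and "C \<subseteq> carr W" "finite C" for p C r
    using that(3,2)
  proof (induction C rule: finite_induct)
    case empty
    show ?case using lf_scl[OF p vs_0[OF W], of 0] by simp
  next
    case (insert b C)
    have "(\<Sum>b\<in>C. scl W (r b) b) \<in> carr W"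
      using insert W by (intro W.subspace_sum) (auto simp: is_vs_def W.subspace_scale)
    then show ?case using insert W by (simp add: lfD[OF p] vs_scl)
  qed
  have "p w = (\<Sum>b\<in>B. g b w * p b)" if "lf W p" "w \<in> Z" for p w
    using w[OF that(2)] p_sum[OF that(1) B fin, of "\<lambda>b. g b w"] by simp
  then show thesis by (rule that[OF fin B g])
qed

text \<open>Expanding every second factor in the vectors of \<open>B\<close> and collecting terms
  leaves second factors in \<open>B\<close>; the first factors become slices of the tensor along the
  functionals \<open>g b\<close>.\<close>

lemma SS_coordinates:
  assumes X: "is_vs X" and F: "bf X W F" and B: "finite B" "B \<subseteq> carr W"
    and eq: "\<And>p w. lf W p \<Longrightarrow> w \<in> Z \<Longrightarrow> p w = (\<Sum>b\<in>B. g b w * p b)"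
    and Z: "snd ` set xs \<inter> carr W \<subseteq> Z"
  shows "SS X W xs F = (\<Sum>b\<in>B. F (SS X W xs (\<lambda>x w. scl X (g b w) x)) b)"
proof -
  have "SS X W xs F = SS X W xs (\<lambda>x w. \<Sum>b\<in>B. g b w * F x b)"
    using Z
  proof (induction xs)
    case (Cons p xs)
    obtain x w where p: "p = (x, w)" by (cases p)
    have "F x w = (\<Sum>b\<in>B. g b w * F x b)" if "x \<in> carr X" "w \<in> carr W"
      using Cons(2) that F by (intro eq) (auto simp: p bf_def)
    moreover have "SS X W xs F = SS X W xs (\<lambda>x w. \<Sum>b\<in>B. g b w * F x b)"
      using Cons by auto
    ultimately show ?case by (simp add: SS_Cons p)
  qed simp
  also have "\<dots> = (\<Sum>b\<in>B. SS X W xs (\<lambda>x w. g b w * F x b))"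
    by (simp add: SS_sum)
  also have "\<dots> = (\<Sum>b\<in>B. F (SS X W xs (\<lambda>x w. scl X (g b w) x)) b)"
  proof (rule sum.cong[OF refl])
    fix b assume "b \<in> B"
    then have b: "b \<in> carr W" using B by auto
    have "F (SS X W xs (\<lambda>x w. scl X (g b w) x)) b = SS X W xs (\<lambda>x w. F (scl X (g b w) x) b)"
      using b F X by (intro SS_lf[where W = X and \<gamma> = "\<lambda>x. F x b"]) (auto simp: bf_def vs_scl)
    then show "SS X W xs (\<lambda>x w. g b w * F x b) = F (SS X W xs (\<lambda>x w. scl X (g b w) x)) b"
      using b by (simp add: bfD[OF F])
  qed
  finally show ?thesis .
qed

text \<open>Supplies a list for the same tensor in which each first factor is a slice along a
  functional. For adjoint coactions this places the first factors in the space of rational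
  maps.\<close>

lemma list_coordinates:
  fixes W :: "('k::field, 'w::ab_group_add, 'v) vs_scheme"
  assumes W: "is_vs W" and X: "is_vs X"
  obtains ys where "\<And>F. bf X W F \<Longrightarrow> SS X W ys F = SS X W xs F"
    and "\<And>x w. (x, w) \<in> set ys \<Longrightarrow> \<exists>g. lf W g \<and> x = SS X W xs (\<lambda>x w. scl X (g w) x)"
proof -
  let ?Z = "snd ` set xs \<inter> carr W"
  obtain B g where B: "finite B" "B \<subseteq> carr W" and g: "\<And>b. lf W (g b)"
    and eq: "\<And>p w. lf W p \<Longrightarrow> w \<in> ?Z \<Longrightarrow> p w = (\<Sum>b\<in>B. g b w * p b)"
    by (rule coordinates[OF W, of ?Z]) auto
  obtain bs where bs: "set bs = B" "distinct bs" using finite_distinct_list[OF B(1)] by auto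
  let ?x = "\<lambda>b. SS X W xs (\<lambda>x w. scl X (g b w) x)"
  have x: "?x b \<in> carr X" for b by (rule SS_closed[OF X]) (rule vs_scl[OF X])
  show thesis
  proof (rule that)
    show "SS X W (map (\<lambda>b. (?x b, b)) bs) F = SS X W xs F" if F: "bf X W F" for F
    proof -
      have "SS X W (map (\<lambda>b. (?x b, b)) cs) F = (\<Sum>b\<leftarrow>cs. F (?x b) b)" if "set cs \<subseteq> B" for cs
        using that
      proof (induction cs)
        case (Cons c cs)
        then have "c \<in> carr W" using B by auto
        then show ?case using Cons x by (simp add: SS_Cons)
      qed simp
      then have "SS X W (map (\<lambda>b. (?x b, b)) bs) F = (\<Sum>b\<in>B. F (?x b) b)"
        using bs by (simp add: sum_list_distinct_conv_sum_set)
      then show ?thesis using SS_coordinates[OF X F B eq order_refl] by simp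
    qed
    show "\<exists>g. lf W g \<and> x = SS X W xs (\<lambda>x w. scl X (g w) x)" if "(x, w) \<in> set (map (\<lambda>b. (?x b, b)) bs)" for x w
      using that g by auto
  qed
qed

text \<open>Leaves open the space that holds the first factors of an adjoint coaction: it is all of
  \<open>Hom\<close> while rationality is being proved, and the rational maps afterwards.\<close>

definition homsp :: "('k::field, 'm::ab_group_add, 'y) vs_scheme \<Rightarrow> ('k, 'n::ab_group_add, 'z) vs_scheme
    \<Rightarrow> ('k, 'm \<Rightarrow> 'n, 'x) vs_scheme \<Rightarrow> bool" where
  "homsp M N X \<longleftrightarrow> is_vs X \<and> carr X \<subseteq> carr (Hom M N) \<and> scl X = scl (Hom M N)"

text \<open>
  Application as a constant, so that linearity in the function and in the argument can be stated as
  rewrite rules.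
\<close>

definition ev :: "('m \<Rightarrow> 'n) \<Rightarrow> 'm \<Rightarrow> 'n" where "ev f m = f m"

lemma ev_closed: "homsp M N X \<Longrightarrow> f \<in> carr X \<Longrightarrow> m \<in> carr M \<Longrightarrow> ev f m \<in> carr N"
  and ev_add: "homsp M N X \<Longrightarrow> f \<in> carr X \<Longrightarrow> m \<in> carr M \<Longrightarrow> n \<in> carr M \<Longrightarrow> ev f (m + n) = ev f m + ev f n"
  and ev_scl: "homsp M N X \<Longrightarrow> f \<in> carr X \<Longrightarrow> m \<in> carr M \<Longrightarrow> ev f (scl M c m) = scl N c (ev f m)"
  and ev_scl1: "homsp M N X \<Longrightarrow> ev (scl X c f) m = scl N c (ev f m)"
  and homsp_vs: "homsp M N X \<Longrightarrow> is_vs X"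
  by (auto simp: homsp_def ev_def Hom_def lin_def)

lemma homsp_add: "homsp M N X \<Longrightarrow> f \<in> carr X \<Longrightarrow> g \<in> carr X \<Longrightarrow> f + g \<in> carr X"
  by (simp add: homsp_def vs_add)

lemma homsp_scl: "homsp M N X \<Longrightarrow> f \<in> carr X \<Longrightarrow> scl X c f \<in> carr X"
  by (rule vs_scl) (simp_all add: homsp_def)

lemma ev_plus: "ev (f + g) m = ev f m + ev g m"
  by (simp add: ev_def)

lemmas homspD = ev_closed ev_add ev_scl ev_scl1 homsp_vs homsp_add homsp_scl

lemma hom_eqI:
  assumes "homsp M N X" "f \<in> carr X" "g \<in> carr X" "\<And>m. m \<in> carr M \<Longrightarrow> ev f m = ev g m"
  shows "f = g"
proof
  fix m
  have "h m = 0" if "h \<in> carr X" "m \<notin> carr M" for h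
    using that assms(1) by (auto simp: homsp_def Hom_def)
  from this[of f] this[of g] show "f m = g m"
    using assms(2-4) by (cases "m \<in> carr M") (auto simp: ev_def)
qed

lemma ev_SS: "ev (SS A B xs f) m = SS A B xs (\<lambda>a b. ev (f a b) m)"
  by (simp add: ev_def SS_apply)

lemma SS_ev_lf:
  assumes "homsp M N X" "is_vs N" "lf N p" "m \<in> carr M" "\<And>a b. a \<in> carr A \<Longrightarrow> b \<in> carr B \<Longrightarrow> f a b \<in> carr X"
  shows "p (ev (SS A B xs f) m) = SS A B xs (\<lambda>a b. p (ev (f a b) m))"
  unfolding ev_SS using assms by (intro SS_lf[where W = N]) (auto simp: homspD)

text \<open>
  Injectivity of \<open>X \<otimes> W \<rightarrow> Hom(M, N \<otimes> W)\<close> for a subspace \<open>X\<close> of \<open>Hom(M, N)\<close>.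
\<close>

lemma hom_sep:
  fixes W :: "('k::field, 'w::ab_group_add, 'v) vs_scheme"
  assumes W: "is_vs W" and N: "is_vs N" and X: "homsp M N X"
    and eq: "\<And>m f. m \<in> carr M \<Longrightarrow> bf N W f \<Longrightarrow> SS X W xs (\<lambda>x w. f (ev x m) w) = SS X W ys (\<lambda>x w. f (ev x m) w)"
    and F: "bf X W F"
  shows "SS X W xs F = SS X W ys F"
proof -
  let ?Z = "snd ` set (xs @ ys) \<inter> carr W"
  obtain B g where B: "finite B" "B \<subseteq> carr W" and g: "\<And>b. lf W (g b)"
    and co: "\<And>p w. lf W p \<Longrightarrow> w \<in> ?Z \<Longrightarrow> p w = (\<Sum>b\<in>B. g b w * p b)"
    by (rule coordinates[OF W, of ?Z]) auto
  have vX: "is_vs X" using X by (simp add: homsp_def)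
  \<comment> \<open>Corresponding slices of the two lists agree as maps: at a point \<open>m\<close>
    and under a functional \<open>p\<close> they are the sums of the bilinear form
    \<open>g b w * p n\<close>, to which the hypothesis \<open>eq\<close> applies.\<close>
  have "SS X W xs (\<lambda>x w. scl X (g b w) x) = SS X W ys (\<lambda>x w. scl X (g b w) x)" for b
  proof (rule hom_eqI[OF X])
    fix m assume m: "m \<in> carr M"
    show "ev (SS X W xs (\<lambda>x w. scl X (g b w) x)) m = ev (SS X W ys (\<lambda>x w. scl X (g b w) x)) m"
    proof (rule lf_sep[OF N])
      fix p assume p: "lf N p"
      have "p (ev (SS X W zs (\<lambda>x w. scl X (g b w) x)) m) = SS X W zs (\<lambda>x w. g b w * p (ev x m))" for zs
        by (subst SS_ev_lf[OF X N p m]) (simp_all add: homspD[OF X] lfD[OF p] m)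
      moreover have "bf N W (\<lambda>n w. g b w * p n)"
        using p g[of b] by (simp add: mf_defs distrib_right distrib_left mult_ac)
      ultimately show "p (ev (SS X W xs (\<lambda>x w. scl X (g b w) x)) m) = p (ev (SS X W ys (\<lambda>x w. scl X (g b w) x)) m)"
        using eq[OF m, of "\<lambda>n w. g b w * p n"] by simp
    qed
  qed (auto intro: SS_closed vX vs_scl)
  moreover have "SS X W zs F = (\<Sum>b\<in>B. F (SS X W zs (\<lambda>x w. scl X (g b w) x)) b)" if "set zs \<subseteq> set (xs @ ys)" for zs
    by (rule SS_coordinates[OF vX F B, of ?Z g zs]) (use co that in auto)
  ultimately show ?thesis by simp
qed

section \<open>Hopf algebras and covariant bimodules\<close>

text \<open>
  The coproduct enters through lists \<open>dl h\<close> of pure tensors with sum \<open>\<Delta>(h)\<close>.  The co-opposite Hopf algebra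
  then has the flipped lists and the inverse antipode (\<open>hopfL_cop\<close>), and a left coaction is a right
  coaction of it; so every statement about right coactions also serves for left ones.
\<close>

locale hopfL =
  fixes H :: "('k::field, 'h::ring_1, 'z) vs_scheme"
    and dl :: "'h \<Rightarrow> ('h \<times> 'h) list" and eps :: "'h \<Rightarrow> 'k" and S :: "'h \<Rightarrow> 'h"
  assumes vsH: "is_vs H" and carrH: "carr H = UNIV"
    and scl_mult_left: "scl H c a * b = scl H c (a * b)"
    and scl_mult_right: "a * scl H c b = scl H c (a * b)"
    and S_add: "S (a + b) = S a + S b" and S_scl: "S (scl H c a) = scl H c (S a)"
    and eps_add: "eps (a + b) = eps a + eps b" and eps_scl: "eps (scl H c a) = c * eps a"
    and eps_mult: "eps (a * b) = eps a * eps b" and eps_one: "eps 1 = 1"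
    and dl_add: "bf H H f \<Longrightarrow> SS H H (dl (a + b)) f = SS H H (dl a) f + SS H H (dl b) f"
    and dl_scl: "bf H H f \<Longrightarrow> SS H H (dl (scl H c a)) f = c * SS H H (dl a) f"
    and dl_coassoc: "tf H H H g \<Longrightarrow> SS H H (dl a) (\<lambda>x y. SS H H (dl x) (\<lambda>u v. g u v y))
        = SS H H (dl a) (\<lambda>x y. SS H H (dl y) (\<lambda>u v. g x u v))"
    and counit1: "lf H p \<Longrightarrow> SS H H (dl a) (\<lambda>x y. eps x * p y) = p a"
    and counit2: "lf H p \<Longrightarrow> SS H H (dl a) (\<lambda>x y. eps y * p x) = p a"
    and dl_mult: "bf H H f \<Longrightarrow> SS H H (dl (a * b)) f
        = SS H H (dl a) (\<lambda>x y. SS H H (dl b) (\<lambda>u v. f (x * u) (y * v)))"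
    and dl_one: "bf H H f \<Longrightarrow> SS H H (dl 1) f = f 1 1"
    and anti1: "lf H p \<Longrightarrow> SS H H (dl a) (\<lambda>x y. p (S x * y)) = eps a * p 1"
    and anti2: "lf H p \<Longrightarrow> SS H H (dl a) (\<lambda>x y. p (x * S y)) = eps a * p 1"
begin

abbreviation "SD a \<equiv> SS H H (dl a)"

text \<open>Simplification with this set discharges the multilinearity side conditions:
  \<open>mf_defs\<close> reduces them to additivity and homogeneity in each slot, and the remaining
  rules push sums and scalars through all operations.\<close>

lemmas linH = vsH carrH scl_mult_left scl_mult_right S_add S_scl eps_add eps_scl dl_add dl_scl
  distrib_left distrib_right mf_defs vs_add[OF vsH] vs_scl[OF vsH] mult.assoc

lemma S_one: "S 1 = 1"
proof (rule lf_sep[OF vsH])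
  fix p assume p: "lf H p"
  note [simp] = lfD[OF p]
  show "p (S 1) = p 1" using anti1[OF p, of 1] by (simp add: dl_one linH eps_one)
qed

text \<open>Apply \<open>eps\<close> to \<open>S(a_1) a_2 = eps(a) 1\<close> and use
  multiplicativity and the counit law.\<close>

lemma eps_S: "eps (S a) = eps a"
proof -
  have "lf H eps" "lf H (\<lambda>x. eps (S x))" by (simp_all add: linH)
  from anti1[OF this(1), of a] counit2[OF this(2), of a] show ?thesis
    by (simp add: eps_mult eps_one mult.commute)
qed

text \<open>Uniqueness of convolution inverses: \<open>S(a b)\<close> and \<open>S(b) S(a)\<close>
  are both inverse to multiplication. The sum \<open>?X\<close> is
  \<open>S(a_1 b_1) a_2 b_2 S(b_3) S(a_3)\<close>, collapsed once from the right and once from the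
  left.\<close>

lemma S_mult: "S (a * b) = S b * S a"
proof (rule lf_sep[OF vsH])
  fix p assume p: "lf H p"
  note [simp] = lfD[OF p]
  let ?X = "SD a (\<lambda>a1 a'. SD b (\<lambda>b1 b'. SD a' (\<lambda>a2 a3. SD b' (\<lambda>b2 b3.
     p (S (a1 * b1) * (a2 * (b2 * (S b3 * S a3))))))))"
  have "SD b' (\<lambda>b2 b3. p (S (a1 * b1) * (a2 * (b2 * (S b3 * S a3)))))
     = eps b' * p (S (a1 * b1) * (a2 * S a3))" for a1 b1 a2 a3 b'
    using anti2[of "\<lambda>z. p (S (a1 * b1) * (a2 * (z * S a3)))" b'] by (simp add: linH)
  moreover have "SD a' (\<lambda>a2 a3. p (S (a1 * b1) * (a2 * S a3))) = eps a' * p (S (a1 * b1))" for a1 b1 a'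
    using anti2[of "\<lambda>z. p (S (a1 * b1) * z)" a'] by (simp add: linH)
  moreover have "SD b (\<lambda>b1 b'. eps b' * p (S (a1 * b1))) = p (S (a1 * b))" for a1
    using counit2[of "\<lambda>b1. p (S (a1 * b1))" b] by (simp add: linH)
  moreover have "SD a (\<lambda>a1 a'. eps a' * p (S (a1 * b))) = p (S (a * b))"
    using counit2[of "\<lambda>a1. p (S (a1 * b))" a] by (simp add: linH)
  ultimately have 1: "?X = p (S (a * b))" by (simp add: mult.left_commute)
  have "?X = SD a (\<lambda>a1 a'. SD a' (\<lambda>a2 a3. SD b (\<lambda>b1 b'. SD b' (\<lambda>b2 b3.
     p (S (a1 * b1) * (a2 * b2) * (S b3 * S a3))))))"
    by (rule SS_cong[OF refl], subst SS_swap) (simp add: mult.assoc)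
  also have "\<dots> = SD a (\<lambda>a' a3. SD a' (\<lambda>a1 a2. SD b (\<lambda>b' b3. SD b' (\<lambda>b1 b2.
     p (S (a1 * b1) * (a2 * b2) * (S b3 * S a3))))))"
    by (simp add: dl_coassoc linH)
  also have "\<dots> = SD a (\<lambda>a' a3. SD b (\<lambda>b' b3. SD (a' * b') (\<lambda>x y.
     p (S x * y * (S b3 * S a3)))))"
    by (rule SS_cong[OF refl], subst SS_swap) (simp add: dl_mult linH)
  also have "\<dots> = p (S b * S a)"
    using anti1[of "\<lambda>z. p (z * (S b3 * S a3))" for b3 a3]
      counit1[of "\<lambda>z. p (S z * S a3)" for a3] counit1[of "\<lambda>z. p (S b * S z)"]
    by (simp add: linH eps_mult)
  finally show "p (S (a * b)) = p (S b * S a)" using 1 by simp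
qed

text \<open>The same argument for maps into \<open>H \<otimes> H\<close>: both sides are convolution
  inverses of the coproduct. Here \<open>?X\<close> is
  \<open>\<Delta>(S(a_1)) \<Delta>(a_2) (S(a_4) \<otimes> S(a_3))\<close>, and \<open>eq4\<close>
  collapses its last two factors.\<close>

lemma dl_S:
  assumes f: "bf H H f"
  shows "SD (S a) f = SD a (\<lambda>x y. f (S y) (S x))"
proof -
  note [simp] = bfD[OF f]
  let ?X = "SD a (\<lambda>x w. SD w (\<lambda>b c. SD (S x) (\<lambda>u v. SD b (\<lambda>p q. SD c (\<lambda>r s.
     f (u * (p * S s)) (v * (q * S r)))))))"
  have eq4: "SD w (\<lambda>b c. SD b (\<lambda>p q. SD c (\<lambda>r s. f (u * (p * S s)) (v * (q * S r)))))
     = eps w * f u v" for u v w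
  proof -
    have "SD w (\<lambda>b c. SD b (\<lambda>p q. SD c (\<lambda>r s. f (u * (p * S s)) (v * (q * S r)))))
       = SD w (\<lambda>p d. SD d (\<lambda>e s. SD e (\<lambda>q r. f (u * (p * S s)) (v * (q * S r)))))"
      by (simp add: dl_coassoc linH)
    also have "\<dots> = eps w * f u v"
      using anti2[of "\<lambda>z. f (u * (p * S s)) (v * z)" for p s]
        counit1[of "\<lambda>s. f (u * (p * S s)) v" for p] anti2[of "\<lambda>z. f (u * z) v"]
      by (simp add: linH)
    finally show ?thesis .
  qed
  have "?X = SD a (\<lambda>x w. SD (S x) (\<lambda>u v. SD w (\<lambda>b c. SD b (\<lambda>p q. SD c (\<lambda>r s.
     f (u * (p * S s)) (v * (q * S r)))))))"
    by (rule SS_cong[OF refl]) (rule SS_swap)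
  also have "\<dots> = SD (S a) f"
    using counit2[of "\<lambda>x. SD (S x) f"] by (simp add: eq4 linH)
  finally have 1: "?X = SD (S a) f" .
  have "?X = SD a (\<lambda>w c. SD w (\<lambda>x b. SD (S x * b) (\<lambda>y z. SD c (\<lambda>r s.
     f (y * S s) (z * S r)))))"
    by (simp add: dl_mult linH dl_coassoc)
  also have "\<dots> = SD a (\<lambda>r s. f (S s) (S r))"
    using anti1[of "\<lambda>k. SD k (\<lambda>y z. SD c (\<lambda>r s. f (y * S s) (z * S r)))" for c]
      counit1[of "\<lambda>c. SD c (\<lambda>r s. f (S s) (S r))"]
    by (simp add: linH dl_one)
  finally show ?thesis using 1 by simp
qed

end

text \<open>Applying \<open>inv S\<close>, which reverses products, to
  \<open>S(a_1) a_2 = eps(a) 1\<close> gives \<open>inv S (a_2) a_1 = eps(a) 1\<close>, the antipode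
  axiom for the flipped coproduct.\<close>

lemma hopfL_cop:
  assumes "hopfL H dl eps S" and bij: "bij S" and dlc: "\<And>a. dlc a = map prod.swap (dl a)"
  shows "hopfL H dlc eps (inv S)"
proof -
  interpret hopfL H dl eps S by fact
  have SI: "S (inv S x) = x" and IS: "inv S (S x) = x" for x
    using bij by (simp_all add: bij_is_surj surj_f_inv_f bij_is_inj inv_f_f)
  have inj: "x = y" if "S x = S y" for x y using that IS by metis
  have Iadd: "inv S (a + b) = inv S a + inv S b" for a b by (rule inj) (simp add: SI S_add)
  have Iscl: "inv S (scl H c a) = scl H c (inv S a)" for c a by (rule inj) (simp add: SI S_scl)
  have Imult: "inv S (a * b) = inv S b * inv S a" for a b by (rule inj) (simp add: SI S_mult)
  have I1: "inv S 1 = 1" by (rule inj) (simp add: SI S_one)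
  have flip: "bf H H (\<lambda>x y. f y x)" if "bf H H f" for f using that by (simp add: mf_defs)
  show ?thesis
  proof
    show "SS H H (dlc a) (\<lambda>x y. SS H H (dlc x) (\<lambda>u v. g u v y)) = SS H H (dlc a) (\<lambda>x y. SS H H (dlc y) (g x))"
      if "tf H H H g" for a g
      using dl_coassoc[of "\<lambda>x y z. g z y x" a] that by (simp add: dlc SS_flip mf_defs carrH)
    show "SS H H (dlc a) (\<lambda>x y. p (inv S x * y)) = eps a * p 1" if p: "lf H p" for a p
      using anti1[of "\<lambda>x. p (inv S x)" a] lfD[OF p] by (simp add: dlc SS_flip Imult IS I1 linH Iadd Iscl)
    show "SS H H (dlc a) (\<lambda>x y. p (x * inv S y)) = eps a * p 1" if p: "lf H p" for a p
      using anti2[of "\<lambda>x. p (inv S x)" a] lfD[OF p] by (simp add: dlc SS_flip Imult IS I1 linH Iadd Iscl)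
  qed (simp_all add: linH Iadd Iscl eps_mult eps_one dlc SS_flip counit1 counit2 dl_one flip dl_mult
         del: mf_defs add: flip)
qed

text \<open>The map \<open>rr\<close> into lists is not linear itself, since a tensor does not
  determine its list; linearity and the coaction axioms are therefore imposed on the sums of
  forms.\<close>

locale rcov = hopfL H dl eps S
  for H :: "('k::field, 'h::ring_1, 'z) vs_scheme" and dl eps S +
  fixes V :: "('k, 'v::ab_group_add, 'y) vs_scheme"
    and la :: "'h \<Rightarrow> 'v \<Rightarrow> 'v" and ra :: "'v \<Rightarrow> 'h \<Rightarrow> 'v" and rr :: "'v \<Rightarrow> ('v \<times> 'h) list"
  assumes vsV: "is_vs V"
    and la_closed: "m \<in> carr V \<Longrightarrow> la a m \<in> carr V"
    and la_add1: "m \<in> carr V \<Longrightarrow> la (a + b) m = la a m + la b m"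
    and la_add2: "m \<in> carr V \<Longrightarrow> n \<in> carr V \<Longrightarrow> la a (m + n) = la a m + la a n"
    and la_scl1: "m \<in> carr V \<Longrightarrow> la (scl H c a) m = scl V c (la a m)"
    and la_scl2: "m \<in> carr V \<Longrightarrow> la a (scl V c m) = scl V c (la a m)"
    and ra_closed: "m \<in> carr V \<Longrightarrow> ra m a \<in> carr V"
    and ra_add1: "m \<in> carr V \<Longrightarrow> ra m (a + b) = ra m a + ra m b"
    and ra_add2: "m \<in> carr V \<Longrightarrow> n \<in> carr V \<Longrightarrow> ra (m + n) a = ra m a + ra n a"
    and ra_scl1: "m \<in> carr V \<Longrightarrow> ra m (scl H c a) = scl V c (ra m a)"
    and ra_scl2: "m \<in> carr V \<Longrightarrow> ra (scl V c m) a = scl V c (ra m a)"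
    and la_one: "m \<in> carr V \<Longrightarrow> la 1 m = m"
    and la_mult: "m \<in> carr V \<Longrightarrow> la (a * b) m = la a (la b m)"
    and ra_one: "m \<in> carr V \<Longrightarrow> ra m 1 = m"
    and ra_mult: "m \<in> carr V \<Longrightarrow> ra m (a * b) = ra (ra m a) b"
    and la_ra: "m \<in> carr V \<Longrightarrow> ra (la a m) b = la a (ra m b)"
    and rr_add: "m \<in> carr V \<Longrightarrow> n \<in> carr V \<Longrightarrow> bf V H f \<Longrightarrow>
      SS V H (rr (m + n)) f = SS V H (rr m) f + SS V H (rr n) f"
    and rr_scl: "m \<in> carr V \<Longrightarrow> bf V H f \<Longrightarrow> SS V H (rr (scl V c m)) f = c * SS V H (rr m) f"
    and rr_coassoc: "m \<in> carr V \<Longrightarrow> tf V H H g \<Longrightarrow> SS V H (rr m) (\<lambda>x b. SS V H (rr x) (\<lambda>y a. g y a b))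
      = SS V H (rr m) (\<lambda>x c. SS H H (dl c) (\<lambda>a b. g x a b))"
    and rr_counit: "m \<in> carr V \<Longrightarrow> lf V p \<Longrightarrow> SS V H (rr m) (\<lambda>x a. eps a * p x) = p m"
    and rr_la: "m \<in> carr V \<Longrightarrow> bf V H f \<Longrightarrow> SS V H (rr (la a m)) f
      = SS H H (dl a) (\<lambda>b c. SS V H (rr m) (\<lambda>x d. f (la b x) (c * d)))"
    and rr_ra: "m \<in> carr V \<Longrightarrow> bf V H f \<Longrightarrow> SS V H (rr (ra m a)) f
      = SS V H (rr m) (\<lambda>x d. SS H H (dl a) (\<lambda>b c. f (ra x b) (d * c)))"
begin

abbreviation "SR m \<equiv> SS V H (rr m)"

lemmas linV0 = vsV la_closed la_add1 la_add2 la_scl1 la_scl2 ra_closed ra_add1 ra_add2 ra_scl1 ra_scl2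
  rr_add rr_scl vs_add[OF vsV] vs_scl[OF vsV]

text \<open>
  The projection onto the right coinvariants.
\<close>

definition P :: "'v \<Rightarrow> 'v" where
  "P m = SR m (\<lambda>x a. ra x (S a))"

lemma P_closed: "P m \<in> carr V"
  unfolding P_def by (rule SS_closed[OF vsV]) (rule ra_closed)

lemma P_ev: "lf V p \<Longrightarrow> p (P m) = SR m (\<lambda>x a. p (ra x (S a)))"
  unfolding P_def by (rule SS_lf[OF vsV]) (auto intro: ra_closed)

lemma P_add: "m \<in> carr V \<Longrightarrow> n \<in> carr V \<Longrightarrow> P (m + n) = P m + P n"
  by (rule lf_sep[OF vsV]) (simp add: P_ev P_closed linH linV0)

lemma P_scl: "m \<in> carr V \<Longrightarrow> P (scl V c m) = scl V c (P m)"
  by (rule lf_sep[OF vsV]) (simp add: P_ev P_closed linH linV0)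

lemmas linV = linV0 P_closed P_add P_scl

text \<open>The antipode reverses coproducts, so the coaction of \<open>P m\<close> is
  \<open>m_0 S(m_3) \<otimes> m_1 S(m_2)\<close>, in which the inner pair cancels.\<close>

lemma rr_P:
  assumes m: "m \<in> carr V" and f: "bf V H f"
  shows "SR (P m) f = f (P m) 1"
proof -
  note [simp] = bfD[OF f]
  have "SR (P m) f = SR m (\<lambda>a b. SR a (\<lambda>c d. SD b (\<lambda>e g. f (ra c (S g)) (d * S e))))"
    using P_ev[of "\<lambda>x. SR x f" m] by (simp add: f linH linV rr_ra dl_S)
  also have "\<dots> = SR m (\<lambda>c w. SD w (\<lambda>d b. SD b (\<lambda>e g. f (ra c (S g)) (d * S e))))"
    by (subst rr_coassoc[OF m]) (simp_all add: linH linV)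
  also have "\<dots> = SR m (\<lambda>c w. SD w (\<lambda>b g. SD b (\<lambda>d e. f (ra c (S g)) (d * S e))))"
    by (simp add: dl_coassoc linH linV)
  also have "\<dots> = f (P m) 1"
    using anti2[of "\<lambda>z. f (ra c (S g)) z" for c g] counit1[of "\<lambda>g. f (ra c (S g)) 1" for c]
      P_ev[of "\<lambda>x. f x 1" m]
    by (simp add: linH linV)
  finally show ?thesis .
qed

lemma P_P: "m \<in> carr V \<Longrightarrow> P (P m) = P m"
proof (rule lf_sep[OF vsV])
  fix p assume m: "m \<in> carr V" and p: "lf V p"
  note [simp] = lfD[OF p]
  show "p (P (P m)) = p (P m)"
    by (simp add: P_ev[OF p, of "P m"] m rr_P linH linV S_one ra_one)
qed

lemma P_la:
  assumes m: "m \<in> carr V" and p: "lf V p"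
  shows "p (P (la a m)) = SD a (\<lambda>b c. SR m (\<lambda>x d. p (ra (la b x) (S (c * d)))))"
  using lfD[OF p] by (simp add: P_ev[OF p] rr_la m linH linV)

text \<open>By \<open>S_mult\<close>, \<open>S(m_1) S(a_2) = S(a_2 m_1)\<close>, so the adjoint
  action of \<open>a\<close> on \<open>P m\<close> is absorbed into the argument of
  \<open>P\<close>.\<close>

lemma P_ad:
  assumes m: "m \<in> carr V" and p: "lf V p"
  shows "SD a (\<lambda>b c. p (la b (ra (P m) (S c)))) = p (P (la a m))"
proof -
  note [simp] = lfD[OF p]
  have "p (la b (ra (P m) (S c))) = SR m (\<lambda>x d. p (ra (la b x) (S (c * d))))" for b c
    using P_ev[of "\<lambda>y. p (la b (ra y (S c)))" m] by (simp add: linH linV la_ra S_mult ra_mult)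
  then show ?thesis by (simp add: P_la[OF m p])
qed

end

text \<open>
  The list \<open>ll m\<close> of the left coaction consists of pairs with the element of \<open>H\<close> in second position.
\<close>

locale bicov =
  R: rcov H dl eps S V la ra rr + L: rcov H dlc eps Si V la ra ll
  for H :: "('k::field, 'h::ring_1, 'z) vs_scheme" and dl dlc eps S Si
    and V :: "('k, 'v::ab_group_add, 'y) vs_scheme" and la ra rr ll +
  assumes dlc: "dlc a = map prod.swap (dl a)"
    and comm: "m \<in> carr V \<Longrightarrow> tf V H H g \<Longrightarrow>
      SS V H (rr m) (\<lambda>x a. SS V H (ll x) (\<lambda>y b. g y b a)) = SS V H (ll m) (\<lambda>x b. SS V H (rr x) (\<lambda>y a. g y b a))"
begin

abbreviation "SD a \<equiv> SS H H (dl a)"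
abbreviation "SR m \<equiv> SS V H (rr m)"
abbreviation "SL m \<equiv> SS V H (ll m)"

lemma dlc_SS: "SS H H (dlc a) f = SD a (\<lambda>x y. f y x)"
  by (simp add: dlc SS_flip)

text \<open>The left-right symmetry: exchanging the coactions together with \<open>dl\<close> and
  \<open>dlc\<close>, \<open>S\<close> and \<open>Si\<close> preserves the axioms, the commutation
  law being its own mirror image once the two \<open>H\<close> slots of the form are
  exchanged.\<close>

lemma bicov_mirror: "bicov H dlc dl eps Si S V la ra ll rr"
proof
  show "dl a = map prod.swap (dlc a)" for a by (simp add: dlc)
  show "SL m (\<lambda>x a. SR x (\<lambda>y b. g y b a)) = SR m (\<lambda>x b. SL x (\<lambda>y a. g y b a))"
    if "m \<in> carr V" "tf V H H g" for m g
    using comm[of m "\<lambda>x a b. g x b a"] that by (simp add: mf_defs R.carrH)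
qed

text \<open>In contrast to \<open>rr_P\<close> nothing cancels: covariance and \<open>dl_S\<close>
  give \<open>m_{-1} S(m_2) \<otimes> m_0 S(m_1)\<close>, whose left leg lies outside the pair that
  forms the projection.\<close>

lemma ll_P:
  assumes m: "m \<in> carr V" and f: "bf V H f"
  shows "SL (R.P m) f
    = SR m (\<lambda>a b. SL a (\<lambda>c d. SD b (\<lambda>u v. f (ra c (S u)) (d * S v))))"
proof -
  note [simp] = bfD[OF f]
  show ?thesis
    using R.P_ev[of "\<lambda>x. SL x f" m]
    by (simp add: f R.linH R.linV L.linV L.rr_ra dlc_SS R.dl_S)
qed

text \<open>
  Writing \<open>l(m) \<otimes> m\<^sub>0\<close> for the left coaction: \<open>l(P(m\<^sub>0)) m\<^sub>1 \<otimes> P(m\<^sub>0)\<^sub>0 = l(m) \<otimes> P(m\<^sub>0)\<close>.  This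
  cancels the antipode in the proof that \<open>\<otimes>\<^sub>\<sigma>\<close> is left colinear.
\<close>

lemma ll_P_rr:
  assumes m: "m \<in> carr V" and f: "bf V H f"
  shows "SR m (\<lambda>a b. SL (R.P a) (\<lambda>c d. f c (d * b))) = SL m (\<lambda>a b. f (R.P a) b)"
proof -
  note [simp] = bfD[OF f]
  note lin = R.linH R.linV L.linV
  have "SR m (\<lambda>a b. SL (R.P a) (\<lambda>c d. f c (d * b)))
    = SR m (\<lambda>a b. SR a (\<lambda>x y. SL x (\<lambda>c d. SD y (\<lambda>u v. f (ra c (S u)) (d * (S v * b))))))"
    by (simp add: ll_P lin)
  also have "\<dots> = SR m (\<lambda>x w. SD w (\<lambda>y b. SL x (\<lambda>c d. SD y (\<lambda>u v. f (ra c (S u)) (d * (S v * b))))))"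
    by (subst R.rr_coassoc[OF m]) (simp_all add: lin)
  also have "\<dots> = SR m (\<lambda>x w. SL x (\<lambda>c d. SD w (\<lambda>y b. SD y (\<lambda>u v. f (ra c (S u)) (d * (S v * b))))))"
    by (rule SS_cong[OF refl]) (rule SS_swap)
  also have "\<dots> = SR m (\<lambda>x w. SL x (\<lambda>c d. f (ra c (S w)) d))"
    using R.anti1[of "\<lambda>z. f (ra c (S u)) (d * z)" for c u d]
      R.counit2[of "\<lambda>u. f (ra c (S u)) d" for c d]
    by (simp add: R.dl_coassoc lin)
  also have "\<dots> = SL m (\<lambda>a b. SR a (\<lambda>c u. f (ra c (S u)) b))"
    by (rule comm[OF m, of "\<lambda>c d w. f (ra c (S w)) d"]) (simp add: lin)
  also have "\<dots> = SL m (\<lambda>a b. f (R.P a) b)"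
    using R.P_ev[of "\<lambda>x. f x b" for b] by (simp add: lin)
  finally show ?thesis .
qed

end

section \<open>Rational morphisms\<close>

locale rpair =
  M: rcov H dl eps S V la ra rr + N: rcov H dl eps S W laW raW rrW
  for H :: "('k::field, 'h::ring_1, 'z) vs_scheme" and dl eps S
    and V :: "('k, 'v::ab_group_add, 'y) vs_scheme" and la ra rr
    and W :: "('k, 'w::ab_group_add, 'x) vs_scheme" and laW raW rrW
begin

abbreviation "SD a \<equiv> SS H H (dl a)"
abbreviation "SR m \<equiv> SS V H (rr m)"
abbreviation "SR' n \<equiv> SS W H (rrW n)"

lemmas lin = M.linH M.linV N.linV ev_plus

text \<open>
  The list \<open>xs\<close> represents the adjoint coaction of \<open>\<phi>\<close>: \<open>\<phi>\<^sub>0(m) \<otimes> \<phi>\<^sub>1 = \<phi>(m\<^sub>0)\<^sub>0 \<otimes> \<phi>(m\<^sub>0)\<^sub>1 S(m\<^sub>1)\<close>.  The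
  equivalent condition \<open>mes\<close>, which is \<open>\<phi>(m)\<^sub>0 \<otimes> \<phi>(m)\<^sub>1 = \<phi>\<^sub>0(m\<^sub>0) \<otimes> \<phi>\<^sub>1 m\<^sub>1\<close>, is free of the antipode.
\<close>

definition adr :: "('k, 'v \<Rightarrow> 'w, 'u) vs_scheme \<Rightarrow> ('v \<Rightarrow> 'w) \<Rightarrow> (('v \<Rightarrow> 'w) \<times> 'h) list \<Rightarrow> bool" where
  "adr X \<phi> xs \<longleftrightarrow> (\<forall>m\<in>carr V. \<forall>f. bf W H f \<longrightarrow>
     SS X H xs (\<lambda>p h. f (ev p m) h) = SR m (\<lambda>x a. SR' (ev \<phi> x) (\<lambda>y b. f y (b * S a))))"

lemma adrD: "adr X \<phi> xs \<Longrightarrow> m \<in> carr V \<Longrightarrow> bf W H f \<Longrightarrow>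
    SS X H xs (\<lambda>p h. f (ev p m) h) = SR m (\<lambda>x a. SR' (ev \<phi> x) (\<lambda>y b. f y (b * S a)))"
  by (simp add: adr_def)

definition mes :: "('k, 'v \<Rightarrow> 'w, 'u) vs_scheme \<Rightarrow> ('v \<Rightarrow> 'w) \<Rightarrow> (('v \<Rightarrow> 'w) \<times> 'h) list \<Rightarrow> bool" where
  "mes X \<phi> xs \<longleftrightarrow> (\<forall>m\<in>carr V. \<forall>f. bf W H f \<longrightarrow>
     SR' (ev \<phi> m) f = SR m (\<lambda>x a. SS X H xs (\<lambda>p h. f (ev p x) (h * a))))"

lemma mesD: "mes X \<phi> xs \<Longrightarrow> m \<in> carr V \<Longrightarrow> bf W H f \<Longrightarrow>
    SR' (ev \<phi> m) f = SR m (\<lambda>x a. SS X H xs (\<lambda>p h. f (ev p x) (h * a)))"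
  by (simp add: mes_def)

text \<open>One more leg of \<open>m\<close> is multiplied on the right, which brings together
  \<open>S(m_1) m_2\<close>.\<close>

lemma adr_imp_mes:
  assumes X: "homsp V W X" and Y: "homsp V W Y" and \<phi>: "\<phi> \<in> carr Y" and a: "adr X \<phi> xs"
  shows "mes X \<phi> xs"
  unfolding mes_def
proof (intro ballI allI impI)
  fix m f assume m: "m \<in> carr V" and f: "bf W H f"
  note [simp] = bfD[OF f] and l = lin homspD[OF X] homspD[OF Y] \<phi>
  have "SR m (\<lambda>x a. SS X H xs (\<lambda>p h. f (ev p x) (h * a)))
    = SR m (\<lambda>x a. SR x (\<lambda>z c. SR' (ev \<phi> z) (\<lambda>y b. f y (b * (S c * a)))))" (is "?l = _")
    using adrD[OF a, of _ "\<lambda>y h. f y (h * a)" for a] by (simp add: l)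
  also have "\<dots> = SR m (\<lambda>z w. SD w (\<lambda>c a. SR' (ev \<phi> z) (\<lambda>y b. f y (b * (S c * a)))))"
    by (subst M.rr_coassoc[OF m]) (simp_all add: l)
  also have "\<dots> = SR' (ev \<phi> m) f"
    using M.anti1[of "\<lambda>c. SR' (ev \<phi> z) (\<lambda>y b. f y (b * c))" for z]
      M.rr_counit[OF m, of "\<lambda>z. SR' (ev \<phi> z) f"]
    by (simp add: l)
  finally show "SR' (ev \<phi> m) f = ?l" ..
qed

text \<open>The converse cancellation is that of \<open>m_1 S(m_2)\<close>.\<close>

lemma mes_imp_adr:
  assumes X: "homsp V W X" and a: "mes X \<phi> xs"
  shows "adr X \<phi> xs"
  unfolding adr_def
proof (intro ballI allI impI)
  fix m f assume m: "m \<in> carr V" and f: "bf W H f"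
  note [simp] = bfD[OF f] and l = lin homspD[OF X]
  have "SR m (\<lambda>x a. SR' (ev \<phi> x) (\<lambda>y b. f y (b * S a)))
    = SR m (\<lambda>x a. SR x (\<lambda>z c. SS X H xs (\<lambda>p h. f (ev p z) (h * (c * S a)))))" (is "?l = _")
    using mesD[OF a, of _ "\<lambda>y h. f y (h * S a)" for a] by (simp add: l)
  also have "\<dots> = SR m (\<lambda>z w. SD w (\<lambda>c a. SS X H xs (\<lambda>p h. f (ev p z) (h * (c * S a)))))"
    by (subst M.rr_coassoc[OF m]) (simp_all add: l)
  also have "\<dots> = SS X H xs (\<lambda>p h. f (ev p m) h)" (is "_ = ?r")
    using M.anti2[of "\<lambda>c. SS X H xs (\<lambda>p h. f (ev p z) (h * c))" for z]
      M.rr_counit[OF m, of "\<lambda>z. SS X H xs (\<lambda>p h. f (ev p z) h)"]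
    by (simp add: l)
  finally show "?r = ?l" ..
qed

text \<open>By \<open>hom_sep\<close>, values at all \<open>m\<close> determine an element of
  \<open>X \<otimes> H\<close>. This makes the definite descriptions in \<open>HOM\<close> well
  posed and lets a coaction be identified from any list that satisfies \<open>adr\<close>.\<close>

lemma adr_unique:
  assumes "homsp V W X" "adr X \<phi> xs" "adr X \<phi> ys" "bf X H F"
  shows "SS X H xs F = SS X H ys F"
proof (rule hom_sep[OF M.vsH N.vsV assms(1) _ assms(4)])
  fix m f assume "m \<in> carr V" "bf W H f"
  then show "SS X H xs (\<lambda>x w. f (ev x m) w) = SS X H ys (\<lambda>x w. f (ev x m) w)"
    using adrD[OF assms(2), of m f] adrD[OF assms(3), of m f] by simp
qed

text \<open>
  The components of the adjoint coaction of \<open>\<phi>\<close> along functionals \<open>g\<close> on \<open>H\<close>.  They are rational again, which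
  is why the adjoint coaction takes values in \<open>HOM \<otimes> H\<close> and not only in \<open>Hom \<otimes> H\<close>.
\<close>

definition slc :: "('h \<Rightarrow> 'k) \<Rightarrow> ('v \<Rightarrow> 'w) \<Rightarrow> 'v \<Rightarrow> 'w" where
  "slc g \<phi> = ext0 V (\<lambda>m. SR m (\<lambda>x a. SR' (ev \<phi> x) (\<lambda>y b. scl W (g (b * S a)) y)))"

lemma homsp_Hom: "homsp V W (Hom V W)"
proof -
  interpret W: vector_space "scl W" using N.vsV by (simp add: is_vs_def)
  have "is_vs (Hom V W)"
    unfolding is_vs_def
  proof
    show vs: "vector_space (scl (Hom V W))"
      by unfold_locales (auto simp: Hom_def fun_eq_iff W.scale_right_distrib W.scale_left_distrib)
    then interpret X: vector_space "scl (Hom V W)" .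
    show "X.subspace (carr (Hom V W))"
      by (rule X.subspaceI) (auto simp: Hom_def lin_def vs_closed[OF N.vsV] W.scale_right_distrib W.scale_left_commute)
  qed
  then show ?thesis by (simp add: homsp_def)
qed

lemma slc_ev:
  assumes "\<phi> \<in> carr (Hom V W)" "m \<in> carr V" "lf W p"
  shows "p (ev (slc g \<phi>) m) = SR m (\<lambda>x a. SR' (ev \<phi> x) (\<lambda>y b. g (b * S a) * p y))"
proof -
  have *: "p (SS W H xs (\<lambda>y b. scl W (g (b * S a)) y)) = SS W H xs (\<lambda>y b. g (b * S a) * p y)" for xs a
    using assms(3) by (subst SS_lf[OF N.vsV, of p]) (auto simp: vs_scl N.vsV lfD)
  have "ev (slc g \<phi>) m = SR m (\<lambda>x a. SR' (ev \<phi> x) (\<lambda>y b. scl W (g (b * S a)) y))"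
    using assms by (simp add: ev_def slc_def ext0_def)
  then show ?thesis
    using assms by (simp only:) (subst SS_lf[OF N.vsV assms(3)], auto simp: * vs_scl N.vsV intro!: SS_closed)
qed

lemma slc_Hom:
  assumes \<phi>: "\<phi> \<in> carr (Hom V W)" and g: "lf H g"
  shows "slc g \<phi> \<in> carr (Hom V W)"
proof -
  note hH = homspD[OF homsp_Hom]
  have "lin V W (ev (slc g \<phi>))"
  proof (rule linI)
    show "ev (slc g \<phi>) m \<in> carr W" if "m \<in> carr V" for m
      using that by (auto simp: ev_def slc_def ext0_def vs_scl N.vsV intro!: SS_closed)
    show "lf V (\<lambda>m. p (ev (slc g \<phi>) m))" if p: "lf W p" for p
      using slc_ev[OF \<phi> _ p, of _ g] lfD[OF p] lfD[OF g] \<phi> hH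
      by (simp add: lin mult.left_commute)
  qed (fact M.vsV N.vsV)+
  moreover have "\<forall>x. x \<notin> carr V \<longrightarrow> slc g \<phi> x = 0" by (simp add: slc_def ext0_def)
  ultimately show ?thesis by (simp add: Hom_def ev_def[abs_def])
qed

text \<open>The slice along \<open>g\<close> is \<open>g(\<phi>_1) \<phi>_0\<close>, so
  coassociativity predicts the coaction \<open>g(\<phi>_2) \<phi>_0 \<otimes> \<phi>_1\<close>; the
  witness list is read off from this.\<close>

lemma adr_slc:
  assumes \<phi>: "\<phi> \<in> carr (Hom V W)" and g: "lf H g" and a: "adr (Hom V W) \<phi> xs"
  shows "\<exists>zs. adr (Hom V W) (slc g \<phi>) zs"
proof
  let ?X = "Hom V W"
  note hH = homspD[OF homsp_Hom] and [simp] = lfD[OF g]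
  show "adr ?X (slc g \<phi>) (sbind ?X H xs (\<lambda>p h. sbind H H (dl h) (\<lambda>c d. [(scl ?X (g d) p, c)])))"
    unfolding adr_def
  proof (intro ballI allI impI)
    fix m f assume m: "m \<in> carr V" and f: "bf W H f"
    note [simp] = bfD[OF f] and l = lin hH \<phi> mult.left_commute
    let ?l = "\<lambda>x a y b. SD b (\<lambda>e h. SD a (\<lambda>u v. g (h * S u) * f y (e * S v)))"
    have "SR m (\<lambda>x a. SR' (ev (slc g \<phi>) x) (\<lambda>y b. f y (b * S a)))
      = SR m (\<lambda>x a. SR x (\<lambda>z c. SR' (ev \<phi> z) (\<lambda>y b. g (b * S c) * SR' y (\<lambda>y b. f y (b * S a)))))"
      using slc_ev[OF \<phi>, of _ "\<lambda>n. SR' n (\<lambda>y b. f y (b * S a))" g for a] by (simp add: l)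
    also have "\<dots> = SR m (\<lambda>z w. SD w (\<lambda>c a. SR' (ev \<phi> z) (\<lambda>y b. g (b * S c) * SR' y (\<lambda>y b. f y (b * S a)))))"
      by (subst M.rr_coassoc[OF m]) (simp_all add: l)
    also have "\<dots> = SR m (\<lambda>z w. SD w (\<lambda>c a. SR' (ev \<phi> z) (\<lambda>y d. SD d (\<lambda>e b. g (b * S c) * f y (e * S a)))))"
      using N.rr_coassoc[of _ "\<lambda>y e b. g (b * S c) * f y (e * S a)" for c a] by (simp add: l)
    also have "\<dots> = SR m (\<lambda>z w. SR' (ev \<phi> z) (\<lambda>y d. SD d (\<lambda>e b. SD w (\<lambda>c a. g (b * S c) * f y (e * S a)))))"
      by (rule SS_cong[OF refl], subst SS_swap, rule SS_cong[OF refl], rule SS_swap)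
    also have "\<dots> = SS ?X H xs (\<lambda>p h. SD h (\<lambda>c d. g d * f (ev p m) c))"
      using adrD[OF a m, of "\<lambda>y h. SD h (\<lambda>c d. g d * f y c)"] by (simp add: l M.dl_mult M.dl_S)
    finally show "SS ?X H (sbind ?X H xs (\<lambda>p h. sbind H H (dl h) (\<lambda>c d. [(scl ?X (g d) p, c)]))) (\<lambda>p h. f (ev p m) h)
      = SR m (\<lambda>x a. SR' (ev (slc g \<phi>) x) (\<lambda>y b. f y (b * S a)))"
      using m by (simp add: l)
  qed
qed

text \<open>Writing the coaction with second factors in coordinates turns its first factors into
  slices of \<open>\<phi>\<close>; \<open>adrD\<close> identifies the abstract slices of the list
  with \<open>slc\<close>.\<close>

lemma adr_list_slc:
  assumes \<phi>: "\<phi> \<in> carr (Hom V W)" and a: "adr (Hom V W) \<phi> xs"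
  obtains ys where "adr (Hom V W) \<phi> ys" "\<And>x h. (x, h) \<in> set ys \<Longrightarrow> \<exists>g. lf H g \<and> x = slc g \<phi>"
proof -
  let ?X = "Hom V W"
  note hH = homspD[OF homsp_Hom]
  obtain ys where ys: "\<And>F. bf ?X H F \<Longrightarrow> SS ?X H ys F = SS ?X H xs F"
    and sl: "\<And>x w. (x, w) \<in> set ys \<Longrightarrow> \<exists>g. lf H g \<and> x = SS ?X H xs (\<lambda>x w. scl ?X (g w) x)"
    using list_coordinates[OF M.vsH hH(5)] by metis
  show thesis
  proof
    show "adr ?X \<phi> ys"
      unfolding adr_def
    proof (intro ballI allI impI)
      fix m f assume m: "m \<in> carr V" and f: "bf W H f"
      have "bf ?X H (\<lambda>p h. f (ev p m) h)" using m bfD[OF f] by (simp add: lin hH)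
      from ys[OF this] adrD[OF a m f]
      show "SS ?X H ys (\<lambda>p h. f (ev p m) h) = SR m (\<lambda>x a. SR' (ev \<phi> x) (\<lambda>y b. f y (b * S a)))"
        by simp
    qed
    fix x h assume "(x, h) \<in> set ys"
    from sl[OF this] obtain g where g: "lf H g" and x: "x = SS ?X H xs (\<lambda>x w. scl ?X (g w) x)" by auto
    note [simp] = lfD[OF g]
    have "x = slc g \<phi>"
    proof (rule hom_eqI[OF homsp_Hom])
      show "x \<in> carr ?X" unfolding x by (rule SS_closed[OF hH(5)]) (rule hH)
      show "slc g \<phi> \<in> carr ?X" using \<phi> g by (rule slc_Hom)
      fix m assume m: "m \<in> carr V"
      show "ev x m = ev (slc g \<phi>) m"
      proof (rule lf_sep[OF N.vsV])
        fix p assume p: "lf W p"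
        note [simp] = lfD[OF p]
        have "p (ev x m) = SS ?X H xs (\<lambda>x h. g h * p (ev x m))"
          unfolding x by (subst SS_ev_lf[OF homsp_Hom N.vsV p m]) (simp_all add: hH m)
        also have "\<dots> = p (ev (slc g \<phi>) m)"
          using adrD[OF a m, of "\<lambda>y h. g h * p y"] by (simp add: slc_ev[OF \<phi> m p] lin mult.left_commute)
        finally show "p (ev x m) = p (ev (slc g \<phi>) m)" .
      qed
    qed
    with g show "\<exists>g. lf H g \<and> x = slc g \<phi>" by auto
  qed
qed

end

locale bipair =
  M: bicov H dl dlc eps S Si V la ra rr ll + N: bicov H dl dlc eps S Si W laW raW rrW llW
  for H :: "('k::field, 'h::ring_1, 'z) vs_scheme" and dl dlc eps S Si
    and V :: "('k, 'v::ab_group_add, 'y) vs_scheme" and la ra rr ll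
    and W :: "('k, 'w::ab_group_add, 'x) vs_scheme" and laW raW rrW llW
begin

abbreviation "SD a \<equiv> SS H H (dl a)"
abbreviation "SR m \<equiv> SS V H (rr m)"
abbreviation "SL m \<equiv> SS V H (ll m)"
abbreviation "SR' n \<equiv> SS W H (rrW n)"
abbreviation "SL' n \<equiv> SS W H (llW n)"

sublocale R: rpair H dl eps S V la ra rr W laW raW rrW ..
sublocale L: rpair H dlc eps Si V la ra ll W laW raW llW ..

lemma bipair_mirror: "bipair H dlc dl eps Si S V la ra ll rr W laW raW llW rrW"
  by (intro bipair.intro M.bicov_mirror N.bicov_mirror)

text \<open>Left and right coactions commute on source and target, so taking a right slice commutes
  with the left coaction: slicing the first factors of a left coaction list of \<open>\<phi>\<close>
  gives one for \<open>slc g \<phi>\<close>.\<close>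

lemma adl_slc:
  assumes \<phi>: "\<phi> \<in> carr (Hom V W)" and g: "lf H g" and a: "L.adr (Hom V W) \<phi> xs"
  shows "\<exists>zs. L.adr (Hom V W) (R.slc g \<phi>) zs"
proof
  let ?X = "Hom V W"
  note hH = homspD[OF R.homsp_Hom] and [simp] = lfD[OF g]
  show "L.adr ?X (R.slc g \<phi>) (sbind ?X H xs (\<lambda>p h. [(R.slc g p, h)]))"
    unfolding L.adr_def
  proof (intro ballI allI impI)
    fix m f assume m: "m \<in> carr V" and f: "bf W H f"
    note [simp] = bfD[OF f] and l = L.lin R.lin hH \<phi> mult.left_commute
    have "SL m (\<lambda>x a. SL' (ev (R.slc g \<phi>) x) (\<lambda>y b. f y (b * Si a)))
      = SL m (\<lambda>x a. SR x (\<lambda>z c. SR' (ev \<phi> z) (\<lambda>y e. SL' y (\<lambda>y b. g (e * S c) * f y (b * Si a)))))"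
      using R.slc_ev[OF \<phi>, of _ "\<lambda>n. SL' n (\<lambda>y b. f y (b * Si a))" g for a] by (simp add: l)
    also have "\<dots> = SR m (\<lambda>x c. SL x (\<lambda>z a. SR' (ev \<phi> z) (\<lambda>y e. SL' y (\<lambda>y b. g (e * S c) * f y (b * Si a)))))"
      by (rule M.comm[OF m, symmetric]) (simp add: l)
    also have "\<dots> = SR m (\<lambda>x c. SS ?X H xs (\<lambda>p h. SR' (ev p x) (\<lambda>y e. g (e * S c) * f y h)))"
      using N.comm[of _ "\<lambda>y b e. g (e * S c) * f y (b * Si a)" for c a]
        L.adrD[OF a, of _ "\<lambda>n h. SR' n (\<lambda>y e. g (e * S c) * f y h)" for c]
      by (simp add: l)
    also have "\<dots> = SS ?X H xs (\<lambda>p h. SR m (\<lambda>x c. SR' (ev p x) (\<lambda>y e. g (e * S c) * f y h)))"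
      by (rule SS_swap)
    also have "\<dots> = SS ?X H xs (\<lambda>p h. f (ev (R.slc g p) m) h)"
      using R.slc_ev[OF _ m, of _ "\<lambda>n. f n h" g for h] by (simp add: l)
    finally show "SS ?X H (sbind ?X H xs (\<lambda>p h. [(R.slc g p, h)])) (\<lambda>p h. f (ev p m) h)
      = SL m (\<lambda>x a. SL' (ev (R.slc g \<phi>) x) (\<lambda>y b. f y (b * Si a)))"
      using m by (simp add: l R.slc_Hom g)
  qed
qed

definition rat :: "('v \<Rightarrow> 'w) set" where
  "rat = {\<phi> \<in> carr (Hom V W). (\<exists>xs. R.adr (Hom V W) \<phi> xs) \<and> (\<exists>xs. L.adr (Hom V W) \<phi> xs)}"

lemma slc_rat: "\<phi> \<in> rat \<Longrightarrow> lf H g \<Longrightarrow> R.slc g \<phi> \<in> rat"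
  using adl_slc R.adr_slc R.slc_Hom by (auto simp: rat_def)

lemma rat_adr:
  assumes "\<phi> \<in> rat" "carr X = rat"
  shows "\<exists>xs. R.adr X \<phi> xs"
proof -
  have \<phi>: "\<phi> \<in> carr (Hom V W)" using assms by (simp add: rat_def)
  obtain xs where "R.adr (Hom V W) \<phi> xs" using assms by (auto simp: rat_def)
  then obtain ys where ys: "R.adr (Hom V W) \<phi> ys" "\<And>x h. (x, h) \<in> set ys \<Longrightarrow> \<exists>g. lf H g \<and> x = R.slc g \<phi>"
    using R.adr_list_slc[OF \<phi>] by metis
  have "\<forall>(x, h)\<in>set ys. x \<in> rat" using ys(2) slc_rat[OF assms(1)] by blast
  \<comment> \<open>All first factors are rational, so the carrier guards of \<open>X\<close> and of
    \<open>Hom\<close> both hold along this list.\<close>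
  then have "SS X H ys F = SS (Hom V W) H ys F" for F :: "('v \<Rightarrow> 'w) \<Rightarrow> 'h \<Rightarrow> 'k"
    using assms(2) by (induction ys) (auto simp: SS_Cons rat_def)
  then have "R.adr X \<phi> ys" using ys(1) by (simp add: R.adr_def)
  then show ?thesis ..
qed

lemma rat_mirror: "bipair.rat H Si S V ll rr W llW rrW = rat"
proof -
  interpret m: bipair H dlc dl eps Si S V la ra ll rr W laW raW llW rrW by (rule bipair_mirror)
  show ?thesis by (auto simp: m.rat_def rat_def)
qed

lemma rat_adl: "\<phi> \<in> rat \<Longrightarrow> carr X = rat \<Longrightarrow> \<exists>xs. L.adr X \<phi> xs"
  using bipair.rat_adr[OF bipair_mirror, of \<phi> X] rat_mirror by simp

end

lemma ptens_add1: "x \<in> carr A \<Longrightarrow> y \<in> carr A \<Longrightarrow> b \<in> carr B \<Longrightarrow> (x + y) \<otimes>\<^bsub>A,B\<^esub> b = x \<otimes>\<^bsub>A,B\<^esub> b + y \<otimes>\<^bsub>A,B\<^esub> b"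
  and ptens_scl1: "x \<in> carr A \<Longrightarrow> b \<in> carr B \<Longrightarrow> scl A c x \<otimes>\<^bsub>A,B\<^esub> b = scl (A \<otimes>\<^sub>v B) c (x \<otimes>\<^bsub>A,B\<^esub> b)"
  by (auto simp: ptens_def fun_eq_iff bilin_iff_bf bf_add1 bf_scl1)

lemma ptens_add2: "x \<in> carr B \<Longrightarrow> y \<in> carr B \<Longrightarrow> a \<in> carr A \<Longrightarrow> a \<otimes>\<^bsub>A,B\<^esub> (x + y) = a \<otimes>\<^bsub>A,B\<^esub> x + a \<otimes>\<^bsub>A,B\<^esub> y"
  and ptens_scl2: "x \<in> carr B \<Longrightarrow> a \<in> carr A \<Longrightarrow> a \<otimes>\<^bsub>A,B\<^esub> scl B c x = scl (A \<otimes>\<^sub>v B) c (a \<otimes>\<^bsub>A,B\<^esub> x)"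
  by (auto simp: ptens_def fun_eq_iff bilin_iff_bf bf_add2 bf_scl2)

lemmas ptensD = ptens_add1 ptens_scl1 ptens_add2 ptens_scl2

text \<open>This is \<open>hom_sep\<close> with a tensor product as second factor. It allows
  identities in \<open>X \<otimes> H \<otimes> H\<close>, such as coassociativity, to be checked
  after evaluating the maps at \<open>m\<close>.\<close>

lemma hom_sep3:
  assumes v: "is_vs A" "is_vs B" "is_vs N" and X: "homsp M N X"
    and eq: "\<And>m f. m \<in> carr M \<Longrightarrow> tf N A B f \<Longrightarrow>
      SS X (A \<otimes>\<^sub>v B) xs (\<lambda>p t. SS A B (rep A B t) (f (ev p m))) = SS X (A \<otimes>\<^sub>v B) ys (\<lambda>p t. SS A B (rep A B t) (f (ev p m)))"
    and g: "tf X A B g"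
  shows "SS X (A \<otimes>\<^sub>v B) xs (\<lambda>p t. SS A B (rep A B t) (g p)) = SS X (A \<otimes>\<^sub>v B) ys (\<lambda>p t. SS A B (rep A B t) (g p))"
proof (rule hom_sep[OF is_vs_tensor v(3) X])
  fix m f assume m: "m \<in> carr M" and f: "bf N (A \<otimes>\<^sub>v B) f"
  have t: "tf N A B (\<lambda>n a b. f n (a \<otimes>\<^bsub>A,B\<^esub> b))"
    using bfD[OF f] by (simp add: mf_defs ptensD vs_closed v)
  have "f n t = SS A B (rep A B t) (\<lambda>a b. f n (a \<otimes>\<^bsub>A,B\<^esub> b))" if "n \<in> carr N" "t \<in> carr (A \<otimes>\<^sub>v B)" for n t
    using that f by (intro rep_lf v) (simp_all add: bf_def)
  then have "SS X (A \<otimes>\<^sub>v B) zs (\<lambda>p t. f (ev p m) t)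
    = SS X (A \<otimes>\<^sub>v B) zs (\<lambda>p t. SS A B (rep A B t) (\<lambda>a b. f (ev p m) (a \<otimes>\<^bsub>A,B\<^esub> b)))" for zs
    by (intro SS_cong refl) (simp add: homspD[OF X] m)
  then show "SS X (A \<otimes>\<^sub>v B) xs (\<lambda>p t. f (ev p m) t) = SS X (A \<otimes>\<^sub>v B) ys (\<lambda>p t. f (ev p m) t)"
    using eq[OF m t] by simp
next
  have "bf A B (g p)" if "p \<in> carr X" for p using g that by (simp add: tf_def)
  then show "bf X (A \<otimes>\<^sub>v B) (\<lambda>p t. SS A B (rep A B t) (g p))"
    using tfD[OF g] by (simp add: bf_def lf_def rep_ev v vs_closed is_vs_tensor)
qed

section \<open>Actions and linear structure on maps, and their effect on adjoint coactions\<close>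

context rpair
begin

definition laX :: "'h \<Rightarrow> ('v \<Rightarrow> 'w) \<Rightarrow> 'v \<Rightarrow> 'w" where
  "laX a \<phi> = ext0 V (\<lambda>m. laW a (\<phi> m))"

definition raX :: "('v \<Rightarrow> 'w) \<Rightarrow> 'h \<Rightarrow> 'v \<Rightarrow> 'w" where
  "raX \<phi> b = ext0 V (\<lambda>m. \<phi> (la b m))"

lemma ev_laX: "m \<in> carr V \<Longrightarrow> ev (laX a \<phi>) m = laW a (ev \<phi> m)"
  and ev_raX: "m \<in> carr V \<Longrightarrow> ev (raX \<phi> b) m = ev \<phi> (la b m)"
  by (simp_all add: ev_def laX_def raX_def ext0_def)

lemma laX_Hom: "\<phi> \<in> carr (Hom V W) \<Longrightarrow> laX a \<phi> \<in> carr (Hom V W)"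
  by (auto simp: Hom_def lin_def laX_def ext0_def N.linV M.linV)

lemma raX_Hom: "\<phi> \<in> carr (Hom V W) \<Longrightarrow> raX \<phi> a \<in> carr (Hom V W)"
  by (auto simp: Hom_def lin_def raX_def ext0_def N.linV M.linV)

text \<open>The list is \<open>a_1 \<phi>_0 \<otimes> a_2 \<phi>_1\<close>. In the form
  \<open>mes\<close> this is immediate from covariance of the target module, with no antipode to
  carry along; in \<open>mes_raX\<close> covariance of the source plays the same part.\<close>

lemma mes_laX:
  assumes X: "homsp V W X" and cl: "\<And>a \<phi>. \<phi> \<in> carr X \<Longrightarrow> laX a \<phi> \<in> carr X"
    and Y: "homsp V W Y" "\<phi> \<in> carr Y" and a: "mes X \<phi> xs"
  shows "mes X (laX a \<phi>) (sbind X H xs (\<lambda>p h. sbind H H (dl a) (\<lambda>b c. [(laX b p, c * h)])))"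
  unfolding mes_def
proof (intro ballI allI impI)
  fix m f assume m: "m \<in> carr V" and f: "bf W H f"
  note [simp] = bfD[OF f] and l = lin homspD[OF X] homspD[OF Y(1)] Y(2) cl ev_laX
  have "SR' (ev (laX a \<phi>) m) f = SD a (\<lambda>b c. SR m (\<lambda>x e. SS X H xs (\<lambda>p h. f (laW b (ev p x)) (c * (h * e)))))"
    using mesD[OF a m, of "\<lambda>y d. f (laW b y) (c * d)" for b c] by (simp add: l m N.rr_la f)
  also have "\<dots> = SR m (\<lambda>x e. SS X H xs (\<lambda>p h. SD a (\<lambda>b c. f (laW b (ev p x)) (c * (h * e)))))"
    by (subst SS_swap, rule SS_cong[OF refl], rule SS_swap)
  finally show "SR' (ev (laX a \<phi>) m) f
     = SR m (\<lambda>x e. SS X H (sbind X H xs (\<lambda>p h. sbind H H (dl a) (\<lambda>b c. [(laX b p, c * h)]))) (\<lambda>p h. f (ev p x) (h * e)))"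
    by (simp add: l)
qed

lemma mes_raX:
  assumes X: "homsp V W X" and cl: "\<And>a \<phi>. \<phi> \<in> carr X \<Longrightarrow> raX \<phi> a \<in> carr X"
    and Y: "homsp V W Y" "\<phi> \<in> carr Y" and a: "mes X \<phi> xs"
  shows "mes X (raX \<phi> a) (sbind X H xs (\<lambda>p h. sbind H H (dl a) (\<lambda>b c. [(raX p b, h * c)])))"
  unfolding mes_def
proof (intro ballI allI impI)
  fix m f assume m: "m \<in> carr V" and f: "bf W H f"
  note [simp] = bfD[OF f] and l = lin homspD[OF X] homspD[OF Y(1)] Y(2) cl ev_raX
  have "SR' (ev (raX \<phi> a) m) f = SD a (\<lambda>b c. SR m (\<lambda>x e. SS X H xs (\<lambda>p h. f (ev p (la b x)) (h * (c * e)))))"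
    using mesD[OF a M.la_closed[OF m] f] by (simp add: l m M.rr_la)
  also have "\<dots> = SR m (\<lambda>x e. SS X H xs (\<lambda>p h. SD a (\<lambda>b c. f (ev p (la b x)) (h * (c * e)))))"
    by (subst SS_swap, rule SS_cong[OF refl], rule SS_swap)
  finally show "SR' (ev (raX \<phi> a) m) f
     = SR m (\<lambda>x e. SS X H (sbind X H xs (\<lambda>p h. sbind H H (dl a) (\<lambda>b c. [(raX p b, h * c)]))) (\<lambda>p h. f (ev p x) (h * e)))"
    by (simp add: l)
qed

lemma adr_laX:
  assumes "\<phi> \<in> carr (Hom V W)" "adr (Hom V W) \<phi> xs"
  shows "\<exists>xs. adr (Hom V W) (laX a \<phi>) xs"
  using mes_imp_adr[OF homsp_Hom mes_laX[OF homsp_Hom laX_Hom homsp_Hom assms(1) adr_imp_mes[OF homsp_Hom homsp_Hom assms]]]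
  by blast

lemma adr_raX:
  assumes "\<phi> \<in> carr (Hom V W)" "adr (Hom V W) \<phi> xs"
  shows "\<exists>xs. adr (Hom V W) (raX \<phi> a) xs"
  using mes_imp_adr[OF homsp_Hom mes_raX[OF homsp_Hom raX_Hom homsp_Hom assms(1) adr_imp_mes[OF homsp_Hom homsp_Hom assms]]]
  by blast

lemma adr_add:
  assumes X: "homsp V W X" and a: "adr X \<phi> xs" "adr X \<psi> ys" and Y: "homsp V W Y" "\<phi> \<in> carr Y" "\<psi> \<in> carr Y"
  shows "adr X (\<phi> + \<psi>) (xs @ ys)"
  unfolding adr_def
proof (intro ballI allI impI)
  fix m f assume m: "m \<in> carr V" and f: "bf W H f"
  note [simp] = bfD[OF f] and l = lin homspD[OF X] homspD[OF Y(1)] Y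
  show "SS X H (xs @ ys) (\<lambda>p h. f (ev p m) h) = SR m (\<lambda>x a. SR' (ev (\<phi> + \<psi>) x) (\<lambda>y b. f y (b * S a)))"
    using adrD[OF a(1) m f] adrD[OF a(2) m f] by (simp add: l)
qed

lemma adr_scl:
  assumes X: "homsp V W X" and a: "adr X \<phi> xs" and Y: "homsp V W Y" "\<phi> \<in> carr Y"
  shows "adr X (scl Y c \<phi>) (sbind X H xs (\<lambda>p h. [(scl X c p, h)]))"
  unfolding adr_def
proof (intro ballI allI impI)
  fix m f assume m: "m \<in> carr V" and f: "bf W H f"
  note [simp] = bfD[OF f] and l = lin homspD[OF X] homspD[OF Y(1)] Y
  show "SS X H (sbind X H xs (\<lambda>p h. [(scl X c p, h)])) (\<lambda>p h. f (ev p m) h)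
    = SR m (\<lambda>x a. SR' (ev (scl Y c \<phi>) x) (\<lambda>y b. f y (b * S a)))"
    using adrD[OF a(1) m f] m by (simp add: l)
qed

lemma adr_zero: "adr X 0 []"
  unfolding adr_def
proof (intro ballI allI impI)
  fix m f assume f: "bf W H f"
  note [simp] = bfD[OF f]
  have "SR' 0 (\<lambda>y b. f y (b * S a)) = 0" for a
  proof -
    let ?F = "SR' 0 (\<lambda>y b. f y (b * S a))"
    have "bf W H (\<lambda>y b. f y (b * S a))" by (simp add: lin)
    from N.rr_add[OF _ _ this, of 0 0] have "?F + 0 = ?F + ?F" by (simp add: vs_0[OF N.vsV] del: mult_2)
    then show ?thesis by (simp only: add_left_cancel)
  qed
  then show "SS X H [] (\<lambda>p h. f (ev p m) h) = SR m (\<lambda>x a. SR' (ev 0 x) (\<lambda>y b. f y (b * S a)))"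
    by (simp add: ev_def)
qed

end

text \<open>Only one side is assumed, so that the comodule and covariance axioms of the adjoint
  coaction are proved once and then instantiated for both sides.\<close>

locale rhom = rpair H dl eps S V la ra rr W laW raW rrW
  for H :: "('k::field, 'h::ring_1, 'z) vs_scheme" and dl eps S
    and V :: "('k, 'v::ab_group_add, 'y) vs_scheme" and la ra rr
    and W :: "('k, 'w::ab_group_add, 'x) vs_scheme" and laW raW rrW +
  fixes X :: "('k, 'v \<Rightarrow> 'w, 'u) vs_scheme" and hr :: "('v \<Rightarrow> 'w) \<Rightarrow> (('v \<Rightarrow> 'w) \<times> 'h) list"
  assumes X: "homsp V W X" and hr: "\<phi> \<in> carr X \<Longrightarrow> adr X \<phi> (hr \<phi>)"
    and laX_in: "\<phi> \<in> carr X \<Longrightarrow> laX a \<phi> \<in> carr X" and raX_in: "\<phi> \<in> carr X \<Longrightarrow> raX \<phi> a \<in> carr X"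
begin

abbreviation "SX \<phi> \<equiv> SS X H (hr \<phi>)"

lemmas hX = homspD[OF X]

lemma hr_ev: "\<phi> \<in> carr X \<Longrightarrow> m \<in> carr V \<Longrightarrow> bf W H f \<Longrightarrow>
    SX \<phi> (\<lambda>p h. f (ev p m) h) = SR m (\<lambda>x a. SR' (ev \<phi> x) (\<lambda>y b. f y (b * S a)))"
  by (rule adrD[OF hr])

lemma hr_mes: "\<phi> \<in> carr X \<Longrightarrow> m \<in> carr V \<Longrightarrow> bf W H f \<Longrightarrow>
    SR' (ev \<phi> m) f = SR m (\<lambda>x a. SX \<phi> (\<lambda>p h. f (ev p x) (h * a)))"
  by (rule mesD[OF adr_imp_mes[OF X X _ hr]])

lemma hr_eqI: "\<phi> \<in> carr X \<Longrightarrow> adr X \<phi> xs \<Longrightarrow> bf X H F \<Longrightarrow> SX \<phi> F = SS X H xs F"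
  by (rule adr_unique[OF X hr])

text \<open>Evaluated at \<open>m\<close>, both sides become \<open>\<phi>(m_0)_0 \<otimes>
  \<phi>(m_0)_1 S(m_2) \<otimes> \<phi>(m_0)_2 S(m_1)\<close>, by coassociativity of source and
  target and because the antipode reverses coproducts.\<close>

lemma hr_coassoc:
  assumes \<phi>: "\<phi> \<in> carr X" and g: "tf X H H g"
  shows "SX \<phi> (\<lambda>x b. SX x (\<lambda>y a. g y a b)) = SX \<phi> (\<lambda>x c. SD c (\<lambda>a b. g x a b))"
proof -
  have bg: "bf H H (g x)" if "x \<in> carr X" for x using g that by (simp add: tf_def)
  let ?xs = "sbind X H (hr \<phi>) (\<lambda>x b. sbind X H (hr x) (\<lambda>y a. [(y, a \<otimes>\<^bsub>H,H\<^esub> b)]))"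
  let ?ys = "sbind X H (hr \<phi>) (\<lambda>x c. sbind H H (dl c) (\<lambda>a b. [(x, a \<otimes>\<^bsub>H,H\<^esub> b)]))"
  have "SS X (H \<otimes>\<^sub>v H) ?xs (\<lambda>p t. SS H H (rep H H t) (g p)) = SS X (H \<otimes>\<^sub>v H) ?ys (\<lambda>p t. SS H H (rep H H t) (g p))"
  proof (rule hom_sep3[OF M.vsH M.vsH N.vsV X _ g])
    fix m f assume m: "m \<in> carr V" and f: "tf W H H f"
    note [simp] = tfD[OF f] and l = lin hX \<phi>
    have bf: "bf H H (f x)" if "x \<in> carr W" for x using f that by (simp add: tf_def)
    have "SX \<phi> (\<lambda>x b. SX x (\<lambda>y a. f (ev y m) a b))
      = SX \<phi> (\<lambda>x b. SR m (\<lambda>z c. SR' (ev x z) (\<lambda>y d. f y (d * S c) b)))"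
      using hr_ev[OF _ m, of _ "\<lambda>y a. f y a b" for b] by (simp add: l)
    also have "\<dots> = SR m (\<lambda>z c. SX \<phi> (\<lambda>x b. SR' (ev x z) (\<lambda>y d. f y (d * S c) b)))"
      by (rule SS_swap)
    also have "\<dots> = SR m (\<lambda>z c. SR z (\<lambda>u e. SR' (ev \<phi> u) (\<lambda>v k. SR' v (\<lambda>y d. f y (d * S c) (k * S e)))))"
      using hr_ev[OF \<phi>, of _ "\<lambda>v b. SR' v (\<lambda>y d. f y (d * S c) b)" for c] by (simp add: l)
    also have "\<dots> = SR m (\<lambda>u w. SD w (\<lambda>e c. SR' (ev \<phi> u) (\<lambda>v k. SR' v (\<lambda>y d. f y (d * S c) (k * S e)))))"
      by (subst M.rr_coassoc[OF m]) (simp_all add: l)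
    also have "\<dots> = SR m (\<lambda>u w. SD w (\<lambda>e c. SR' (ev \<phi> u) (\<lambda>y q. SD q (\<lambda>d k. f y (d * S c) (k * S e)))))"
      using N.rr_coassoc[of _ "\<lambda>y d k. f y (d * S c) (k * S e)" for c e] by (simp add: l)
    also have "\<dots> = SR m (\<lambda>u w. SR' (ev \<phi> u) (\<lambda>y q. SD q (\<lambda>d k. SD w (\<lambda>e c. f y (d * S c) (k * S e)))))"
      by (rule SS_cong[OF refl], subst SS_swap, rule SS_cong[OF refl], rule SS_swap)
    also have "\<dots> = SX \<phi> (\<lambda>x c. SD c (f (ev x m)))"
      using hr_ev[OF \<phi> m, of "\<lambda>y c. SD c (f y)"] by (simp add: l bf M.dl_mult M.dl_S)
    finally show "SS X (H \<otimes>\<^sub>v H) ?xs (\<lambda>p t. SS H H (rep H H t) (f (ev p m))) = SS X (H \<otimes>\<^sub>v H) ?ys (\<lambda>p t. SS H H (rep H H t) (f (ev p m)))"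
      using m by (simp add: rep_ev bf ptens_ev l)
  qed
  then show ?thesis by (simp add: rep_ev bg ptens_ev M.vsH M.carrH)
qed

lemma hr_counit:
  assumes \<phi>: "\<phi> \<in> carr X" and p: "lf X p"
  shows "SX \<phi> (\<lambda>x a. eps a * p x) = p \<phi>"
proof -
  have "SX \<phi> (\<lambda>x a. scl X (eps a) x) = \<phi>"
  proof (rule hom_eqI[OF X _ \<phi>])
    show "SX \<phi> (\<lambda>x a. scl X (eps a) x) \<in> carr X" by (rule SS_closed) (simp_all add: hX)
    fix m assume m: "m \<in> carr V"
    show "ev (SX \<phi> (\<lambda>x a. scl X (eps a) x)) m = ev \<phi> m"
    proof (rule lf_sep[OF N.vsV])
      fix q assume q: "lf W q"
      note [simp] = lfD[OF q] and l = lin hX \<phi>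
      have "q (ev (SX \<phi> (\<lambda>x a. scl X (eps a) x)) m) = SX \<phi> (\<lambda>x a. eps a * q (ev x m))" (is "?l = _")
        by (subst SS_ev_lf[OF X N.vsV q m]) (simp_all add: l m)
      also have "\<dots> = SR m (\<lambda>x a. SR' (ev \<phi> x) (\<lambda>y b. eps (b * S a) * q y))"
        using hr_ev[OF \<phi> m, of "\<lambda>y h. eps h * q y"] by (simp add: l mult.left_commute)
      also have "\<dots> = SR m (\<lambda>x a. SR' (ev \<phi> x) (\<lambda>y b. eps a * (eps b * q y)))"
        by (simp only: M.eps_mult M.eps_S mult_ac)
      also have "\<dots> = q (ev \<phi> m)"
        using N.rr_counit[of _ q] q M.rr_counit[OF m, of "\<lambda>x. q (ev \<phi> x)"] by (simp add: l)
      finally show "?l = q (ev \<phi> m)" .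
    qed
  qed
  from arg_cong[OF this, of p] show ?thesis
    by (subst (asm) SS_lf[OF hX(5) p]) (simp_all add: hX lfD[OF p])
qed

lemma rcov_hom: "rcov H dl eps S X laX raX hr"
proof -
  note l = lin hX hX(6)[of 0 0, simplified] and e = hom_eqI[OF X]
  show ?thesis
  proof
    fix \<phi> a F assume \<phi>: "\<phi> \<in> carr X" and F: "bf X H F"
    note a = adr_imp_mes[OF X X \<phi> hr[OF \<phi>]]
    from hr_eqI[OF laX_in[OF \<phi>] mes_imp_adr[OF X mes_laX[OF X laX_in X \<phi> a]] F]
    have "SX (laX a \<phi>) F = SX \<phi> (\<lambda>x d. SD a (\<lambda>b c. F (laX b x) (c * d)))"
      by (simp add: laX_in M.carrH)
    then show "SX (laX a \<phi>) F = SD a (\<lambda>b c. SX \<phi> (\<lambda>x d. F (laX b x) (c * d)))"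
      by (subst SS_swap)
    from hr_eqI[OF raX_in[OF \<phi>] mes_imp_adr[OF X mes_raX[OF X raX_in X \<phi> a]] F]
    show "SX (raX \<phi> a) F = SX \<phi> (\<lambda>x d. SD a (\<lambda>b c. F (raX x b) (d * c)))"
      by (simp add: raX_in M.carrH)
    show "SX (scl X c \<phi>) F = c * SX \<phi> F" for c
      using hr_eqI[OF hX(7)[OF \<phi>] adr_scl[OF X hr[OF \<phi>] X \<phi>] F] by (simp add: hX bfD[OF F])
    show "SX (\<phi> + \<psi>) F = SX \<phi> F + SX \<psi> F" if "\<psi> \<in> carr X" for \<psi>
      using hr_eqI[OF hX(6)[OF \<phi> that] adr_add[OF X hr[OF \<phi>] hr[OF that] X \<phi> that] F] by simp
  next
    fix \<phi> a b assume \<phi>: "\<phi> \<in> carr X"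
    note l = lin hX laX_in raX_in ev_laX ev_raX \<phi>
    show "laX (a + b) \<phi> = laX a \<phi> + laX b \<phi>" "laX (a * b) \<phi> = laX a (laX b \<phi>)"
      "raX \<phi> (a + b) = raX \<phi> a + raX \<phi> b" "raX \<phi> (a * b) = raX (raX \<phi> a) b"
      "raX (laX a \<phi>) b = laX a (raX \<phi> b)" "laX 1 \<phi> = \<phi>" "raX \<phi> 1 = \<phi>"
      by (rule e; simp add: l M.la_mult N.la_mult M.la_one N.la_one)+
    show "laX (scl H c a) \<phi> = scl X c (laX a \<phi>)" "laX a (scl X c \<phi>) = scl X c (laX a \<phi>)"
      "raX \<phi> (scl H c a) = scl X c (raX \<phi> a)" "raX (scl X c \<phi>) a = scl X c (raX \<phi> a)" for c
      by (rule e; simp add: l)+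
    show "laX a (\<phi> + \<psi>) = laX a \<phi> + laX a \<psi>" "raX (\<phi> + \<psi>) a = raX \<phi> a + raX \<psi> a" if "\<psi> \<in> carr X" for \<psi>
      using that by (rule_tac [!] e; simp add: l)+
  qed (simp_all add: hX laX_in raX_in hr_coassoc hr_counit)
qed

end

locale bihom = bipair H dl dlc eps S Si V la ra rr ll W laW raW rrW llW
  for H :: "('k::field, 'h::ring_1, 'z) vs_scheme" and dl dlc eps S Si
    and V :: "('k, 'v::ab_group_add, 'y) vs_scheme" and la ra rr ll
    and W :: "('k, 'w::ab_group_add, 'x) vs_scheme" and laW raW rrW llW +
  fixes X :: "('k, 'v \<Rightarrow> 'w, 'u) vs_scheme" and hr hl :: "('v \<Rightarrow> 'w) \<Rightarrow> (('v \<Rightarrow> 'w) \<times> 'h) list"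
  assumes carrX: "carr X = rat" and sclX: "scl X = scl (Hom V W)"
    and hr0: "\<phi> \<in> carr X \<Longrightarrow> R.adr X \<phi> (hr \<phi>)" and hl0: "\<phi> \<in> carr X \<Longrightarrow> L.adr X \<phi> (hl \<phi>)"
begin

abbreviation "SX \<phi> \<equiv> SS X H (hr \<phi>)"
abbreviation "SLX \<phi> \<equiv> SS X H (hl \<phi>)"

lemma homspX: "homsp V W X"
proof -
  note h = homspD[OF R.homsp_Hom]
  interpret Y: vector_space "scl (Hom V W)" using h(5) by (simp add: is_vs_def)
  have z: "0 \<in> rat"
  proof -
    have "0 \<in> carr (Hom V W)" by (rule vs_0[OF h(5)])
    with R.adr_zero L.adr_zero show ?thesis by (auto simp: rat_def)
  qed
  have "Y.subspace rat"
  proof (rule Y.subspaceI)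
    show "0 \<in> rat" by (rule z)
  next
    fix x y assume x: "x \<in> rat" and y: "y \<in> rat"
    then obtain xs xs' ys ys' where
      a: "R.adr (Hom V W) x xs" "L.adr (Hom V W) x xs'" "R.adr (Hom V W) y ys" "L.adr (Hom V W) y ys'"
      and xy: "x \<in> carr (Hom V W)" "y \<in> carr (Hom V W)"
      unfolding rat_def by blast
    from h(6)[OF xy] R.adr_add[OF R.homsp_Hom a(1,3) R.homsp_Hom xy] L.adr_add[OF R.homsp_Hom a(2,4) R.homsp_Hom xy]
    show "x + y \<in> rat" unfolding rat_def by blast
  next
    fix c x assume "x \<in> rat"
    then obtain xs xs' where a: "R.adr (Hom V W) x xs" "L.adr (Hom V W) x xs'" and x: "x \<in> carr (Hom V W)"
      unfolding rat_def by blast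
    from h(7)[OF x] R.adr_scl[OF R.homsp_Hom a(1) R.homsp_Hom x] L.adr_scl[OF R.homsp_Hom a(2) R.homsp_Hom x]
    show "scl (Hom V W) c x \<in> rat" unfolding rat_def by blast
  qed
  then have "is_vs X" using h(5) by (simp add: is_vs_def carrX sclX)
  then show ?thesis by (auto simp: homsp_def sclX carrX rat_def)
qed

sublocale R: rhom H dl eps S V la ra rr W laW raW rrW X hr
proof
  show "R.laX a \<phi> \<in> carr X" "R.raX \<phi> a \<in> carr X" if "\<phi> \<in> carr X" for a \<phi>
    using that R.adr_laX R.adr_raX L.adr_laX L.adr_raX R.laX_Hom R.raX_Hom
    by (auto simp: carrX rat_def R.laX_def L.laX_def R.raX_def L.raX_def)
qed (fact homspX hr0)+

sublocale L: rhom H dlc eps Si V la ra ll W laW raW llW X hl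
proof
  show "L.laX a \<phi> \<in> carr X" "L.raX \<phi> a \<in> carr X" if "\<phi> \<in> carr X" for a \<phi>
    using R.laX_in[OF that] R.raX_in[OF that] by (simp_all add: R.laX_def L.laX_def R.raX_def L.raX_def)
qed (fact homspX hl0)+

text \<open>Evaluation at \<open>m\<close> splits the two adjoint coactions into coactions of the
  source and of the target, and each of these two pairs commutes.\<close>

lemma hom_comm:
  assumes \<phi>: "\<phi> \<in> carr X" and g: "tf X H H g"
  shows "SX \<phi> (\<lambda>x a. SLX x (\<lambda>y b. g y b a)) = SLX \<phi> (\<lambda>x b. SX x (\<lambda>y a. g y b a))"
proof -
  note vH = M.R.vsH
  have bg: "bf H H (g x)" if "x \<in> carr X" for x using g that by (simp add: tf_def)
  let ?xs = "sbind X H (hr \<phi>) (\<lambda>x a. sbind X H (hl x) (\<lambda>y b. [(y, b \<otimes>\<^bsub>H,H\<^esub> a)]))"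
  let ?ys = "sbind X H (hl \<phi>) (\<lambda>x b. sbind X H (hr x) (\<lambda>y a. [(y, b \<otimes>\<^bsub>H,H\<^esub> a)]))"
  have "SS X (H \<otimes>\<^sub>v H) ?xs (\<lambda>p t. SS H H (rep H H t) (g p)) = SS X (H \<otimes>\<^sub>v H) ?ys (\<lambda>p t. SS H H (rep H H t) (g p))"
  proof (rule hom_sep3[OF vH vH N.R.vsV homspX _ g])
    fix m f assume m: "m \<in> carr V" and f: "tf W H H f"
    note [simp] = tfD[OF f] and l = R.lin L.lin R.hX \<phi>
    have bf: "bf H H (f x)" if "x \<in> carr W" for x using f that by (simp add: tf_def)
    have "SX \<phi> (\<lambda>x a. SLX x (\<lambda>y b. f (ev y m) b a))
      = SX \<phi> (\<lambda>x a. SL m (\<lambda>z c. SL' (ev x z) (\<lambda>y b. f y (b * Si c) a)))"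
      using L.hr_ev[OF _ m, of _ "\<lambda>y b. f y b a" for a] by (simp add: l)
    also have "\<dots> = SL m (\<lambda>z c. SX \<phi> (\<lambda>x a. SL' (ev x z) (\<lambda>y b. f y (b * Si c) a)))"
      by (rule SS_swap)
    also have "\<dots> = SL m (\<lambda>z c. SR z (\<lambda>u e. SR' (ev \<phi> u) (\<lambda>v k. SL' v (\<lambda>y b. f y (b * Si c) (k * S e)))))"
      using R.hr_ev[OF \<phi>, of _ "\<lambda>v a. SL' v (\<lambda>y b. f y (b * Si c) a)" for c] by (simp add: l)
    also have "\<dots> = SR m (\<lambda>z e. SL z (\<lambda>u c. SR' (ev \<phi> u) (\<lambda>v k. SL' v (\<lambda>y b. f y (b * Si c) (k * S e)))))"
      by (rule M.comm[OF m, symmetric]) (simp add: l)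
    also have "\<dots> = SR m (\<lambda>z e. SLX \<phi> (\<lambda>x b. SR' (ev x z) (\<lambda>y k. f y b (k * S e))))"
      using N.comm[of _ "\<lambda>y b k. f y (b * Si c) (k * S e)" for c e]
        L.hr_ev[OF \<phi>, of _ "\<lambda>v b. SR' v (\<lambda>y k. f y b (k * S e))" for e]
      by (simp add: l)
    also have "\<dots> = SLX \<phi> (\<lambda>x b. SR m (\<lambda>z e. SR' (ev x z) (\<lambda>y k. f y b (k * S e))))"
      by (rule SS_swap)
    also have "\<dots> = SLX \<phi> (\<lambda>x b. SX x (\<lambda>y a. f (ev y m) b a))"
      using R.hr_ev[OF _ m, of _ "\<lambda>y a. f y b a" for b] by (simp add: l)
    finally show "SS X (H \<otimes>\<^sub>v H) ?xs (\<lambda>p t. SS H H (rep H H t) (f (ev p m))) = SS X (H \<otimes>\<^sub>v H) ?ys (\<lambda>p t. SS H H (rep H H t) (f (ev p m)))"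
      using m by (simp add: rep_ev bf ptens_ev l)
  qed
  then show ?thesis by (simp add: rep_ev bg ptens_ev vH M.R.carrH)
qed

lemma bicov_hom: "bicov H dl dlc eps S Si X R.laX R.raX hr hl"
proof (intro bicov.intro bicov_axioms.intro)
  show "rcov H dl eps S X R.laX R.raX hr" by (rule R.rcov_hom)
  have "R.laX = L.laX" "R.raX = L.raX" by (simp_all add: fun_eq_iff R.laX_def L.laX_def R.raX_def L.raX_def)
  then show "rcov H dlc eps Si X R.laX R.raX hl" using L.rcov_hom by simp
qed (fact M.dlc hom_comm)+

end

section \<open>Tensor products of covariant bimodules\<close>

text \<open>The structure on \<open>T\<close> is specified only by its values on forms. One and the
  same locale then covers both coactions, and the \<open>sw\<close> expressions in
  \<open>bitensor\<close> have to be evaluated just once.\<close>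

locale rten = rpair H dl eps S V la ra rr W laW raW rrW
  for H :: "('k::field, 'h::ring_1, 'z) vs_scheme" and dl eps S
    and V :: "('k, 'v::ab_group_add, 'y) vs_scheme" and la ra rr
    and W :: "('k, 'w::ab_group_add, 'x) vs_scheme" and laW raW rrW +
  fixes T :: "('k, ('k, 'v, 'w) tens, 'u) vs_scheme" and laT raT rrT
  assumes carrT: "carr T = carr (V \<otimes>\<^sub>v W)" and sclT: "scl T = scl (V \<otimes>\<^sub>v W)"
    and laT_closed: "t \<in> carr T \<Longrightarrow> laT a t \<in> carr T"
    and laT_ev: "t \<in> carr T \<Longrightarrow> bf V W g \<Longrightarrow> laT a t g = SS V W (rep V W t) (\<lambda>m n. g (la a m) n)"
    and raT_closed: "t \<in> carr T \<Longrightarrow> raT t a \<in> carr T"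
    and raT_ev: "t \<in> carr T \<Longrightarrow> bf V W g \<Longrightarrow> raT t a g = SS V W (rep V W t) (\<lambda>m n. g m (raW n a))"
    and rrT_ev: "t \<in> carr T \<Longrightarrow> bf T H f \<Longrightarrow> SS T H (rrT t) f =
      SS V W (rep V W t) (\<lambda>m n. SS V H (rr m) (\<lambda>x a. SS W H (rrW n) (\<lambda>y b. f (x \<otimes>\<^bsub>V,W\<^esub> y) (a * b))))"
begin

abbreviation "ST t \<equiv> SS T H (rrT t)"

lemma vsT: "is_vs T"
  using is_vs_tensor[of V W] by (simp add: is_vs_def carrT sclT)

lemma pT: "m \<in> carr V \<Longrightarrow> n \<in> carr W \<Longrightarrow> m \<otimes>\<^bsub>V,W\<^esub> n \<in> carr T"
  by (simp add: carrT)

lemma pT_lin: "x \<in> carr V \<Longrightarrow> y \<in> carr V \<Longrightarrow> n \<in> carr W \<Longrightarrow> (x + y) \<otimes>\<^bsub>V,W\<^esub> n = x \<otimes>\<^bsub>V,W\<^esub> n + y \<otimes>\<^bsub>V,W\<^esub> n"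
  "x \<in> carr V \<Longrightarrow> n \<in> carr W \<Longrightarrow> scl V c x \<otimes>\<^bsub>V,W\<^esub> n = scl T c (x \<otimes>\<^bsub>V,W\<^esub> n)"
  "m \<in> carr V \<Longrightarrow> u \<in> carr W \<Longrightarrow> v \<in> carr W \<Longrightarrow> m \<otimes>\<^bsub>V,W\<^esub> (u + v) = m \<otimes>\<^bsub>V,W\<^esub> u + m \<otimes>\<^bsub>V,W\<^esub> v"
  "m \<in> carr V \<Longrightarrow> u \<in> carr W \<Longrightarrow> m \<otimes>\<^bsub>V,W\<^esub> scl W c u = scl T c (m \<otimes>\<^bsub>V,W\<^esub> u)"
  by (simp_all add: ptensD sclT)

lemma T_eqI: "t \<in> carr T \<Longrightarrow> u \<in> carr T \<Longrightarrow> (\<And>g. bf V W g \<Longrightarrow> t g = u g) \<Longrightarrow> t = u"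
  using tensor_eqI[OF M.vsV, of t W u] by (simp add: carrT)

lemma rep_evT: "t \<in> carr T \<Longrightarrow> bf V W g \<Longrightarrow> SS V W (rep V W t) g = t g"
  by (simp add: rep_ev M.vsV carrT)

lemma sclT_ev: "scl T c t g = c * t g"
  by (simp add: sclT)

lemmas linT0 = vsT vs_add[OF vsT] vs_scl[OF vsT] pT pT_lin sclT_ev

lemma laT_pure: "m \<in> carr V \<Longrightarrow> n \<in> carr W \<Longrightarrow> laT a (m \<otimes>\<^bsub>V,W\<^esub> n) = la a m \<otimes>\<^bsub>V,W\<^esub> n"
  by (rule T_eqI) (simp_all add: laT_closed pT lin laT_ev rep_evT ptens_ev)

lemma raT_pure: "m \<in> carr V \<Longrightarrow> n \<in> carr W \<Longrightarrow> raT (m \<otimes>\<^bsub>V,W\<^esub> n) a = m \<otimes>\<^bsub>V,W\<^esub> raW n a"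
  by (rule T_eqI) (simp_all add: raT_closed pT lin raT_ev rep_evT ptens_ev)

lemma rrT_pure:
  assumes m: "m \<in> carr V" and n: "n \<in> carr W" and f: "bf T H f"
  shows "ST (m \<otimes>\<^bsub>V,W\<^esub> n) f = SR m (\<lambda>x a. SR' n (\<lambda>y b. f (x \<otimes>\<^bsub>V,W\<^esub> y) (a * b)))"
  by (simp add: rrT_ev pT m n f rep_evT lin linT0 ptens_ev bfD[OF f])

lemma laT_lin: "t \<in> carr T \<Longrightarrow> laT (a + b) t = laT a t + laT b t"
  "t \<in> carr T \<Longrightarrow> u \<in> carr T \<Longrightarrow> laT a (t + u) = laT a t + laT a u"
  "t \<in> carr T \<Longrightarrow> laT (scl H c a) t = scl T c (laT a t)"
  "t \<in> carr T \<Longrightarrow> laT a (scl T c t) = scl T c (laT a t)"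
  by (rule T_eqI; simp add: laT_closed linT0 lin laT_ev rep_evT)+

lemma raT_lin: "t \<in> carr T \<Longrightarrow> raT t (a + b) = raT t a + raT t b"
  "t \<in> carr T \<Longrightarrow> u \<in> carr T \<Longrightarrow> raT (t + u) a = raT t a + raT u a"
  "t \<in> carr T \<Longrightarrow> raT t (scl H c a) = scl T c (raT t a)"
  "t \<in> carr T \<Longrightarrow> raT (scl T c t) a = scl T c (raT t a)"
  by (rule T_eqI; simp add: raT_closed linT0 lin raT_ev rep_evT)+

lemma rrT_lin:
  assumes f: "bf T H f"
  shows "t \<in> carr T \<Longrightarrow> u \<in> carr T \<Longrightarrow> ST (t + u) f = ST t f + ST u f"
    "t \<in> carr T \<Longrightarrow> ST (scl T c t) f = c * ST t f"
  by (simp_all add: linT0 lin rrT_ev f rep_evT bfD[OF f])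

lemmas linT = linT0 laT_lin raT_lin rrT_lin laT_closed raT_closed

text \<open>Coassociativity of the two factors, joined by multiplicativity of the coproduct on the
  product of their legs in \<open>H\<close>.\<close>

lemma rrT_coassoc:
  assumes t: "t \<in> carr T" and g: "tf T H H g"
  shows "ST t (\<lambda>s b. ST s (\<lambda>u a. g u a b)) = ST t (\<lambda>u c. SD c (\<lambda>a b. g u a b))"
proof -
  note [simp] = tfD[OF g] and l = lin linT
  have bg: "bf H H (g x)" if "x \<in> carr T" for x using g that by (simp add: tf_def)
  have "ST t (\<lambda>s b. ST s (\<lambda>u a. g u a b))
    = SS V W (rep V W t) (\<lambda>m n. SR m (\<lambda>x a. SR' n (\<lambda>y b. SR x (\<lambda>z c. SR' y (\<lambda>v d. g (z \<otimes>\<^bsub>V,W\<^esub> v) (c * d) (a * b))))))"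
    by (simp add: rrT_ev[OF t] rrT_pure l)
  also have "\<dots> = SS V W (rep V W t) (\<lambda>m n. SR m (\<lambda>x a. SR x (\<lambda>z c. SR' n (\<lambda>y b. SR' y (\<lambda>v d. g (z \<otimes>\<^bsub>V,W\<^esub> v) (c * d) (a * b))))))"
    by (rule SS_cong[OF refl], rule SS_cong[OF refl], rule SS_swap)
  also have "\<dots> = SS V W (rep V W t) (\<lambda>m n. SR m (\<lambda>z w. SD w (\<lambda>c a. SR' n (\<lambda>v q. SD q (\<lambda>d b. g (z \<otimes>\<^bsub>V,W\<^esub> v) (c * d) (a * b))))))"
  proof (rule SS_cong[OF refl])
    fix m n assume m: "m \<in> carr V" and n: "n \<in> carr W"
    have "SR m (\<lambda>x a. SR x (\<lambda>z c. SR' n (\<lambda>y b. SR' y (\<lambda>v d. g (z \<otimes>\<^bsub>V,W\<^esub> v) (c * d) (a * b)))))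
      = SR m (\<lambda>z w. SD w (\<lambda>c a. SR' n (\<lambda>y b. SR' y (\<lambda>v d. g (z \<otimes>\<^bsub>V,W\<^esub> v) (c * d) (a * b)))))" (is "?l = _")
      by (subst M.rr_coassoc[OF m]) (simp_all add: l n)
    also have "\<dots> = SR m (\<lambda>z w. SD w (\<lambda>c a. SR' n (\<lambda>v q. SD q (\<lambda>d b. g (z \<otimes>\<^bsub>V,W\<^esub> v) (c * d) (a * b)))))" (is "_ = ?r")
      using N.rr_coassoc[OF n, of "\<lambda>v d b. g (z \<otimes>\<^bsub>V,W\<^esub> v) (c * d) (a * b)" for z c a]
      by (simp add: l)
    finally show "?l = ?r" .
  qed
  also have "\<dots> = SS V W (rep V W t) (\<lambda>m n. SR m (\<lambda>z w. SR' n (\<lambda>v q. SD w (\<lambda>c a. SD q (\<lambda>d b. g (z \<otimes>\<^bsub>V,W\<^esub> v) (c * d) (a * b))))))"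
    by (rule SS_cong[OF refl], rule SS_cong[OF refl], rule SS_swap)
  also have "\<dots> = ST t (\<lambda>u c. SD c (\<lambda>a b. g u a b))"
    by (simp add: rrT_ev t l M.dl_mult bg)
  finally show ?thesis .
qed

lemma rrT_counit:
  assumes t: "t \<in> carr T" and p: "lf T p"
  shows "ST t (\<lambda>x a. eps a * p x) = p t"
proof -
  note [simp] = lfD[OF p] and l = lin linT mult.left_commute
  have "ST t (\<lambda>x a. eps a * p x)
    = SS V W (rep V W t) (\<lambda>m n. SR m (\<lambda>x a. eps a * p (x \<otimes>\<^bsub>V,W\<^esub> n)))"
    using N.rr_counit[of _ "\<lambda>y. p (x \<otimes>\<^bsub>V,W\<^esub> y)" for x]
    by (simp add: rrT_ev t l M.eps_mult)
  also have "\<dots> = p t"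
    using M.rr_counit[of _ "\<lambda>x. p (x \<otimes>\<^bsub>V,W\<^esub> n)" for n] rep_lf[OF M.vsV, of t W p] t p
    by (simp add: l carrT lf_def sclT)
  finally show ?thesis .
qed

lemma rrT_laT:
  assumes t: "t \<in> carr T" and f: "bf T H f"
  shows "ST (laT a t) f = SD a (\<lambda>b c. ST t (\<lambda>x d. f (laT b x) (c * d)))"
proof -
  note [simp] = bfD[OF f] and l = lin linT
  let ?G = "\<lambda>m n. SR m (\<lambda>x a. SR' n (\<lambda>y b. f (x \<otimes>\<^bsub>V,W\<^esub> y) (a * b)))"
  have G: "bf V W ?G" by (simp add: l)
  have "ST (laT a t) f = SS V W (rep V W t) (\<lambda>m n. SD a (\<lambda>b c. SR m (\<lambda>x d. SR' n (\<lambda>y e. f (la b x \<otimes>\<^bsub>V,W\<^esub> y) (c * (d * e))))))"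
    using laT_ev[OF t G] rep_evT[OF laT_closed[OF t] G] by (simp add: rrT_ev laT_closed t f M.rr_la l)
  also have "\<dots> = SD a (\<lambda>b c. SS V W (rep V W t) (\<lambda>m n. SR m (\<lambda>x d. SR' n (\<lambda>y e. f (la b x \<otimes>\<^bsub>V,W\<^esub> y) (c * (d * e))))))"
    by (rule SS_swap)
  also have "\<dots> = SD a (\<lambda>b c. ST t (\<lambda>x d. f (laT b x) (c * d)))"
    by (simp add: rrT_ev t l laT_pure)
  finally show ?thesis .
qed

lemma rrT_raT:
  assumes t: "t \<in> carr T" and f: "bf T H f"
  shows "ST (raT t a) f = ST t (\<lambda>x d. SD a (\<lambda>b c. f (raT x b) (d * c)))"
proof -
  note [simp] = bfD[OF f] and l = lin linT
  let ?G = "\<lambda>m n. SR m (\<lambda>x a. SR' n (\<lambda>y b. f (x \<otimes>\<^bsub>V,W\<^esub> y) (a * b)))"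
  have G: "bf V W ?G" by (simp add: l)
  have "ST (raT t a) f = SS V W (rep V W t) (\<lambda>m n. ?G m (raW n a))"
    using raT_ev[OF t G] rep_evT[OF raT_closed[OF t] G] by (simp add: rrT_ev raT_closed t f)
  also have "\<dots> = ST t (\<lambda>x d. SD a (\<lambda>b c. f (raT x b) (d * c)))"
    by (simp add: rrT_ev t l raT_pure N.rr_ra)
  finally show ?thesis .
qed

lemma rcov_tensor: "rcov H dl eps S T laT raT rrT"
proof
  fix t a b assume t: "t \<in> carr T"
  note l = t linT lin laT_ev raT_ev rep_evT M.la_mult M.la_one N.ra_mult N.ra_one
  show "laT 1 t = t" "raT t 1 = t" "laT (a * b) t = laT a (laT b t)" "raT t (a * b) = raT (raT t a) b"
    "raT (laT a t) b = laT a (raT t b)"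
    by (rule T_eqI; simp add: l)+
qed (simp_all add: linT rrT_coassoc rrT_counit rrT_laT rrT_raT)

end

locale biten = bipair H dl dlc eps S Si V la ra rr ll W laW raW rrW llW
    + R: rten H dl eps S V la ra rr W laW raW rrW T laT raT rrT
    + L: rten H dlc eps Si V la ra ll W laW raW llW T laT raT llT
  for H :: "('k::field, 'h::ring_1, 'z) vs_scheme" and dl dlc eps S Si
    and V :: "('k, 'v::ab_group_add, 'y) vs_scheme" and la ra rr ll
    and W :: "('k, 'w::ab_group_add, 'x) vs_scheme" and laW raW rrW llW
    and T :: "('k, ('k, 'v, 'w) tens, 'u) vs_scheme" and laT raT rrT llT
begin

abbreviation "ST t \<equiv> SS T H (rrT t)"
abbreviation "SLT t \<equiv> SS T H (llT t)"

lemma tensor_comm: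
  assumes t: "t \<in> carr T" and g: "tf T H H g"
  shows "ST t (\<lambda>x a. SLT x (\<lambda>y b. g y b a)) = SLT t (\<lambda>x b. ST x (\<lambda>y a. g y b a))"
proof -
  note [simp] = tfD[OF g] and l = R.lin R.linT L.lin L.linT
  have "ST t (\<lambda>x a. SLT x (\<lambda>y b. g y b a))
    = SS V W (rep V W t) (\<lambda>m n. SR m (\<lambda>x a. SR' n (\<lambda>y b. SL x (\<lambda>z c. SL' y (\<lambda>v d. g (z \<otimes>\<^bsub>V,W\<^esub> v) (c * d) (a * b))))))"
    by (simp add: R.rrT_ev t L.rrT_pure l)
  also have "\<dots> = SS V W (rep V W t) (\<lambda>m n. SR m (\<lambda>x a. SL x (\<lambda>z c. SR' n (\<lambda>y b. SL' y (\<lambda>v d. g (z \<otimes>\<^bsub>V,W\<^esub> v) (c * d) (a * b))))))"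
    by (rule SS_cong[OF refl], rule SS_cong[OF refl], rule SS_swap)
  also have "\<dots> = SS V W (rep V W t) (\<lambda>m n. SL m (\<lambda>x c. SR x (\<lambda>z a. SL' n (\<lambda>y d. SR' y (\<lambda>v b. g (z \<otimes>\<^bsub>V,W\<^esub> v) (c * d) (a * b))))))"
  proof (rule SS_cong[OF refl])
    fix m n assume m: "m \<in> carr V" and n: "n \<in> carr W"
    have "SR m (\<lambda>x a. SL x (\<lambda>z c. SR' n (\<lambda>y b. SL' y (\<lambda>v d. g (z \<otimes>\<^bsub>V,W\<^esub> v) (c * d) (a * b)))))
      = SL m (\<lambda>x c. SR x (\<lambda>z a. SR' n (\<lambda>y b. SL' y (\<lambda>v d. g (z \<otimes>\<^bsub>V,W\<^esub> v) (c * d) (a * b)))))" (is "?l = _")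
      by (rule M.comm[OF m]) (simp add: l n)
    also have "\<dots> = SL m (\<lambda>x c. SR x (\<lambda>z a. SL' n (\<lambda>y d. SR' y (\<lambda>v b. g (z \<otimes>\<^bsub>V,W\<^esub> v) (c * d) (a * b)))))" (is "_ = ?r")
      using N.comm[OF n, of "\<lambda>v d b. g (z \<otimes>\<^bsub>V,W\<^esub> v) (c * d) (a * b)" for z c a]
      by (simp add: l)
    finally show "?l = ?r" .
  qed
  also have "\<dots> = SS V W (rep V W t) (\<lambda>m n. SL m (\<lambda>x c. SL' n (\<lambda>y d. SR x (\<lambda>z a. SR' y (\<lambda>v b. g (z \<otimes>\<^bsub>V,W\<^esub> v) (c * d) (a * b))))))"
    by (rule SS_cong[OF refl], rule SS_cong[OF refl], rule SS_swap)
  also have "\<dots> = SLT t (\<lambda>x b. ST x (\<lambda>y a. g y b a))"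
    by (simp add: L.rrT_ev t R.rrT_pure l)
  finally show ?thesis .
qed

lemma bicov_tensor: "bicov H dl dlc eps S Si T laT raT rrT llT"
  by (intro bicov.intro bicov_axioms.intro R.rcov_tensor L.rcov_tensor M.dlc tensor_comm)

end

section \<open>Bicovariant bimodules as records\<close>

lemma lin_closed: "lin A W f \<Longrightarrow> x \<in> carr A \<Longrightarrow> f x \<in> carr W"
  and lin_add: "lin A W f \<Longrightarrow> x \<in> carr A \<Longrightarrow> y \<in> carr A \<Longrightarrow> f (x + y) = f x + f y"
  and lin_scl: "lin A W f \<Longrightarrow> x \<in> carr A \<Longrightarrow> f (scl A c x) = scl W c (f x)"
  by (simp_all add: lin_def)

lemmas linD = lin_closed lin_add lin_scl

lemma bil_closed: "bilin A B W f \<Longrightarrow> x \<in> carr A \<Longrightarrow> b \<in> carr B \<Longrightarrow> f x b \<in> carr W"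
  and bil_add1: "bilin A B W f \<Longrightarrow> x \<in> carr A \<Longrightarrow> y \<in> carr A \<Longrightarrow> b \<in> carr B \<Longrightarrow> f (x + y) b = f x b + f y b"
  and bil_scl1: "bilin A B W f \<Longrightarrow> x \<in> carr A \<Longrightarrow> b \<in> carr B \<Longrightarrow> f (scl A c x) b = scl W c (f x b)"
  and bil_add2: "bilin A B W f \<Longrightarrow> u \<in> carr B \<Longrightarrow> v \<in> carr B \<Longrightarrow> x \<in> carr A \<Longrightarrow> f x (u + v) = f x u + f x v"
  and bil_scl2: "bilin A B W f \<Longrightarrow> u \<in> carr B \<Longrightarrow> x \<in> carr A \<Longrightarrow> f x (scl B c u) = scl W c (f x u)"
  by (simp_all add: bilin_def lin_def)

lemmas bilD = bil_closed bil_add1 bil_scl1 bil_add2 bil_scl2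

lemma lin_id: "lin A A id"
  by (simp add: lin_def)

lemma tmap_bilin:
  assumes v: "is_vs A" "is_vs B" "is_vs A'" and f: "lin A A' f" and g: "lin B B' g"
  shows "bilin A B (A' \<otimes>\<^sub>v B') (\<lambda>a b. f a \<otimes>\<^bsub>A',B'\<^esub> g b)"
proof (rule bilinI_tensor[OF _ v])
  show "bf A B (\<lambda>a b. (f a \<otimes>\<^bsub>A',B'\<^esub> g b) \<beta>)" if \<beta>: "bf A' B' \<beta>" for \<beta>
    using bfD[OF \<beta>] by (simp add: ptens_ev \<beta> bf_def[of A B] lf_def linD[OF f] linD[OF g])
qed (simp add: linD[OF f] linD[OF g])

lemma tmap_in:
  assumes "is_vs A" "is_vs B" "is_vs A'" "lin A A' f" "lin B B' g" "t \<in> carr (A \<otimes>\<^sub>v B)"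
  shows "tmap A B A' B' f g t \<in> carr (A' \<otimes>\<^sub>v B')"
  unfolding tmap_def by (rule sw_closed[OF is_vs_tensor tmap_bilin[OF assms(1-5)] assms(6)])

lemma tmap_ev:
  assumes "is_vs A" "is_vs B" "is_vs A'" "lin A A' f" "lin B B' g" "t \<in> carr (A \<otimes>\<^sub>v B)" and \<beta>: "bf A' B' \<beta>"
  shows "tmap A B A' B' f g t \<beta> = SS A B (rep A B t) (\<lambda>a b. \<beta> (f a) (g b))"
  unfolding tmap_def
  by (simp add: sw_eq_SS[OF assms(1) is_vs_tensor tmap_bilin[OF assms(1-5)] assms(6)] SS_apply ptens_ev \<beta>)

text \<open>The outer \<open>sw\<close> of \<open>tprod\<close> can be evaluated only when the inner
  one is known to be bilinear in the outer variables; the value of the inner one at forms gives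
  exactly this.\<close>

lemma tprod_bilin:
  assumes v: "is_vs A" "is_vs A'" "is_vs B" "is_vs B'" "is_vs C"
    and f: "bilin A B C f" and g: "bilin A' B' C' g" and u: "u \<in> carr (B \<otimes>\<^sub>v B')"
  defines "F \<equiv> \<lambda>a a'. sw B B' (C \<otimes>\<^sub>v C') u (\<lambda>b b'. f a b \<otimes>\<^bsub>C,C'\<^esub> g a' b')"
  shows "bilin A A' (C \<otimes>\<^sub>v C') F"
    and "a \<in> carr A \<Longrightarrow> a' \<in> carr A' \<Longrightarrow> bf C C' \<beta> \<Longrightarrow> F a a' \<beta> = SS B B' (rep B B' u) (\<lambda>b b'. \<beta> (f a b) (g a' b'))"
proof -
  note fg = bilD[OF f] bilD[OF g]
  have lin: "lin B C (f a)" "lin B' C' (g a')" if "a \<in> carr A" "a' \<in> carr A'" for a a'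
    using f g that by (simp_all add: bilin_def)
  have ev: "F a a' \<beta> = SS B B' (rep B B' u) (\<lambda>b b'. \<beta> (f a b) (g a' b'))"
    if a: "a \<in> carr A" "a' \<in> carr A'" and \<beta>: "bf C C' \<beta>" for a a' \<beta>
    using tmap_ev[OF v(3-5) lin[OF a] u \<beta>] by (simp add: tmap_def F_def)
  then show "a \<in> carr A \<Longrightarrow> a' \<in> carr A' \<Longrightarrow> bf C C' \<beta> \<Longrightarrow> F a a' \<beta> = SS B B' (rep B B' u) (\<lambda>b b'. \<beta> (f a b) (g a' b'))" .
  show "bilin A A' (C \<otimes>\<^sub>v C') F"
  proof (rule bilinI_tensor[OF _ v(1,2,5)])
    show "F a a' \<in> carr (C \<otimes>\<^sub>v C')" if "a \<in> carr A" "a' \<in> carr A'" for a a'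
      using tmap_in[OF v(3-5) lin[OF that] u] by (simp add: tmap_def F_def)
    show "bf A A' (\<lambda>a b. F a b \<beta>)" if \<beta>: "bf C C' \<beta>" for \<beta>
      using bfD[OF \<beta>] by (simp add: bf_def[of A A'] lf_def ev \<beta> fg v vs_closed)
  qed
qed

lemma tprod_in:
  assumes "is_vs A" "is_vs A'" "is_vs B" "is_vs B'" "is_vs C"
    and "bilin A B C f" "bilin A' B' C' g" "u \<in> carr (B \<otimes>\<^sub>v B')" "t \<in> carr (A \<otimes>\<^sub>v A')"
  shows "tprod A A' B B' C C' f g t u \<in> carr (C \<otimes>\<^sub>v C')"
  unfolding tprod_def by (rule sw_closed[OF is_vs_tensor tprod_bilin(1)[OF assms(1-8)] assms(9)])

lemma tprod_ev:
  assumes "is_vs A" "is_vs A'" "is_vs B" "is_vs B'" "is_vs C"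
    and "bilin A B C f" "bilin A' B' C' g" "u \<in> carr (B \<otimes>\<^sub>v B')" "t \<in> carr (A \<otimes>\<^sub>v A')" and \<beta>: "bf C C' \<beta>"
  shows "tprod A A' B B' C C' f g t u \<beta>
    = SS A A' (rep A A' t) (\<lambda>a a'. SS B B' (rep B B' u) (\<lambda>b b'. \<beta> (f a b) (g a' b')))"
  unfolding tprod_def
  by (simp add: sw_eq_SS[OF assms(1) is_vs_tensor tprod_bilin(1)[OF assms(1-8)] assms(9)] SS_apply
      tprod_bilin(2)[OF assms(1-8) _ _ \<beta>])

lemma tassoc_bilin:
  assumes v: "is_vs A" "is_vs B" "is_vs C"
  defines "F \<equiv> \<lambda>s c. sw A B (A \<otimes>\<^sub>v (B \<otimes>\<^sub>v C)) s (\<lambda>a b. a \<otimes>\<^bsub>A,B \<otimes>\<^sub>v C\<^esub> (b \<otimes>\<^bsub>B,C\<^esub> c))"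
  shows "bilin (A \<otimes>\<^sub>v B) C (A \<otimes>\<^sub>v (B \<otimes>\<^sub>v C)) F"
    and "s \<in> carr (A \<otimes>\<^sub>v B) \<Longrightarrow> c \<in> carr C \<Longrightarrow> bf A (B \<otimes>\<^sub>v C) \<beta> \<Longrightarrow>
      F s c \<beta> = SS A B (rep A B s) (\<lambda>a b. \<beta> a (b \<otimes>\<^bsub>B,C\<^esub> c))"
proof -
  have bl: "bilin A B (A \<otimes>\<^sub>v (B \<otimes>\<^sub>v C)) (\<lambda>a b. a \<otimes>\<^bsub>A,B \<otimes>\<^sub>v C\<^esub> (b \<otimes>\<^bsub>B,C\<^esub> c))" if "c \<in> carr C" for c
    using that tmap_bilin[OF v(1,2,1) lin_id, of "B \<otimes>\<^sub>v C" "\<lambda>b. b \<otimes>\<^bsub>B,C\<^esub> c"]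
    by (simp add: lin_def ptensD)
  have ev: "F s c \<beta> = SS A B (rep A B s) (\<lambda>a b. \<beta> a (b \<otimes>\<^bsub>B,C\<^esub> c))"
    if "s \<in> carr (A \<otimes>\<^sub>v B)" "c \<in> carr C" "bf A (B \<otimes>\<^sub>v C) \<beta>" for s c \<beta>
    unfolding F_def using that by (simp add: sw_eq_SS[OF v(1) is_vs_tensor bl] SS_apply ptens_ev)
  then show "s \<in> carr (A \<otimes>\<^sub>v B) \<Longrightarrow> c \<in> carr C \<Longrightarrow> bf A (B \<otimes>\<^sub>v C) \<beta> \<Longrightarrow>
      F s c \<beta> = SS A B (rep A B s) (\<lambda>a b. \<beta> a (b \<otimes>\<^bsub>B,C\<^esub> c))" .
  show "bilin (A \<otimes>\<^sub>v B) C (A \<otimes>\<^sub>v (B \<otimes>\<^sub>v C)) F"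
  proof (rule bilinI_tensor[OF _ is_vs_tensor v(3,1)])
    show "F s c \<in> carr (A \<otimes>\<^sub>v (B \<otimes>\<^sub>v C))" if "s \<in> carr (A \<otimes>\<^sub>v B)" "c \<in> carr C" for s c
      unfolding F_def by (rule sw_closed[OF is_vs_tensor bl[OF that(2)] that(1)])
    show "bf (A \<otimes>\<^sub>v B) C (\<lambda>a b. F a b \<beta>)" if \<beta>: "bf A (B \<otimes>\<^sub>v C) \<beta>" for \<beta>
    proof -
      note b = bfD[OF \<beta>]
      have "bf A B (\<lambda>a b. \<beta> a (b \<otimes>\<^bsub>B,C\<^esub> c))" if "c \<in> carr C" for c
        using that by (simp add: bf_def[of A B] lf_def b ptensD)
      then show ?thesis
        by (simp add: bf_def[of "A \<otimes>\<^sub>v B" C] lf_def ev \<beta> v vs_closed is_vs_tensor rep_ev b ptensD)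
    qed
  qed
qed

lemma tassoc_in:
  assumes "is_vs A" "is_vs B" "is_vs C" "t \<in> carr ((A \<otimes>\<^sub>v B) \<otimes>\<^sub>v C)"
  shows "tassoc A B C t \<in> carr (A \<otimes>\<^sub>v (B \<otimes>\<^sub>v C))"
  unfolding tassoc_def by (rule sw_closed[OF is_vs_tensor tassoc_bilin(1)[OF assms(1-3)] assms(4)])

lemma tassoc_ev:
  assumes "is_vs A" "is_vs B" "is_vs C" "t \<in> carr ((A \<otimes>\<^sub>v B) \<otimes>\<^sub>v C)" and \<beta>: "bf A (B \<otimes>\<^sub>v C) \<beta>"
  shows "tassoc A B C t \<beta> = SS (A \<otimes>\<^sub>v B) C (rep (A \<otimes>\<^sub>v B) C t) (\<lambda>s c. SS A B (rep A B s) (\<lambda>a b. \<beta> a (b \<otimes>\<^bsub>B,C\<^esub> c)))"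
  unfolding tassoc_def
  by (simp add: sw_eq_SS[OF is_vs_tensor is_vs_tensor tassoc_bilin(1)[OF assms(1-3)] assms(4)] SS_apply
      tassoc_bilin(2)[OF assms(1-3) _ _ \<beta>])

lemma bf_assoc:
  assumes v: "is_vs A" "is_vs B" "is_vs C" and \<beta>: "bf A (B \<otimes>\<^sub>v C) \<beta>"
  shows "bf (A \<otimes>\<^sub>v B) C (\<lambda>s c. SS A B (rep A B s) (\<lambda>a b. \<beta> a (b \<otimes>\<^bsub>B,C\<^esub> c)))"
proof -
  note b = bfD[OF \<beta>]
  have "bf A B (\<lambda>a b. \<beta> a (b \<otimes>\<^bsub>B,C\<^esub> c))" if "c \<in> carr C" for c
    using that by (simp add: bf_def[of A B] lf_def b ptensD)
  then show ?thesis
    by (simp add: bf_def[of "A \<otimes>\<^sub>v B" C] lf_def v vs_closed is_vs_tensor rep_ev b ptensD)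
qed

text \<open>
  The common form of the coassociativity axioms and of the axiom that the two coactions commute.
\<close>

lemma coassoc_iff:
  assumes v: "is_vs A" "is_vs B" "is_vs C" "is_vs D" "is_vs E"
    and p: "lin D (A \<otimes>\<^sub>v B) p" and q: "lin E (B \<otimes>\<^sub>v C) q"
    and t: "t \<in> carr (D \<otimes>\<^sub>v C)" and u: "u \<in> carr (A \<otimes>\<^sub>v E)"
  shows "tassoc A B C (tmap D C (A \<otimes>\<^sub>v B) C p id t) = tmap A E A (B \<otimes>\<^sub>v C) id q u \<longleftrightarrow>
    (\<forall>g. tf A B C g \<longrightarrow> SS D C (rep D C t) (\<lambda>x c. SS A B (rep A B (p x)) (\<lambda>a b. g a b c))
       = SS A E (rep A E u) (\<lambda>a e. SS B C (rep B C (q e)) (\<lambda>b c. g a b c)))" (is "?l = ?r \<longleftrightarrow> ?P")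
proof -
  have w: "tmap D C (A \<otimes>\<^sub>v B) C p id t \<in> carr ((A \<otimes>\<^sub>v B) \<otimes>\<^sub>v C)"
    by (rule tmap_in[OF v(4,3) is_vs_tensor p lin_id t])
  have l: "?l \<in> carr (A \<otimes>\<^sub>v (B \<otimes>\<^sub>v C))" by (rule tassoc_in[OF v(1-3) w])
  have r: "?r \<in> carr (A \<otimes>\<^sub>v (B \<otimes>\<^sub>v C))" by (rule tmap_in[OF v(1,5,1) lin_id q u])
  have l_ev: "?l \<beta> = SS D C (rep D C t) (\<lambda>x c. SS A B (rep A B (p x)) (\<lambda>a b. \<beta> a (b \<otimes>\<^bsub>B,C\<^esub> c)))"
    if \<beta>: "bf A (B \<otimes>\<^sub>v C) \<beta>" for \<beta>
  proof -
    note G = bf_assoc[OF v(1-3) \<beta>]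
    show ?thesis
      using tassoc_ev[OF v(1-3) w \<beta>] rep_ev[OF is_vs_tensor w G] tmap_ev[OF v(4,3) is_vs_tensor p lin_id t G]
      by simp
  qed
  have r_ev: "?r \<beta> = SS A E (rep A E u) (\<lambda>a e. SS B C (rep B C (q e)) (\<lambda>b c. \<beta> a (b \<otimes>\<^bsub>B,C\<^esub> c)))"
    if \<beta>: "bf A (B \<otimes>\<^sub>v C) \<beta>" for \<beta>
  proof -
    have "\<beta> a (q e) = SS B C (rep B C (q e)) (\<lambda>b c. \<beta> a (b \<otimes>\<^bsub>B,C\<^esub> c))" if "a \<in> carr A" "e \<in> carr E" for a e
      using \<beta> that by (intro rep_lf v linD[OF q]) (simp_all add: bf_def)
    then show ?thesis using tmap_ev[OF v(1,5,1) lin_id q u \<beta>] by simp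
  qed
  show ?thesis
  proof
    assume eq: "?l = ?r"
    show ?P
    proof (intro allI impI)
      fix g assume g: "tf A B C g"
      \<comment> \<open>A trilinear form extends to a bilinear form on \<open>A\<close> and
        \<open>B \<otimes> C\<close>; it is linear in the tensor because, by \<open>rep_ev\<close>,
        the sum over the chosen list is an evaluation of the tensor.\<close>
      let ?\<beta> = "\<lambda>a s. SS B C (rep B C s) (g a)"
      have bg: "bf B C (g a)" if "a \<in> carr A" for a using g that by (simp add: tf_def)
      have \<beta>: "bf A (B \<otimes>\<^sub>v C) ?\<beta>"
        using tfD[OF g] by (simp add: bf_def lf_def rep_ev v vs_closed is_vs_tensor bg)
      have pt: "?\<beta> a (b \<otimes>\<^bsub>B,C\<^esub> c) = g a b c" if "a \<in> carr A" "b \<in> carr B" "c \<in> carr C" for a b c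
        using that by (simp add: rep_ev v bg ptens_ev)
      from l_ev[OF \<beta>] r_ev[OF \<beta>] eq
      show "SS D C (rep D C t) (\<lambda>x c. SS A B (rep A B (p x)) (\<lambda>a b. g a b c))
       = SS A E (rep A E u) (\<lambda>a e. SS B C (rep B C (q e)) (\<lambda>b c. g a b c))"
        by (simp add: pt)
    qed
  next
    assume P: ?P
    show "?l = ?r"
    proof (rule tensor_eqI[OF v(1) l r])
      fix \<beta> assume \<beta>: "bf A (B \<otimes>\<^sub>v C) \<beta>"
      have "tf A B C (\<lambda>a b c. \<beta> a (b \<otimes>\<^bsub>B,C\<^esub> c))"
        by (simp add: tf_def bf_def[of B C] lf_def bfD[OF \<beta>] ptensD)
      with P l_ev[OF \<beta>] r_ev[OF \<beta>] show "?l \<beta> = ?r \<beta>" by simp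
    qed
  qed
qed

section \<open>Translation between records of tensors and lists\<close>

definition dlH :: "('k::field, 'h::ring_1) hopf \<Rightarrow> 'h \<Rightarrow> ('h \<times> 'h) list" where
  "dlH H h = rep H H (comult H h)"

definition dlcH :: "('k::field, 'h::ring_1) hopf \<Rightarrow> 'h \<Rightarrow> ('h \<times> 'h) list" where
  "dlcH H h = map prod.swap (dlH H h)"

definition rrM :: "('k::field, 'h::ring_1) hopf \<Rightarrow> ('k, 'h, 'm::ab_group_add) bimod \<Rightarrow> 'm \<Rightarrow> ('m \<times> 'h) list" where
  "rrM H M m = rep M H (rcoact M m)"

definition llM :: "('k::field, 'h::ring_1) hopf \<Rightarrow> ('k, 'h, 'm::ab_group_add) bimod \<Rightarrow> 'm \<Rightarrow> ('m \<times> 'h) list" where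
  "llM H M m = map prod.swap (rep H M (lcoact M m))"

abbreviation bicovH where
  "bicovH H M \<equiv> bicov H (dlH H) (dlcH H) (counit H) (antipode H) (antipode_inv H) M (lact M) (ract M) (rrM H M) (llM H M)"

lemma hopfL_hopf_algebra:
  assumes "hopf_algebra H"
  shows "hopfL H (dlH H) (counit H) (antipode H)"
proof -
  interpret hopf_algebra H by fact
  note cm = linD[OF comult_lin] and e = linD[OF counit_lin] and s = linD[OF antipode_lin]
    and m = bilD[OF mult_bilin]
  have ev: "SS H H (dlH H h) f = comult H h f" if "bf H H f" for h f
    using that by (simp add: dlH_def rep_ev vs_H cm carr_H)
  have C: "comult H h \<in> carr (H \<otimes>\<^sub>v H)" for h by (simp add: cm carr_H)
  have sw: "p (sw H H H (comult H h) f) = SS H H (dlH H h) (\<lambda>a b. p (f a b))"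
    if "bilin H H H f" "lf H p" for p f h
    unfolding dlH_def by (rule sw_lf[OF vs_H vs_H that(1) C that(2)])
  have bl: "bilin H H H (\<lambda>a b. f a * g b)" if "lin H H f" "lin H H g" for f g
    using that m by (simp add: bilin_def lin_def carr_H)
  show ?thesis
  proof
    show "is_vs H" by (rule vs_H)
    show "carr H = UNIV" by (rule carr_H)
    show "SS H H (dlH H a) (\<lambda>x y. SS H H (dlH H x) (\<lambda>u v. g u v y)) = SS H H (dlH H a) (\<lambda>x y. SS H H (dlH H y) (g x))"
      if "tf H H H g" for g a
      using that coassoc[of a] coassoc_iff[OF vs_H vs_H vs_H vs_H vs_H comult_lin comult_lin C C, of a a]
      by (simp add: dlH_def)
    show "SS H H (dlH H a) (\<lambda>x y. counit H x * p y) = p a" if p: "lf H p" for p a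
    proof -
      have "bilin H H H (\<lambda>a b. scl H (counit H a) b)"
        by (rule bilinI[OF _ vs_H vs_H vs_H]) (simp_all add: carr_H mf_defs e base_field_def algebra_simps)
      from sw[OF this p, of a] show ?thesis by (simp add: counit_left lfD[OF p])
    qed
    show "SS H H (dlH H a) (\<lambda>x y. counit H y * p x) = p a" if p: "lf H p" for p a
    proof -
      have "bilin H H H (\<lambda>a b. scl H (counit H b) a)"
        by (rule bilinI[OF _ vs_H vs_H vs_H]) (simp_all add: carr_H mf_defs e base_field_def algebra_simps)
      from sw[OF this p, of a] show ?thesis by (simp add: counit_right lfD[OF p])
    qed
    show "SS H H (dlH H (a * b)) f = SS H H (dlH H a) (\<lambda>x y. SS H H (dlH H b) (\<lambda>u v. f (x * u) (y * v)))"
      if f: "bf H H f" for a b f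
      using tprod_ev[OF vs_H vs_H vs_H vs_H vs_H mult_bilin mult_bilin C C f, of a b]
      by (simp add: ev f comult_mult) (simp add: dlH_def)
    show "SS H H (dlH H a) (\<lambda>x y. p (antipode H x * y)) = counit H a * p 1" if p: "lf H p" for p a
      using sw[OF bl[OF antipode_lin lin_id] p, of a] by (simp add: antipode_left lfD[OF p] carr_H)
    show "SS H H (dlH H a) (\<lambda>x y. p (x * antipode H y)) = counit H a * p 1" if p: "lf H p" for p a
      using sw[OF bl[OF lin_id antipode_lin] p, of a] by (simp add: antipode_right lfD[OF p] carr_H)
  qed (simp_all add: m s e cm ev carr_H base_field_def counit_mult counit_one comult_one ptens_ev)
qed

text \<open>Each axiom between tensors is evaluated at forms. The membership statements are recorded
  as well, because the list form cannot recover them: \<open>rep\<close> is arbitrary outside the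
  carrier.\<close>

lemma bicovH_D:
  assumes b: "bij (antipode H)" and "bicovariant_bimodule H M"
  shows "bicovH H M" and "\<And>m. m \<in> carr M \<Longrightarrow> rcoact M m \<in> carr (M \<otimes>\<^sub>v H)"
    and "\<And>m. m \<in> carr M \<Longrightarrow> lcoact M m \<in> carr (H \<otimes>\<^sub>v M)"
proof -
  interpret bicovariant_bimodule H M by fact
  interpret R: hopfL H "dlH H" "counit H" "antipode H"
    by (rule hopfL_hopf_algebra) unfold_locales
  interpret L: hopfL H "dlcH H" "counit H" "antipode_inv H"
    unfolding antipode_inv_def by (rule hopfL_cop[OF R.hopfL_axioms b]) (simp add: dlcH_def)
  note r = linD[OF rcoact_lin] and l = linD[OF lcoact_lin] and cm = linD[OF comult_lin]
    and A = bilD[OF lact_bilin] bilD[OF ract_bilin]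
  show Rin: "rcoact M m \<in> carr (M \<otimes>\<^sub>v H)" if "m \<in> carr M" for m by (rule r(1)[OF that])
  show Lin: "lcoact M m \<in> carr (H \<otimes>\<^sub>v M)" if "m \<in> carr M" for m by (rule l(1)[OF that])
  have C: "comult H h \<in> carr (H \<otimes>\<^sub>v H)" for h by (simp add: cm carr_H)
  have rev: "SS M H (rrM H M m) f = rcoact M m f" if "bf M H f" "m \<in> carr M" for m f
    using that by (simp add: rrM_def rep_ev vs_M r)
  have flip: "bf H M (\<lambda>a m. f m a)" if "bf M H f" for f using that by (simp add: mf_defs)
  have lev: "SS M H (llM H M m) f = lcoact M m (\<lambda>a m. f m a)" if "bf M H f" "m \<in> carr M" for m f
    using that flip[OF that(1)] by (simp add: llM_def SS_flip rep_ev vs_H l)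
  \<comment> \<open>The record axiom treats both actions at once; putting \<open>b = 1\<close> or
    \<open>a = 1\<close> below separates it into the covariance laws for each action.\<close>
  have rr2: "SS M H (rrM H M (ract M (lact M a m) b)) f
    = SS H H (dlH H a) (\<lambda>a1 a2. SS M H (rrM H M m) (\<lambda>x d. SS H H (dlH H b) (\<lambda>b1 b2. f (ract M (lact M a1 x) b1) (a2 * d * b2))))"
    if m: "m \<in> carr M" and f: "bf M H f" for a m b f
  proof -
    note t1 = tprod_in[OF vs_H vs_H vs_M vs_H vs_M lact_bilin mult_bilin Rin[OF m] C, of a]
    have G: "bf M H (\<lambda>x d. SS H H (rep H H (comult H b)) (\<lambda>b1 b2. f (ract M x b1) (d * b2)))"
      using bfD[OF f] by (simp add: bf_def[of M H] lf_def A carr_H distrib_right R.scl_mult_left)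
    show ?thesis
      using tprod_ev[OF vs_M vs_H vs_H vs_H vs_M ract_bilin mult_bilin C t1 f, of b]
        rep_ev[OF vs_M t1 G] tprod_ev[OF vs_H vs_H vs_M vs_H vs_M lact_bilin mult_bilin Rin[OF m] C G, of a]
      by (simp add: rev f m A carr_H rcoact_bimod) (simp add: rrM_def dlH_def)
  qed
  have ll2: "SS M H (llM H M (ract M (lact M a m) b)) f
    = SS H H (dlH H a) (\<lambda>a1 a2. SS M H (llM H M m) (\<lambda>x d. SS H H (dlH H b) (\<lambda>b1 b2. f (ract M (lact M a2 x) b2) (a1 * d * b1))))"
    if m: "m \<in> carr M" and f: "bf M H f" for a m b f
  proof -
    note f' = flip[OF f]
    note t1 = tprod_in[OF vs_H vs_H vs_H vs_M vs_H mult_bilin lact_bilin Lin[OF m] C, of a]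
    have G: "bf H M (\<lambda>d x. SS H H (rep H H (comult H b)) (\<lambda>b1 b2. f (ract M x b2) (d * b1)))"
      using bfD[OF f] by (simp add: bf_def[of H M] lf_def A carr_H distrib_right R.scl_mult_left)
    show ?thesis
      using tprod_ev[OF vs_H vs_M vs_H vs_H vs_H mult_bilin ract_bilin C t1 f', of b]
        rep_ev[OF vs_H t1 G] tprod_ev[OF vs_H vs_H vs_H vs_M vs_H mult_bilin lact_bilin Lin[OF m] C G, of a]
      by (simp add: lev f m A carr_H lcoact_bimod) (simp add: llM_def SS_flip dlH_def)
  qed
  have cS: "SS H H (dlcH H a) f = SS H H (dlH H a) (\<lambda>x y. f y x)" for a f
    by (simp add: dlcH_def SS_flip)
  note lin = R.linH A vs_M
  show "bicovH H M"
  proof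
    show "SS M H (rrM H M m) (\<lambda>x b. SS M H (rrM H M x) (\<lambda>y a. g y a b)) = SS M H (rrM H M m) (\<lambda>x c. SS H H (dlH H c) (g x))"
      if m: "m \<in> carr M" and g: "tf M H H g" for m g
      using rcoact_coassoc[OF m] coassoc_iff[OF vs_M vs_H vs_H vs_M vs_H rcoact_lin comult_lin Rin[OF m] Rin[OF m]] g
      by (simp add: rrM_def dlH_def)
    show "SS M H (llM H M m) (\<lambda>x b. SS M H (llM H M x) (\<lambda>y a. g y a b)) = SS M H (llM H M m) (\<lambda>x c. SS H H (dlcH H c) (g x))"
      if m: "m \<in> carr M" and g: "tf M H H g" for m g
    proof -
      have "tf H H M (\<lambda>a b c. g c b a)" using g by (simp add: mf_defs)
      with lcoact_coassoc[OF m] coassoc_iff[OF vs_H vs_H vs_M vs_H vs_M comult_lin lcoact_lin Lin[OF m] Lin[OF m]]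
      show ?thesis by (simp add: llM_def dlH_def cS SS_flip)
    qed
    show "SS M H (rrM H M m) (\<lambda>x a. SS M H (llM H M x) (\<lambda>y b. g y b a)) = SS M H (llM H M m) (\<lambda>x b. SS M H (rrM H M x) (\<lambda>y a. g y b a))"
      if m: "m \<in> carr M" and g: "tf M H H g" for m g
    proof -
      have "tf H M H (\<lambda>b y a. g y b a)" using g by (simp add: mf_defs)
      with coact_commute[OF m] coassoc_iff[OF vs_H vs_M vs_H vs_M vs_M lcoact_lin rcoact_lin Rin[OF m] Lin[OF m]]
      show ?thesis by (simp add: llM_def rrM_def SS_flip)
    qed
    show "SS M H (rrM H M m) (\<lambda>x a. counit H a * p x) = p m" if m: "m \<in> carr M" and p: "lf M p" for m p
    proof -
      have "bilin M H M (\<lambda>m a. scl M (counit H a) m)"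
        by (rule bilinI[OF _ vs_M vs_H vs_M]) (simp_all add: vs_closed vs_M mf_defs R.eps_add R.eps_scl algebra_simps vs_scl_add vs_scl_scl)
      from sw_lf[OF vs_M vs_M this Rin[OF m] p] show ?thesis by (simp add: rcoact_counit m lfD[OF p] rrM_def)
    qed
    show "SS M H (llM H M m) (\<lambda>x a. counit H a * p x) = p m" if m: "m \<in> carr M" and p: "lf M p" for m p
    proof -
      have "bilin H M M (\<lambda>a m. scl M (counit H a) m)"
        by (rule bilinI[OF _ vs_H vs_M vs_M]) (simp_all add: vs_closed vs_M mf_defs R.eps_add R.eps_scl algebra_simps vs_scl_add vs_scl_scl)
      from sw_lf[OF vs_H vs_M this Lin[OF m] p] show ?thesis by (simp add: lcoact_counit m lfD[OF p] llM_def SS_flip)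
    qed
    show "SS M H (rrM H M (lact M a m)) f = SS H H (dlH H a) (\<lambda>b c. SS M H (rrM H M m) (\<lambda>x d. f (lact M b x) (c * d)))"
      if m: "m \<in> carr M" and f: "bf M H f" for m a f
      using rr2[OF m f, of a 1] bfD[OF f] by (simp add: ract_one m lin R.dl_one)
    show "SS M H (rrM H M (ract M m a)) f = SS M H (rrM H M m) (\<lambda>x d. SS H H (dlH H a) (\<lambda>b c. f (ract M x b) (d * c)))"
      if m: "m \<in> carr M" and f: "bf M H f" for m a f
      using rr2[OF m f, of 1 a] bfD[OF f] by (simp add: lact_one m lin R.dl_one)
    show "SS M H (llM H M (lact M a m)) f = SS H H (dlcH H a) (\<lambda>b c. SS M H (llM H M m) (\<lambda>x d. f (lact M b x) (c * d)))"
      if m: "m \<in> carr M" and f: "bf M H f" for m a f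
      using ll2[OF m f, of a 1] bfD[OF f] by (simp add: ract_one m lin R.dl_one cS)
    show "SS M H (llM H M (ract M m a)) f = SS M H (llM H M m) (\<lambda>x d. SS H H (dlcH H a) (\<lambda>b c. f (ract M x b) (d * c)))"
      if m: "m \<in> carr M" and f: "bf M H f" for m a f
      using ll2[OF m f, of 1 a] bfD[OF f] by (simp add: lact_one m lin R.dl_one cS)
  qed (simp_all add: vs_M A carr_H vs_closed lact_one ract_one lact_mult ract_mult lact_ract rev lev r l dlcH_def)
qed

text \<open>The way back, needed because \<open>HOM\<close> and \<open>bitensor\<close> are
  recognised as bicovariant bimodules in list form. Membership of the coactions makes the test on
  bilinear forms sufficient.\<close>

lemma bicovH_I:
  assumes "hopf_algebra H" and "bicovH H M" and Rin: "\<And>m. m \<in> carr M \<Longrightarrow> rcoact M m \<in> carr (M \<otimes>\<^sub>v H)"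
    and Lin: "\<And>m. m \<in> carr M \<Longrightarrow> lcoact M m \<in> carr (H \<otimes>\<^sub>v M)"
  shows "bicovariant_bimodule H M"
proof -
  interpret hopf_algebra H by fact
  interpret bicov H "dlH H" "dlcH H" "counit H" "antipode H" "antipode_inv H" M "lact M" "ract M" "rrM H M" "llM H M" by fact
  note vs_M = R.vsV and lin = R.linH R.linV L.linV
  have C: "comult H h \<in> carr (H \<otimes>\<^sub>v H)" for h by (simp add: linD[OF comult_lin] carr_H)
  have rev: "rcoact M m f = SS M H (rrM H M m) f" if "bf M H f" "m \<in> carr M" for m f
    using that by (simp add: rrM_def rep_ev vs_M Rin)
  have flip: "bf M H (\<lambda>m a. f a m)" if "bf H M f" for f using that by (simp add: mf_defs)
  have lev: "lcoact M m f = SS M H (llM H M m) (\<lambda>m a. f a m)" if "bf H M f" "m \<in> carr M" for m f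
    using that by (simp add: llM_def SS_flip rep_ev vs_H Lin)
  have la: "bilin H M M (lact M)" and ra: "bilin M H M (ract M)"
    by (simp_all add: bilin_def lin_def R.linV)
  have rl: "lin M (M \<otimes>\<^sub>v H) (rcoact M)"
    by (rule linI_tensor[OF Rin vs_M vs_M]) (simp_all add: lf_def rev R.linV)
  have ll: "lin M (H \<otimes>\<^sub>v M) (lcoact M)"
    by (rule linI_tensor[OF Lin vs_M vs_H]) (simp_all add: lf_def lev flip L.linV)
  have cS: "SS H H (dlcH H a) f = SS H H (dlH H a) (\<lambda>x y. f y x)" for a f
    by (simp add: dlcH_def SS_flip)
  show ?thesis
  proof
    show "is_vs M" "bilin H M M (lact M)" "bilin M H M (ract M)" "lin M (M \<otimes>\<^sub>v H) (rcoact M)" "lin M (H \<otimes>\<^sub>v M) (lcoact M)"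
      by (fact vs_M la ra rl ll)+
    fix m assume m: "m \<in> carr M"
    show "tassoc M H H (tmap M H (M \<otimes>\<^sub>v H) H (rcoact M) id (rcoact M m)) = tmap M H M (H \<otimes>\<^sub>v H) id (comult H) (rcoact M m)"
      unfolding coassoc_iff[OF vs_M vs_H vs_H vs_M vs_H rl comult_lin Rin[OF m] Rin[OF m]]
      using R.rr_coassoc[OF m] by (simp add: rrM_def dlH_def)
    show "tassoc H H M (tmap H M (H \<otimes>\<^sub>v H) M (comult H) id (lcoact M m)) = tmap H M H (H \<otimes>\<^sub>v M) id (lcoact M) (lcoact M m)"
      unfolding coassoc_iff[OF vs_H vs_H vs_M vs_H vs_M comult_lin ll Lin[OF m] Lin[OF m]]
    proof (intro allI impI)
      fix g assume "tf H H M g"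
      then have "tf M H H (\<lambda>c b a. g a b c)" by (simp add: mf_defs)
      from L.rr_coassoc[OF m this]
      show "SS H M (rep H M (lcoact M m)) (\<lambda>x c. SS H H (rep H H (comult H x)) (\<lambda>a b. g a b c))
        = SS H M (rep H M (lcoact M m)) (\<lambda>a e. SS H M (rep H M (lcoact M e)) (g a))"
        by (simp add: llM_def dlH_def cS SS_flip)
    qed
    show "tassoc H M H (tmap M H (H \<otimes>\<^sub>v M) H (lcoact M) id (rcoact M m)) = tmap H M H (M \<otimes>\<^sub>v H) id (rcoact M) (lcoact M m)"
      unfolding coassoc_iff[OF vs_H vs_M vs_H vs_M vs_M ll rl Rin[OF m] Lin[OF m]]
    proof (intro allI impI)
      fix g assume "tf H M H g"
      then have "tf M H H (\<lambda>y b a. g b y a)" by (simp add: mf_defs)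
      from comm[OF m this]
      show "SS M H (rep M H (rcoact M m)) (\<lambda>x c. SS H M (rep H M (lcoact M x)) (\<lambda>a b. g a b c))
        = SS H M (rep H M (lcoact M m)) (\<lambda>a e. SS M H (rep M H (rcoact M e)) (g a))"
        by (simp add: llM_def rrM_def SS_flip)
    qed
    show "sw M H M (rcoact M m) (\<lambda>m\<^sub>0 m\<^sub>1. scl M (counit H m\<^sub>1) m\<^sub>0) = m"
    proof (rule lf_sep[OF vs_M])
      fix p assume p: "lf M p"
      have "bilin M H M (\<lambda>m a. scl M (counit H a) m)"
        by (rule bilinI[OF _ vs_M vs_H vs_M]) (simp_all add: vs_closed vs_M mf_defs R.eps_add R.eps_scl algebra_simps vs_scl_add vs_scl_scl)
      from sw_lf[OF vs_M vs_M this Rin[OF m] p] R.rr_counit[OF m p]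
      show "p (sw M H M (rcoact M m) (\<lambda>m\<^sub>0 m\<^sub>1. scl M (counit H m\<^sub>1) m\<^sub>0)) = p m" by (simp add: lfD[OF p] rrM_def)
    qed
    show "sw H M M (lcoact M m) (\<lambda>m\<^sub>1 m\<^sub>0. scl M (counit H m\<^sub>1) m\<^sub>0) = m"
    proof (rule lf_sep[OF vs_M])
      fix p assume p: "lf M p"
      have "bilin H M M (\<lambda>a m. scl M (counit H a) m)"
        by (rule bilinI[OF _ vs_H vs_M vs_M]) (simp_all add: vs_closed vs_M mf_defs R.eps_add R.eps_scl algebra_simps vs_scl_add vs_scl_scl)
      from sw_lf[OF vs_H vs_M this Lin[OF m] p] L.rr_counit[OF m p]
      show "p (sw H M M (lcoact M m) (\<lambda>m\<^sub>1 m\<^sub>0. scl M (counit H m\<^sub>1) m\<^sub>0)) = p m" by (simp add: lfD[OF p] llM_def SS_flip)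
    qed
    fix a b
    have mab: "ract M (lact M a m) b \<in> carr M" by (simp add: R.linV m)
    show "rcoact M (ract M (lact M a m) b) = tprod M H H H M H (ract M) (*)
          (tprod H H M H M H (lact M) (*) (comult H a) (rcoact M m)) (comult H b)"
    proof (rule tensor_eqI[OF vs_M Rin[OF mab]])
      note t1 = tprod_in[OF vs_H vs_H vs_M vs_H vs_M la mult_bilin Rin[OF m] C, of a]
      show "tprod M H H H M H (ract M) (*) (tprod H H M H M H (lact M) (*) (comult H a) (rcoact M m)) (comult H b) \<in> carr (M \<otimes>\<^sub>v H)"
        by (rule tprod_in[OF vs_M vs_H vs_H vs_H vs_M ra mult_bilin C t1])
      fix f assume f: "bf M H f"
      note [simp] = bfD[OF f]
      have G: "bf M H (\<lambda>x d. SS H H (rep H H (comult H b)) (\<lambda>b1 b2. f (ract M x b1) (d * b2)))"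
        by (simp add: lin)
      show "rcoact M (ract M (lact M a m) b) f = tprod M H H H M H (ract M) (*)
          (tprod H H M H M H (lact M) (*) (comult H a) (rcoact M m)) (comult H b) f"
        using tprod_ev[OF vs_M vs_H vs_H vs_H vs_M ra mult_bilin C t1 f, of b]
          rep_ev[OF vs_M t1 G] tprod_ev[OF vs_H vs_H vs_M vs_H vs_M la mult_bilin Rin[OF m] C G, of a]
        by (simp add: rev f mab R.rr_ra R.rr_la m lin) (simp add: rrM_def dlH_def)
    qed
    show "lcoact M (ract M (lact M a m) b) = tprod H M H H H M (*) (ract M)
          (tprod H H H M H M (*) (lact M) (comult H a) (lcoact M m)) (comult H b)"
    proof (rule tensor_eqI[OF vs_H Lin[OF mab]])
      note t1 = tprod_in[OF vs_H vs_H vs_H vs_M vs_H mult_bilin la Lin[OF m] C, of a]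
      show "tprod H M H H H M (*) (ract M) (tprod H H H M H M (*) (lact M) (comult H a) (lcoact M m)) (comult H b) \<in> carr (H \<otimes>\<^sub>v M)"
        by (rule tprod_in[OF vs_H vs_M vs_H vs_H vs_H mult_bilin ra C t1])
      fix f assume f: "bf H M f"
      note [simp] = bfD[OF f]
      have G: "bf H M (\<lambda>d x. SS H H (rep H H (comult H b)) (\<lambda>b1 b2. f (d * b1) (ract M x b2)))"
        by (simp add: lin)
      show "lcoact M (ract M (lact M a m) b) f = tprod H M H H H M (*) (ract M)
          (tprod H H H M H M (*) (lact M) (comult H a) (lcoact M m)) (comult H b) f"
        using tprod_ev[OF vs_H vs_M vs_H vs_H vs_H mult_bilin ra C t1 f, of b]
          rep_ev[OF vs_H t1 G] tprod_ev[OF vs_H vs_H vs_H vs_M vs_H mult_bilin la Lin[OF m] C G, of a]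
        by (simp add: lev f flip mab L.rr_ra L.rr_la m lin cS) (simp add: llM_def SS_flip dlH_def)
    qed
  qed (simp_all add: R.la_one R.la_mult R.ra_one R.ra_mult R.la_ra)
qed

text \<open>\<open>HOM\<close> and \<open>HOM_space\<close>, and likewise
  \<open>bitensor H M N\<close> and \<open>M \<otimes>\<^sub>v N\<close>, are different records over
  the same space. These congruences pass between them, since tensor products see only carrier and
  scalar multiplication.\<close>

lemma bilin_cong: "carr A = carr A' \<Longrightarrow> scl A = scl A' \<Longrightarrow> carr B = carr B' \<Longrightarrow> scl B = scl B' \<Longrightarrow>
    bilin A B W f = bilin A' B' W f"
  by (simp add: bilin_def lin_def)

lemma ptens_vs_cong: "carr A = carr A' \<Longrightarrow> scl A = scl A' \<Longrightarrow> carr B = carr B' \<Longrightarrow> scl B = scl B' \<Longrightarrow>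
    a \<otimes>\<^bsub>A,B\<^esub> b = a \<otimes>\<^bsub>A',B'\<^esub> b"
  by (simp add: ptens_def bilin_cong[of A A' B B'])

lemma tensor_vs_cong: "carr A = carr A' \<Longrightarrow> scl A = scl A' \<Longrightarrow> carr B = carr B' \<Longrightarrow> scl B = scl B' \<Longrightarrow>
    A \<otimes>\<^sub>v B = A' \<otimes>\<^sub>v B'"
  by (simp add: tensor_def ptens_vs_cong[of A A' B B'])

lemma SS_vs_cong: "carr A = carr A' \<Longrightarrow> carr B = carr B' \<Longrightarrow> SS A B xs f = SS A' B' xs f"
  by (simp add: SS_def)

lemma rep_vs_cong: "carr A = carr A' \<Longrightarrow> scl A = scl A' \<Longrightarrow> carr B = carr B' \<Longrightarrow> scl B = scl B' \<Longrightarrow>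
    rep A B t = rep A' B' t"
  by (simp add: rep_def ptens_vs_cong[of A A' B B'] SS_vs_cong[of A A' B B'])

section \<open>The records \<open>HOM\<close> and \<open>bitensor\<close> as bicovariant
  bimodules\<close>

locale bimod_pair =
  fixes H :: "('k::field, 'h::ring_1) hopf" and M :: "('k, 'h, 'm::ab_group_add) bimod"
    and N :: "('k, 'h, 'n::ab_group_add) bimod"
  assumes hopf: "hopf_algebra H" and bijS: "bij (antipode H)"
    and bM: "bicovariant_bimodule H M" and bN: "bicovariant_bimodule H N"

sublocale bimod_pair \<subseteq> B: bipair H "dlH H" "dlcH H" "counit H" "antipode H" "antipode_inv H"
  M "lact M" "ract M" "rrM H M" "llM H M" N "lact N" "ract N" "rrM H N" "llM H N"
  by (rule bipair.intro[OF bicovH_D(1)[OF bijS bM] bicovH_D(1)[OF bijS bN]])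

context bimod_pair
begin

lemmas vsM = B.M.R.vsV and vsN = B.N.R.vsV and vsH = B.M.R.vsH and carrH = B.M.R.carrH
lemmas coact_in = bicovH_D(2)[OF bijS bM] bicovH_D(3)[OF bijS bM] bicovH_D(2)[OF bijS bN] bicovH_D(3)[OF bijS bN]
lemmas lin = B.R.lin B.L.lin

lemma bf_flip: "bf A B f \<Longrightarrow> bf B A (\<lambda>x y. f y x)"
  by (simp add: mf_defs)

lemma
  assumes \<phi>: "\<phi> \<in> carr (Hom M N)" and m: "m \<in> carr M"
  shows right_ad_in: "right_ad H M N \<phi> m \<in> carr (N \<otimes>\<^sub>v H)"
    and right_ad_ev: "bf N H f \<Longrightarrow> right_ad H M N \<phi> m f
      = SS M H (rrM H M m) (\<lambda>x a. SS N H (rrM H N (ev \<phi> x)) (\<lambda>y b. f y (b * antipode H a)))"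
    and left_ad_in: "left_ad H M N \<phi> m \<in> carr (H \<otimes>\<^sub>v N)"
    and left_ad_ev: "bf H N g \<Longrightarrow> left_ad H M N \<phi> m g
      = SS M H (llM H M m) (\<lambda>x a. SS N H (llM H N (ev \<phi> x)) (\<lambda>y b. g (b * antipode_inv H a) y))"
proof -
  note hH = homspD[OF B.R.homsp_Hom] \<phi>
  have \<phi>in: "\<phi> x \<in> carr N" if "x \<in> carr M" for x using hH(1)[OF \<phi> that] by (simp add: ev_def)
  have lr: "lin H H (\<lambda>b. b * antipode H a)" and ll: "lin H H (\<lambda>b. b * antipode_inv H a)" for a
    by (simp_all add: lin_def lin)
  let ?R = "\<lambda>x a. sw N H (N \<otimes>\<^sub>v H) (rcoact N (\<phi> x)) (\<lambda>y b. y \<otimes>\<^bsub>N,H\<^esub> (b * antipode H a))"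
  let ?L = "\<lambda>a x. sw H N (H \<otimes>\<^sub>v N) (lcoact N (\<phi> x)) (\<lambda>b y. (b * antipode_inv H a) \<otimes>\<^bsub>H,N\<^esub> y)"
  have Rev: "?R x a f = SS N H (rrM H N (ev \<phi> x)) (\<lambda>y b. f y (b * antipode H a))"
    if "x \<in> carr M" "bf N H f" for x a f
    using tmap_ev[OF vsN vsH vsN lin_id lr coact_in(3)[OF \<phi>in[OF that(1)]] that(2), of a]
    by (simp add: tmap_def rrM_def ev_def)
  have Lev: "?L a x f = SS N H (llM H N (ev \<phi> x)) (\<lambda>y b. f (b * antipode_inv H a) y)"
    if "x \<in> carr M" "bf H N f" for x a f
    using tmap_ev[OF vsH vsN vsH ll lin_id coact_in(4)[OF \<phi>in[OF that(1)]] that(2), of a]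
    by (simp add: tmap_def llM_def SS_flip ev_def)
  have R: "bilin M H (N \<otimes>\<^sub>v H) ?R"
  proof (rule bilinI_tensor[OF _ vsM vsH vsN])
    show "?R x a \<in> carr (N \<otimes>\<^sub>v H)" if "x \<in> carr M" for x a
      using tmap_in[OF vsN vsH vsN lin_id lr coact_in(3)[OF \<phi>in[OF that(1)]]] by (simp add: tmap_def)
    show "bf M H (\<lambda>x a. ?R x a f)" if f: "bf N H f" for f
      using bfD[OF f] by (simp add: Rev f lin hH)
  qed
  have L: "bilin H M (H \<otimes>\<^sub>v N) ?L"
  proof (rule bilinI_tensor[OF _ vsH vsM vsH])
    show "?L a x \<in> carr (H \<otimes>\<^sub>v N)" if "x \<in> carr M" for x a
      using tmap_in[OF vsH vsN vsH ll lin_id coact_in(4)[OF \<phi>in[OF that(1)]]] by (simp add: tmap_def)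
    show "bf H M (\<lambda>a x. ?L a x f)" if f: "bf H N f" for f
      using bfD[OF f] by (simp add: Lev f lin hH)
  qed
  show "right_ad H M N \<phi> m \<in> carr (N \<otimes>\<^sub>v H)"
    unfolding right_ad_def by (rule sw_closed[OF is_vs_tensor R coact_in(1)[OF m]])
  show "left_ad H M N \<phi> m \<in> carr (H \<otimes>\<^sub>v N)"
    unfolding left_ad_def by (rule sw_closed[OF is_vs_tensor L coact_in(2)[OF m]])
  show "right_ad H M N \<phi> m f
      = SS M H (rrM H M m) (\<lambda>x a. SS N H (rrM H N (ev \<phi> x)) (\<lambda>y b. f y (b * antipode H a)))" if "bf N H f"
    unfolding right_ad_def sw_eq_SS[OF vsM is_vs_tensor R coact_in(1)[OF m]]
    by (simp add: SS_apply Rev that) (simp add: rrM_def)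
  show "left_ad H M N \<phi> m g
      = SS M H (llM H M m) (\<lambda>x a. SS N H (llM H N (ev \<phi> x)) (\<lambda>y b. g (b * antipode_inv H a) y))" if "bf H N g"
    unfolding left_ad_def sw_eq_SS[OF vsH is_vs_tensor L coact_in(2)[OF m]]
    by (simp add: SS_apply Lev that) (simp add: llM_def SS_flip)
qed

lemma
  assumes X: "homsp M N X" and m: "m \<in> carr M"
  shows right_emb_in: "t \<in> carr (X \<otimes>\<^sub>v H) \<Longrightarrow> right_emb H N X t m \<in> carr (N \<otimes>\<^sub>v H)"
    and right_emb_ev: "t \<in> carr (X \<otimes>\<^sub>v H) \<Longrightarrow> bf N H f \<Longrightarrow>
      right_emb H N X t m f = SS X H (rep X H t) (\<lambda>p h. f (ev p m) h)"
    and left_emb_in: "u \<in> carr (H \<otimes>\<^sub>v X) \<Longrightarrow> left_emb H N X u m \<in> carr (H \<otimes>\<^sub>v N)"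
    and left_emb_ev: "u \<in> carr (H \<otimes>\<^sub>v X) \<Longrightarrow> bf H N g \<Longrightarrow>
      left_emb H N X u m g = SS H X (rep H X u) (\<lambda>h p. g h (ev p m))"
proof -
  have l: "lin X N (\<lambda>p. p m)"
    using homspD[OF X] m by (auto simp: lin_def ev_def)
  have vsX: "is_vs X" by (rule homspD[OF X])
  show "right_emb H N X t m \<in> carr (N \<otimes>\<^sub>v H)" if "t \<in> carr (X \<otimes>\<^sub>v H)"
    using tmap_in[OF vsX vsH vsN l lin_id that] by (simp add: right_emb_def tmap_def)
  show "left_emb H N X u m \<in> carr (H \<otimes>\<^sub>v N)" if "u \<in> carr (H \<otimes>\<^sub>v X)"
    using tmap_in[OF vsH vsX vsH lin_id l that] by (simp add: left_emb_def tmap_def)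
  show "right_emb H N X t m f = SS X H (rep X H t) (\<lambda>p h. f (ev p m) h)" if "t \<in> carr (X \<otimes>\<^sub>v H)" "bf N H f"
    using tmap_ev[OF vsX vsH vsN l lin_id that] by (simp add: right_emb_def tmap_def ev_def)
  show "left_emb H N X u m g = SS H X (rep H X u) (\<lambda>h p. g h (ev p m))" if "u \<in> carr (H \<otimes>\<^sub>v X)" "bf H N g"
    using tmap_ev[OF vsH vsX vsH lin_id l that] by (simp add: left_emb_def tmap_def ev_def)
qed

text \<open>Here the tensor formulation of rationality meets the list condition \<open>adr\<close>:
  both compare values at bilinear forms, point by point.\<close>

lemma right_emb_iff:
  assumes X: "homsp M N X" and \<phi>: "\<phi> \<in> carr (Hom M N)" and t: "t \<in> carr (X \<otimes>\<^sub>v H)"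
  shows "(\<forall>m\<in>carr M. right_emb H N X t m = right_ad H M N \<phi> m) \<longleftrightarrow> B.R.adr X \<phi> (rep X H t)"
proof
  assume eq: "\<forall>m\<in>carr M. right_emb H N X t m = right_ad H M N \<phi> m"
  show "B.R.adr X \<phi> (rep X H t)" unfolding B.R.adr_def
  proof (intro ballI allI impI)
    fix m f assume m: "m \<in> carr M" and f: "bf N H f"
    show "SS X H (rep X H t) (\<lambda>p h. f (ev p m) h)
      = SS M H (rrM H M m) (\<lambda>x a. SS N H (rrM H N (ev \<phi> x)) (\<lambda>y b. f y (b * antipode H a)))"
      using right_emb_ev[OF X m t f] right_ad_ev[OF \<phi> m f] eq m by simp
  qed
next
  assume a: "B.R.adr X \<phi> (rep X H t)"
  show "\<forall>m\<in>carr M. right_emb H N X t m = right_ad H M N \<phi> m"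
  proof
    fix m assume m: "m \<in> carr M"
    show "right_emb H N X t m = right_ad H M N \<phi> m"
    proof (rule tensor_eqI[OF vsN right_emb_in[OF X m t] right_ad_in[OF \<phi> m]])
      fix f assume f: "bf N H f"
      show "right_emb H N X t m f = right_ad H M N \<phi> m f"
        using right_emb_ev[OF X m t f] right_ad_ev[OF \<phi> m f] B.R.adrD[OF a m f] by simp
    qed
  qed
qed

lemma left_emb_iff:
  assumes X: "homsp M N X" and \<phi>: "\<phi> \<in> carr (Hom M N)" and t: "t \<in> carr (H \<otimes>\<^sub>v X)"
  shows "(\<forall>m\<in>carr M. left_emb H N X t m = left_ad H M N \<phi> m) \<longleftrightarrow> B.L.adr X \<phi> (map prod.swap (rep H X t))"
proof
  assume eq: "\<forall>m\<in>carr M. left_emb H N X t m = left_ad H M N \<phi> m"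
  show "B.L.adr X \<phi> (map prod.swap (rep H X t))" unfolding B.L.adr_def
  proof (intro ballI allI impI)
    fix m f assume m: "m \<in> carr M" and f: "bf N H f"
    show "SS X H (map prod.swap (rep H X t)) (\<lambda>p h. f (ev p m) h)
      = SS M H (llM H M m) (\<lambda>x a. SS N H (llM H N (ev \<phi> x)) (\<lambda>y b. f y (b * antipode_inv H a)))"
      using left_emb_ev[OF X m t bf_flip[OF f]] left_ad_ev[OF \<phi> m bf_flip[OF f]] eq m by (simp add: SS_flip)
  qed
next
  assume a: "B.L.adr X \<phi> (map prod.swap (rep H X t))"
  show "\<forall>m\<in>carr M. left_emb H N X t m = left_ad H M N \<phi> m"
  proof
    fix m assume m: "m \<in> carr M"
    show "left_emb H N X t m = left_ad H M N \<phi> m"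
    proof (rule tensor_eqI[OF vsH left_emb_in[OF X m t] left_ad_in[OF \<phi> m]])
      fix f assume f: "bf H N f"
      show "left_emb H N X t m f = left_ad H M N \<phi> m f"
        using left_emb_ev[OF X m t f] left_ad_ev[OF \<phi> m f] B.L.adrD[OF a m bf_flip[OF f]] by (simp add: SS_flip)
    qed
  qed
qed

lemma tensor_of_list:
  assumes "is_vs A"
  shows "SS A B xs (\<lambda>a b. a \<otimes>\<^bsub>A,B\<^esub> b) \<in> carr (A \<otimes>\<^sub>v B)"
    and "bf A B F \<Longrightarrow> SS A B (rep A B (SS A B xs (\<lambda>a b. a \<otimes>\<^bsub>A,B\<^esub> b))) F = SS A B xs F"
  by (simp_all add: rep_ev assms SS_ptens_ev)

text \<open>\<open>adr\<close> sees a list only through sums of bilinear forms, so it passes from a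
  given list to the one that \<open>rep\<close> picks for the same tensor.\<close>

lemma adr_list_cong:
  assumes X: "homsp M N X" and e: "\<And>F. bf X H F \<Longrightarrow> SS X H xs F = SS X H ys F"
  shows "B.R.adr X \<phi> xs \<Longrightarrow> B.R.adr X \<phi> ys" "B.L.adr X \<phi> xs \<Longrightarrow> B.L.adr X \<phi> ys"
proof -
  have *: "SS X H xs (\<lambda>p. f (ev p m)) = SS X H ys (\<lambda>p. f (ev p m))" if "m \<in> carr M" "bf N H f" for m f
    using that(1) bfD[OF that(2)] by (intro e) (simp add: lin homspD[OF X])
  show "B.R.adr X \<phi> xs \<Longrightarrow> B.R.adr X \<phi> ys" "B.L.adr X \<phi> xs \<Longrightarrow> B.L.adr X \<phi> ys"
    using * by (simp_all add: B.R.adr_def B.L.adr_def)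
qed

lemma right_ex_iff:
  assumes X: "homsp M N X" and \<phi>: "\<phi> \<in> carr (Hom M N)"
  shows "(\<exists>t\<in>carr (X \<otimes>\<^sub>v H). \<forall>m\<in>carr M. right_emb H N X t m = right_ad H M N \<phi> m) \<longleftrightarrow> (\<exists>xs. B.R.adr X \<phi> xs)"
proof -
  note tl = tensor_of_list[OF homspD(5)[OF X], of H]
  have "B.R.adr X \<phi> xs \<Longrightarrow> B.R.adr X \<phi> (rep X H (SS X H xs (\<lambda>a b. a \<otimes>\<^bsub>X,H\<^esub> b)))" for xs
    by (erule adr_list_cong(1)[OF X, rotated]) (simp add: tl)
  then show ?thesis using right_emb_iff[OF X \<phi>] tl(1) by blast
qed

lemma left_ex_iff:
  assumes X: "homsp M N X" and \<phi>: "\<phi> \<in> carr (Hom M N)"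
  shows "(\<exists>t\<in>carr (H \<otimes>\<^sub>v X). \<forall>m\<in>carr M. left_emb H N X t m = left_ad H M N \<phi> m) \<longleftrightarrow> (\<exists>xs. B.L.adr X \<phi> xs)"
proof -
  note tl = tensor_of_list[OF vsH, of X]
  have "B.L.adr X \<phi> xs \<Longrightarrow> B.L.adr X \<phi> (map prod.swap (rep H X (SS H X (map prod.swap xs) (\<lambda>a b. a \<otimes>\<^bsub>H,X\<^esub> b))))" for xs
  proof (erule adr_list_cong(2)[OF X, rotated])
    fix F :: "('m \<Rightarrow> 'n) \<Rightarrow> 'h \<Rightarrow> 'k" assume F: "bf X H F"
    have "SS X H xs F = SS H X (map prod.swap xs) (\<lambda>a b. F b a)" by (simp add: SS_flip)
    also have "\<dots> = SS H X (rep H X (SS H X (map prod.swap xs) (\<lambda>a b. a \<otimes>\<^bsub>H,X\<^esub> b))) (\<lambda>a b. F b a)"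
      by (rule tl(2)[OF bf_flip[OF F], symmetric])
    also have "\<dots> = SS X H (map prod.swap (rep H X (SS H X (map prod.swap xs) (\<lambda>a b. a \<otimes>\<^bsub>H,X\<^esub> b)))) F" (is "_ = ?r")
      by (rule SS_flip[symmetric])
    finally show "SS X H xs F = ?r" .
  qed
  then show ?thesis using left_emb_iff[OF X \<phi>] tl(1) by blast
qed

lemma carr_HOM: "carr (HOM H M N) = B.rat" "carr (HOM_space H M N) = B.rat"
  using right_ex_iff[OF B.R.homsp_Hom] left_ex_iff[OF B.R.homsp_Hom]
  by (simp_all add: HOM_def HOM_space_def B.rat_def cong: conj_cong)

lemma scl_HOM: "scl (HOM H M N) = scl (Hom M N)" "scl (HOM_space H M N) = scl (Hom M N)"
  by (simp_all add: HOM_def HOM_space_def)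

lemma HOM_sub: "\<phi> \<in> B.rat \<Longrightarrow> \<phi> \<in> carr (Hom M N)"
  by (simp add: B.rat_def)

lemma homsp_HOM: "homsp M N (HOM_space H M N)"
proof -
  \<comment> \<open>Arbitrary coaction lists suffice: the interpretation serves to import the fact
    that the rational maps form a subspace. The actual coactions of \<open>HOM\<close> become
    available only afterwards.\<close>
  obtain hr hl where "\<And>\<phi>. \<phi> \<in> B.rat \<Longrightarrow> B.R.adr (HOM_space H M N) \<phi> (hr \<phi>)"
    "\<And>\<phi>. \<phi> \<in> B.rat \<Longrightarrow> B.L.adr (HOM_space H M N) \<phi> (hl \<phi>)"
    using B.rat_adr[OF _ carr_HOM(2)] B.rat_adl[OF _ carr_HOM(2)] by metis
  then interpret bihom H "dlH H" "dlcH H" "counit H" "antipode H" "antipode_inv H"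
    M "lact M" "ract M" "rrM H M" "llM H M" N "lact N" "ract N" "rrM H N" "llM H N" "HOM_space H M N" hr hl
    by unfold_locales (simp_all add: carr_HOM scl_HOM)
  show ?thesis by (rule homspX)
qed

text \<open>The definite description asks for a tensor in \<open>HOM_space \<otimes> H\<close>, not
  merely in \<open>Hom \<otimes> H\<close>; \<open>rat_adr\<close> provides one through slices, and
  \<open>adr_unique\<close> shows that there is no other.\<close>

lemma HOM_rcoact:
  assumes \<phi>: "\<phi> \<in> B.rat"
  shows "rcoact (HOM H M N) \<phi> \<in> carr (HOM H M N \<otimes>\<^sub>v H)" "B.R.adr (HOM H M N) \<phi> (rrM H (HOM H M N) \<phi>)"
proof -
  let ?X = "HOM_space H M N" and ?Y = "HOM H M N"
  let ?P = "\<lambda>t. t \<in> carr (?X \<otimes>\<^sub>v H) \<and> (\<forall>m\<in>carr M. right_emb H N ?X t m = right_ad H M N \<phi> m)"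
  note X = homsp_HOM and \<phi>H = HOM_sub[OF \<phi>]
  have "\<exists>!t. ?P t"
  proof (rule ex_ex1I)
    show "\<exists>t. ?P t" using right_ex_iff[OF X \<phi>H] B.rat_adr[OF \<phi> carr_HOM(2)] by blast
    fix t u assume t: "?P t" and u: "?P u"
    show "t = u"
    proof (rule tensor_eqI[OF homspD(5)[OF X]])
      fix F assume F: "bf ?X H F"
      have "SS ?X H (rep ?X H t) F = SS ?X H (rep ?X H u) F"
        using t u right_emb_iff[OF X \<phi>H] by (intro B.R.adr_unique[OF X _ _ F]) auto
      then show "t F = u F" using t u F by (simp add: rep_ev homspD(5)[OF X])
    qed (use t u in auto)
  qed
  from theI'[OF this] have P: "?P (rcoact ?Y \<phi>)" by (simp add: HOM_def)
  have t: "?Y \<otimes>\<^sub>v H = ?X \<otimes>\<^sub>v H" and r: "rep ?Y H = rep ?X H"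
    using carr_HOM scl_HOM by (auto intro!: tensor_vs_cong rep_vs_cong)
  have SS: "SS ?Y H = (SS ?X H :: _ \<Rightarrow> _ \<Rightarrow> 'k)"
    using carr_HOM by (auto simp: fun_eq_iff intro!: SS_vs_cong)
  show "rcoact ?Y \<phi> \<in> carr (?Y \<otimes>\<^sub>v H)" using P by (simp add: t)
  show "B.R.adr ?Y \<phi> (rrM H ?Y \<phi>)"
    using P right_emb_iff[OF X \<phi>H] by (auto simp: rrM_def r B.R.adr_def SS)
qed

lemma HOM_lcoact:
  assumes \<phi>: "\<phi> \<in> B.rat"
  shows "lcoact (HOM H M N) \<phi> \<in> carr (H \<otimes>\<^sub>v HOM H M N)" "B.L.adr (HOM H M N) \<phi> (llM H (HOM H M N) \<phi>)"
proof -
  let ?X = "HOM_space H M N" and ?Y = "HOM H M N"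
  let ?P = "\<lambda>t. t \<in> carr (H \<otimes>\<^sub>v ?X) \<and> (\<forall>m\<in>carr M. left_emb H N ?X t m = left_ad H M N \<phi> m)"
  note X = homsp_HOM and \<phi>H = HOM_sub[OF \<phi>]
  have "\<exists>!t. ?P t"
  proof (rule ex_ex1I)
    show "\<exists>t. ?P t" using left_ex_iff[OF X \<phi>H] B.rat_adl[OF \<phi> carr_HOM(2)] by blast
    fix t u assume t: "?P t" and u: "?P u"
    show "t = u"
    proof (rule tensor_eqI[OF vsH])
      fix F assume F: "bf H ?X F"
      have "SS ?X H (map prod.swap (rep H ?X t)) (\<lambda>x y. F y x) = SS ?X H (map prod.swap (rep H ?X u)) (\<lambda>x y. F y x)"
        using t u left_emb_iff[OF X \<phi>H] by (intro B.L.adr_unique[OF X _ _ bf_flip[OF F]]) auto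
      then show "t F = u F" using t u F by (simp add: rep_ev vsH SS_flip)
    qed (use t u in auto)
  qed
  from theI'[OF this] have P: "?P (lcoact ?Y \<phi>)" by (simp add: HOM_def)
  have t: "H \<otimes>\<^sub>v ?Y = H \<otimes>\<^sub>v ?X" and r: "rep H ?Y = rep H ?X"
    using carr_HOM scl_HOM by (auto intro!: tensor_vs_cong rep_vs_cong)
  have SS: "SS ?Y H = (SS ?X H :: _ \<Rightarrow> _ \<Rightarrow> 'k)"
    using carr_HOM by (auto simp: fun_eq_iff intro!: SS_vs_cong)
  show "lcoact ?Y \<phi> \<in> carr (H \<otimes>\<^sub>v ?Y)" using P by (simp add: t)
  show "B.L.adr ?Y \<phi> (llM H ?Y \<phi>)"
    using P left_emb_iff[OF X \<phi>H] by (auto simp: llM_def r B.L.adr_def SS)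
qed

end

sublocale bimod_pair \<subseteq> X: bihom H "dlH H" "dlcH H" "counit H" "antipode H" "antipode_inv H"
  M "lact M" "ract M" "rrM H M" "llM H M" N "lact N" "ract N" "rrM H N" "llM H N"
  "HOM H M N" "rrM H (HOM H M N)" "llM H (HOM H M N)"
  by unfold_locales (simp_all add: carr_HOM scl_HOM HOM_rcoact HOM_lcoact)

context bimod_pair
begin

lemma HOM_acts: "lact (HOM H M N) = B.R.laX" "ract (HOM H M N) = B.R.raX"
  by (simp_all add: fun_eq_iff HOM_def B.R.laX_def B.R.raX_def)

lemma ev_lact_HOM: "m \<in> carr M \<Longrightarrow> ev (lact (HOM H M N) a \<phi>) m = lact N a (ev \<phi> m)"
  and ev_ract_HOM: "m \<in> carr M \<Longrightarrow> ev (ract (HOM H M N) \<phi> a) m = ev \<phi> (lact M a m)"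
  by (simp_all add: HOM_acts B.R.ev_laX B.R.ev_raX)

lemma bicov_HOM: "bicovariant_bimodule H (HOM H M N)"
proof (rule bicovH_I[OF hopf])
  show "bicovH H (HOM H M N)" using X.bicov_hom by (simp add: HOM_acts)
qed (simp_all add: carr_HOM HOM_rcoact HOM_lcoact)

abbreviation "T \<equiv> bitensor H M N"

lemma T_simps: "carr T = carr (M \<otimes>\<^sub>v N)" "scl T = scl (M \<otimes>\<^sub>v N)"
  "lact T a = tmap M N M N (lact M a) id" "ract T t b = tmap M N M N id (\<lambda>n. ract N n b) t"
  by (simp_all add: bitensor_def)

lemma lin_acts: "lin M M (lact M a)" "lin N N (\<lambda>n. ract N n a)"
  by (simp_all add: lin_def lin)

lemma T_coact:
  assumes t: "t \<in> carr T"
  shows "rcoact T t \<in> carr (T \<otimes>\<^sub>v H)" "lcoact T t \<in> carr (H \<otimes>\<^sub>v T)"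
    "bf T H f \<Longrightarrow> SS T H (rrM H T t) f =
      SS M N (rep M N t) (\<lambda>m n. SS M H (rrM H M m) (\<lambda>x a. SS N H (rrM H N n) (\<lambda>y b. f (x \<otimes>\<^bsub>M,N\<^esub> y) (a * b))))"
    "bf T H f \<Longrightarrow> SS T H (llM H T t) f =
      SS M N (rep M N t) (\<lambda>m n. SS M H (llM H M m) (\<lambda>x a. SS N H (llM H N n) (\<lambda>y b. f (x \<otimes>\<^bsub>M,N\<^esub> y) (a * b))))"
proof -
  have TH: "T \<otimes>\<^sub>v H = (M \<otimes>\<^sub>v N) \<otimes>\<^sub>v H" "H \<otimes>\<^sub>v T = H \<otimes>\<^sub>v (M \<otimes>\<^sub>v N)"
    by (rule tensor_vs_cong; simp add: T_simps)+
  have vT: "is_vs T" using is_vs_tensor[of M N] by (simp add: is_vs_def T_simps)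
  have TB: "bf T H f = bf (M \<otimes>\<^sub>v N) H f" "bf H T g = bf H (M \<otimes>\<^sub>v N) g" for f g
    by (simp_all add: bf_def lf_def T_simps)
  have t': "t \<in> carr (M \<otimes>\<^sub>v N)" using t by (simp add: T_simps)
  have pt: "bilin M N (M \<otimes>\<^sub>v N) (\<lambda>m n. m \<otimes>\<^bsub>M,N\<^esub> n)" and mu: "bilin H H H (*)"
    by (simp_all add: bilin_def lin_def ptensD lin)
  let ?R = "\<lambda>m n. tprod M H N H (M \<otimes>\<^sub>v N) H (\<lambda>m n. m \<otimes>\<^bsub>M,N\<^esub> n) (*) (rcoact M m) (rcoact N n)"
  let ?L = "\<lambda>m n. tprod H M H N H (M \<otimes>\<^sub>v N) (*) (\<lambda>m n. m \<otimes>\<^bsub>M,N\<^esub> n) (lcoact M m) (lcoact N n)"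
  have Rev: "?R m n f = SS M H (rrM H M m) (\<lambda>x a. SS N H (rrM H N n) (\<lambda>y b. f (x \<otimes>\<^bsub>M,N\<^esub> y) (a * b)))"
    if "m \<in> carr M" "n \<in> carr N" "bf (M \<otimes>\<^sub>v N) H f" for m n f
    using tprod_ev[OF vsM vsH vsN vsH is_vs_tensor pt mu coact_in(3)[OF that(2)] coact_in(1)[OF that(1)] that(3)]
    by (simp add: rrM_def)
  have Lev: "?L m n f = SS M H (llM H M m) (\<lambda>x a. SS N H (llM H N n) (\<lambda>y b. f (a * b) (x \<otimes>\<^bsub>M,N\<^esub> y)))"
    if "m \<in> carr M" "n \<in> carr N" "bf H (M \<otimes>\<^sub>v N) f" for m n f
    using tprod_ev[OF vsH vsM vsH vsN vsH mu pt coact_in(4)[OF that(2)] coact_in(2)[OF that(1)] that(3)]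
    by (simp add: llM_def SS_flip)
  have R: "bilin M N ((M \<otimes>\<^sub>v N) \<otimes>\<^sub>v H) ?R"
  proof (rule bilinI_tensor[OF _ vsM vsN is_vs_tensor])
    show "?R m n \<in> carr ((M \<otimes>\<^sub>v N) \<otimes>\<^sub>v H)" if "m \<in> carr M" "n \<in> carr N" for m n
      by (rule tprod_in[OF vsM vsH vsN vsH is_vs_tensor pt mu coact_in(3)[OF that(2)] coact_in(1)[OF that(1)]])
    show "bf M N (\<lambda>m n. ?R m n f)" if f: "bf (M \<otimes>\<^sub>v N) H f" for f
      using bfD[OF f] by (simp add: Rev f lin ptensD)
  qed
  have L: "bilin M N (H \<otimes>\<^sub>v (M \<otimes>\<^sub>v N)) ?L"
  proof (rule bilinI_tensor[OF _ vsM vsN vsH])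
    show "?L m n \<in> carr (H \<otimes>\<^sub>v (M \<otimes>\<^sub>v N))" if "m \<in> carr M" "n \<in> carr N" for m n
      by (rule tprod_in[OF vsH vsM vsH vsN vsH mu pt coact_in(4)[OF that(2)] coact_in(2)[OF that(1)]])
    show "bf M N (\<lambda>m n. ?L m n f)" if f: "bf H (M \<otimes>\<^sub>v N) f" for f
      using bfD[OF f] by (simp add: Lev f lin ptensD)
  qed
  have rT: "rcoact T t = sw M N ((M \<otimes>\<^sub>v N) \<otimes>\<^sub>v H) t ?R" and lT: "lcoact T t = sw M N (H \<otimes>\<^sub>v (M \<otimes>\<^sub>v N)) t ?L"
    by (simp_all add: bitensor_def)
  show 1: "rcoact T t \<in> carr (T \<otimes>\<^sub>v H)" unfolding TH rT by (rule sw_closed[OF is_vs_tensor R t'])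
  show 2: "lcoact T t \<in> carr (H \<otimes>\<^sub>v T)" unfolding TH lT by (rule sw_closed[OF is_vs_tensor L t'])
  show "SS T H (rrM H T t) f =
      SS M N (rep M N t) (\<lambda>m n. SS M H (rrM H M m) (\<lambda>x a. SS N H (rrM H N n) (\<lambda>y b. f (x \<otimes>\<^bsub>M,N\<^esub> y) (a * b))))"
    if f: "bf T H f"
  proof -
    have "SS T H (rrM H T t) f = rcoact T t f" using 1 f by (simp add: rrM_def rep_ev vT)
    also have "\<dots> = SS M N (rep M N t) (\<lambda>m n. SS M H (rrM H M m) (\<lambda>x a. SS N H (rrM H N n) (\<lambda>y b. f (x \<otimes>\<^bsub>M,N\<^esub> y) (a * b))))"
      using f by (simp add: rT sw_eq_SS[OF vsM is_vs_tensor R t'] SS_apply Rev TB)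
    finally show ?thesis .
  qed
  show "SS T H (llM H T t) f =
      SS M N (rep M N t) (\<lambda>m n. SS M H (llM H M m) (\<lambda>x a. SS N H (llM H N n) (\<lambda>y b. f (x \<otimes>\<^bsub>M,N\<^esub> y) (a * b))))"
    if f: "bf T H f"
  proof -
    have "SS T H (llM H T t) f = lcoact T t (\<lambda>a x. f x a)"
      using 2 bf_flip[OF f] by (simp add: llM_def SS_flip rep_ev vsH)
    also have "\<dots> = SS M N (rep M N t) (\<lambda>m n. SS M H (llM H M m) (\<lambda>x a. SS N H (llM H N n) (\<lambda>y b. f (x \<otimes>\<^bsub>M,N\<^esub> y) (a * b))))"
      using bf_flip[OF f] by (simp add: lT sw_eq_SS[OF vsM is_vs_tensor L t'] SS_apply Lev TB)
    finally show ?thesis .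
  qed
qed

end

sublocale bimod_pair \<subseteq> T: biten H "dlH H" "dlcH H" "counit H" "antipode H" "antipode_inv H"
  M "lact M" "ract M" "rrM H M" "llM H M" N "lact N" "ract N" "rrM H N" "llM H N"
  "bitensor H M N" "lact (bitensor H M N)" "ract (bitensor H M N)" "rrM H (bitensor H M N)" "llM H (bitensor H M N)"
proof -
  note tm = tmap_ev[OF vsM vsN vsM lin_acts(1) lin_id] tmap_ev[OF vsM vsN vsM lin_id lin_acts(2)]
    tmap_in[OF vsM vsN vsM lin_acts(1) lin_id] tmap_in[OF vsM vsN vsM lin_id lin_acts(2)]
  show "biten H (dlH H) (dlcH H) (counit H) (antipode H) (antipode_inv H) M (lact M) (ract M) (rrM H M) (llM H M)
     N (lact N) (ract N) (rrM H N) (llM H N) T (lact T) (ract T) (rrM H T) (llM H T)"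
    by unfold_locales (simp_all add: T_coact, simp_all add: T_simps tm)
qed

lemma (in bimod_pair) bicov_T: "bicovariant_bimodule H T"
  by (rule bicovH_I[OF hopf T.bicov_tensor]) (rule T_coact, assumption)+

section \<open>The tensor product of rational morphisms\<close>

lemma sw_tensor:
  assumes "is_vs A" "is_vs B" "is_vs C" and t: "t \<in> carr (A \<otimes>\<^sub>v B)"
    and "\<And>a b. a \<in> carr A \<Longrightarrow> b \<in> carr B \<Longrightarrow> F a b \<in> carr (C \<otimes>\<^sub>v D)"
    and "\<And>\<beta>. bf C D \<beta> \<Longrightarrow> bf A B (\<lambda>a b. F a b \<beta>)"
  shows "sw A B (C \<otimes>\<^sub>v D) t F \<in> carr (C \<otimes>\<^sub>v D)" "sw A B (C \<otimes>\<^sub>v D) t F \<beta> = SS A B (rep A B t) (\<lambda>a b. F a b \<beta>)"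
proof -
  have b: "bilin A B (C \<otimes>\<^sub>v D) F" by (rule bilinI_tensor[OF assms(5,1-3,6)])
  show "sw A B (C \<otimes>\<^sub>v D) t F \<in> carr (C \<otimes>\<^sub>v D)" by (rule sw_closed[OF is_vs_tensor b t])
  show "sw A B (C \<otimes>\<^sub>v D) t F \<beta> = SS A B (rep A B t) (\<lambda>a b. F a b \<beta>)"
    by (simp add: sw_eq_SS[OF assms(1) is_vs_tensor b t] SS_apply)
qed

lemma lf_tensor_eqI:
  assumes "is_vs A" "lf (A \<otimes>\<^sub>v B) v" "lf (A \<otimes>\<^sub>v B) w" "t \<in> carr (A \<otimes>\<^sub>v B)"
    and "\<And>a b. a \<in> carr A \<Longrightarrow> b \<in> carr B \<Longrightarrow> v (a \<otimes>\<^bsub>A,B\<^esub> b) = w (a \<otimes>\<^bsub>A,B\<^esub> b)"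
  shows "v t = w t"
  using rep_lf[OF assms(1,4,2)] rep_lf[OF assms(1,4,3)] assms(5) by simp

sublocale bimod_pair \<subseteq> XB: bicov H "dlH H" "dlcH H" "counit H" "antipode H" "antipode_inv H"
  "HOM H M N" "lact (HOM H M N)" "ract (HOM H M N)" "rrM H (HOM H M N)" "llM H (HOM H M N)"
  using X.bicov_hom by (simp add: HOM_acts)

sublocale bimod_pair \<subseteq> TB: bicov H "dlH H" "dlcH H" "counit H" "antipode H" "antipode_inv H"
  "bitensor H M N" "lact (bitensor H M N)" "ract (bitensor H M N)" "rrM H (bitensor H M N)" "llM H (bitensor H M N)"
  by (rule T.bicov_tensor)

locale sigma_ctx =
  fixes H :: "('k::field, 'h::ring_1) hopf"
    and M :: "('k, 'h, 'm::ab_group_add) bimod" and M' :: "('k, 'h, 'm'::ab_group_add) bimod"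
    and N :: "('k, 'h, 'n::ab_group_add) bimod" and N' :: "('k, 'h, 'n'::ab_group_add) bimod"
  assumes hopf: "hopf_algebra H" and bijS: "bij (antipode H)"
    and bM: "bicovariant_bimodule H M" and bM': "bicovariant_bimodule H M'"
    and bN: "bicovariant_bimodule H N" and bN': "bicovariant_bimodule H N'"

text \<open>The prefixes: \<open>A\<close> and \<open>C\<close> carry the two spaces of morphisms,
  \<open>D\<close> and \<open>E\<close> the tensor products of the sources and of the targets, and
  \<open>G\<close> the morphisms between these tensor products.\<close>

sublocale sigma_ctx \<subseteq> A: bimod_pair H M M' by (rule bimod_pair.intro[OF hopf bijS bM bM'])
sublocale sigma_ctx \<subseteq> C: bimod_pair H N N' by (rule bimod_pair.intro[OF hopf bijS bN bN'])
sublocale sigma_ctx \<subseteq> D: bimod_pair H M N by (rule bimod_pair.intro[OF hopf bijS bM bN])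
sublocale sigma_ctx \<subseteq> E: bimod_pair H M' N' by (rule bimod_pair.intro[OF hopf bijS bM' bN'])
sublocale sigma_ctx \<subseteq> G: bimod_pair H "bitensor H M N" "bitensor H M' N'"
  by (rule bimod_pair.intro[OF hopf bijS D.bicov_T E.bicov_T])

context sigma_ctx
begin

abbreviation "X \<equiv> HOM H M M'"
abbreviation "Y \<equiv> HOM H N N'"
abbreviation "T \<equiv> bitensor H M N"
abbreviation "T' \<equiv> bitensor H M' N'"
abbreviation "Z \<equiv> HOM H T T'"
abbreviation "\<sigma> \<equiv> sigma_tensor H M M' N N'"
abbreviation "rM \<equiv> rrM H M"
abbreviation "rN \<equiv> rrM H N"
abbreviation "lM \<equiv> llM H M"
abbreviation "lN \<equiv> llM H N"
abbreviation "lY \<equiv> llM H Y"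
abbreviation "PM \<equiv> A.B.M.R.P"
abbreviation "PN \<equiv> C.B.M.R.P"
abbreviation "Sa \<equiv> antipode H"

abbreviation pure :: "'m \<Rightarrow> 'n \<Rightarrow> ('k, 'm, 'n) tens" (infixl "\<otimes>\<^sub>1" 70) where
  "m \<otimes>\<^sub>1 n \<equiv> m \<otimes>\<^bsub>M,N\<^esub> n"
abbreviation pure' :: "'m' \<Rightarrow> 'n' \<Rightarrow> ('k, 'm', 'n') tens" (infixl "\<otimes>\<^sub>2" 70) where
  "m \<otimes>\<^sub>2 n \<equiv> m \<otimes>\<^bsub>M',N'\<^esub> n"
abbreviation "RM t \<equiv> SS M H (rM t)"
abbreviation "LM t \<equiv> SS M H (lM t)"
abbreviation "RN t \<equiv> SS N H (rN t)"
abbreviation "LN t \<equiv> SS N H (lN t)"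
abbreviation "LY t \<equiv> SS Y H (lY t)"
abbreviation "SD t \<equiv> SS H H (dlH H t)"

lemmas slin = A.lin C.lin A.X.R.hX C.X.R.hX A.XB.R.linV A.XB.L.linV C.XB.R.linV C.XB.L.linV

lemma dlcS: "SS H H (dlcH H a) f = SD a (\<lambda>x y. f y x)"
  by (simp add: dlcH_def SS_flip)

lemma T_eqs: "carr T = carr (M \<otimes>\<^sub>v N)" "scl T = scl (M \<otimes>\<^sub>v N)" "carr T' = carr (M' \<otimes>\<^sub>v N')" "scl T' = scl (M' \<otimes>\<^sub>v N')"
  by (simp_all add: D.T_simps E.T_simps)

text \<open>
  By coassociativity the argument \<open>\<psi>\<^sub>-\<^sub>2 m\<^sub>0 S(\<psi>\<^sub>-\<^sub>1 m\<^sub>1)\<close> of \<open>\<phi>\<close> is \<open>P(\<psi>\<^sub>-\<^sub>1 m\<^sub>0)\<close>.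
\<close>

lemma sigma_formula_ev:
  assumes \<phi>: "\<phi> \<in> carr X" and \<psi>: "\<psi> \<in> carr Y" and m: "m \<in> carr M" and n: "n \<in> carr N"
  shows "sigma_formula H M M' N N' \<phi> \<psi> m n \<in> carr (M' \<otimes>\<^sub>v N')"
    and "bf M' N' \<beta> \<Longrightarrow> sigma_formula H M M' N N' \<phi> \<psi> m n \<beta> = LY \<psi> (\<lambda>\<psi>0 h. RM m (\<lambda>x a.
      \<beta> (ev \<phi> (PM (lact M h x))) (ev \<psi>0 (lact N a n))))"
proof -
  let ?W = "M' \<otimes>\<^sub>v N'"
  \<comment> \<open>The four nested \<open>sw\<close> are treated from the inside out, since each
    can be evaluated only after its integrand is known to be bilinear.\<close>
  define F1 where "F1 = (\<lambda>p q \<psi>0 m2 m0 m1. ev \<phi> (ract M (lact M p m0) (antipode H (q * m1))) \<otimes>\<^sub>2 ev \<psi>0 (lact N m2 n))"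
  define F2 where "F2 = (\<lambda>p q \<psi>0 m' m2. sw M H ?W (rcoact M m') (F1 p q \<psi>0 m2))"
  define F3 where "F3 = (\<lambda>p q \<psi>0. sw M H ?W (rcoact M m) (F2 p q \<psi>0))"
  define F4 where "F4 = (\<lambda>p \<psi>'. sw H Y ?W (lcoact Y \<psi>') (F3 p))"
  note vs = A.vsM A.vsN C.vsN A.vsH C.X.R.hX(5)
  have lc: "lcoact Y y \<in> carr (H \<otimes>\<^sub>v Y)" if "y \<in> carr Y" for y
    using that by (intro C.HOM_lcoact) (simp add: C.carr_HOM)
  have 1: "F1 p q y m2 m0 m1 \<in> carr ?W" "bf M' N' \<beta> \<Longrightarrow> F1 p q y m2 m0 m1 \<beta>
      = \<beta> (ev \<phi> (ract M (lact M p m0) (antipode H (q * m1)))) (ev y (lact N m2 n))"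
    if "y \<in> carr Y" "m0 \<in> carr M" for p q y m2 m0 m1 \<beta>
    using that \<phi> n by (simp_all add: F1_def ptens_ev slin)
  have 2: "F2 p q y m' m2 \<in> carr ?W" "bf M' N' \<beta> \<Longrightarrow> F2 p q y m' m2 \<beta> = RM m' (\<lambda>m0 m1.
      \<beta> (ev \<phi> (ract M (lact M p m0) (antipode H (q * m1)))) (ev y (lact N m2 n)))"
    if y: "y \<in> carr Y" and m': "m' \<in> carr M" for p q y m' m2 \<beta>
  proof -
    have b: "bf M H (\<lambda>m0 m1. F1 p q y m2 m0 m1 \<beta>)" if \<beta>: "bf M' N' \<beta>" for \<beta>
      using bfD[OF \<beta>] y \<phi> n by (simp add: 1 \<beta> slin)
    note s = sw_tensor[where F = "F1 p q y m2", OF vs(1,4,2) A.coact_in(1)[OF m'] 1(1)[OF y] b]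
    show "F2 p q y m' m2 \<in> carr ?W" unfolding F2_def by (rule s(1))
    show "F2 p q y m' m2 \<beta> = RM m' (\<lambda>m0 m1.
      \<beta> (ev \<phi> (ract M (lact M p m0) (antipode H (q * m1)))) (ev y (lact N m2 n)))" if \<beta>: "bf M' N' \<beta>"
    proof -
      have "F2 p q y m' m2 \<beta> = RM m' (\<lambda>m0 m1. F1 p q y m2 m0 m1 \<beta>)"
        unfolding F2_def rrM_def by (rule s(2))
      then show ?thesis using 1(2)[OF y _ \<beta>] by simp
    qed
  qed
  have 3: "F3 p q y \<in> carr ?W" "bf M' N' \<beta> \<Longrightarrow> F3 p q y \<beta> = RM m (\<lambda>m' m2. RM m' (\<lambda>m0 m1.
      \<beta> (ev \<phi> (ract M (lact M p m0) (antipode H (q * m1)))) (ev y (lact N m2 n))))"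
    if y: "y \<in> carr Y" for p q y \<beta>
  proof -
    have b: "bf M H (\<lambda>m' m2. F2 p q y m' m2 \<beta>)" if \<beta>: "bf M' N' \<beta>" for \<beta>
      using bfD[OF \<beta>] y \<phi> n by (simp add: 2 \<beta> slin)
    note s = sw_tensor[where F = "F2 p q y", OF vs(1,4,2) A.coact_in(1)[OF m] 2(1)[OF y] b]
    show "F3 p q y \<in> carr ?W" unfolding F3_def by (rule s(1))
    show "F3 p q y \<beta> = RM m (\<lambda>m' m2. RM m' (\<lambda>m0 m1.
      \<beta> (ev \<phi> (ract M (lact M p m0) (antipode H (q * m1)))) (ev y (lact N m2 n))))" if \<beta>: "bf M' N' \<beta>"
    proof -
      have "F3 p q y \<beta> = RM m (\<lambda>m' m2. F2 p q y m' m2 \<beta>)"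
        unfolding F3_def rrM_def by (rule s(2))
      then show ?thesis using 2(2)[OF y _ \<beta>] by simp
    qed
  qed
  have 4: "F4 p z \<in> carr ?W" "bf M' N' \<beta> \<Longrightarrow> F4 p z \<beta> = LY z (\<lambda>y q. RM m (\<lambda>m' m2. RM m' (\<lambda>m0 m1.
      \<beta> (ev \<phi> (ract M (lact M p m0) (antipode H (q * m1)))) (ev y (lact N m2 n)))))"
    if z: "z \<in> carr Y" for p z \<beta>
  proof -
    have b: "bf H Y (\<lambda>q y. F3 p q y \<beta>)" if \<beta>: "bf M' N' \<beta>" for \<beta>
      using bfD[OF \<beta>] \<phi> n m by (simp add: 3 \<beta> slin)
    note s = sw_tensor[where F = "F3 p", OF vs(4,5,2) lc[OF z] 3(1) b]
    show "F4 p z \<in> carr ?W" unfolding F4_def by (rule s(1))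
    show "F4 p z \<beta> = LY z (\<lambda>y q. RM m (\<lambda>m' m2. RM m' (\<lambda>m0 m1.
      \<beta> (ev \<phi> (ract M (lact M p m0) (antipode H (q * m1)))) (ev y (lact N m2 n)))))" if \<beta>: "bf M' N' \<beta>"
    proof -
      have "F4 p z \<beta> = SS H Y (rep H Y (lcoact Y z)) (\<lambda>q y. F3 p q y \<beta>)"
        unfolding F4_def by (rule s(2))
      also have "\<dots> = LY z (\<lambda>y q. F3 p q y \<beta>)" by (simp add: llM_def SS_flip)
      finally show ?thesis using 3(2)[OF _ \<beta>] by simp
    qed
  qed
  have b: "bf H Y (\<lambda>p z. F4 p z \<beta>)" if \<beta>: "bf M' N' \<beta>" for \<beta>
    using bfD[OF \<beta>] \<phi> n m by (simp add: 4 \<beta> slin)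
  note s = sw_tensor[where F = F4, OF vs(4,5,2) lc[OF \<psi>] 4(1) b]
  have eq: "sigma_formula H M M' N N' \<phi> \<psi> m n = sw H Y ?W (lcoact Y \<psi>) F4"
    by (simp add: sigma_formula_def F4_def F3_def F2_def F1_def ev_def)
  show "sigma_formula H M M' N N' \<phi> \<psi> m n \<in> carr (M' \<otimes>\<^sub>v N')" unfolding eq by (rule s(1))
  assume \<beta>: "bf M' N' \<beta>"
  note [simp] = bfD[OF \<beta>] and l = slin \<phi> \<psi> m n
  have "sigma_formula H M M' N N' \<phi> \<psi> m n \<beta> = LY \<psi> (\<lambda>z p. LY z (\<lambda>y q. RM m (\<lambda>m' m2. RM m' (\<lambda>m0 m1.
      \<beta> (ev \<phi> (ract M (lact M p m0) (antipode H (q * m1)))) (ev y (lact N m2 n))))))" (is "?l = _")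
  proof -
    have "sigma_formula H M M' N N' \<phi> \<psi> m n \<beta> = SS H Y (rep H Y (lcoact Y \<psi>)) (\<lambda>p z. F4 p z \<beta>)"
      unfolding eq by (rule s(2))
    also have "\<dots> = LY \<psi> (\<lambda>z p. F4 p z \<beta>)" by (simp add: llM_def SS_flip)
    finally show ?thesis using 4(2)[OF _ \<beta>] by simp
  qed
  also have "\<dots> = LY \<psi> (\<lambda>y h. SD h (\<lambda>p q. RM m (\<lambda>m' m2. RM m' (\<lambda>m0 m1.
      \<beta> (ev \<phi> (ract M (lact M p m0) (antipode H (q * m1)))) (ev y (lact N m2 n))))))"
    by (subst C.XB.L.rr_coassoc[OF \<psi>]) (simp_all add: l dlcS)
  also have "\<dots> = LY \<psi> (\<lambda>y h. RM m (\<lambda>m' m2. SD h (\<lambda>p q. RM m' (\<lambda>m0 m1.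
      \<beta> (ev \<phi> (ract M (lact M p m0) (antipode H (q * m1)))) (ev y (lact N m2 n))))))"
    by (rule SS_cong[OF refl]) (rule SS_swap)
  also have "\<dots> = LY \<psi> (\<lambda>\<psi>0 h. RM m (\<lambda>x a. \<beta> (ev \<phi> (PM (lact M h x))) (ev \<psi>0 (lact N a n))))" (is "_ = ?r")
    using A.B.M.R.P_la[of _ "\<lambda>x. \<beta> (ev \<phi> x) (ev y (lact N a n))" for y a] by (simp add: l)
  finally show "?l = ?r" .
qed

lemma sigma_formula_bilin:
  assumes \<phi>: "\<phi> \<in> carr X" and \<psi>: "\<psi> \<in> carr Y"
  shows "bilin M N (M' \<otimes>\<^sub>v N') (sigma_formula H M M' N N' \<phi> \<psi>)"
proof (rule bilinI_tensor[OF _ A.vsM C.vsM A.vsN])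
  show "bf M N (\<lambda>a b. sigma_formula H M M' N N' \<phi> \<psi> a b \<beta>)" if \<beta>: "bf M' N' \<beta>" for \<beta>
    using bfD[OF \<beta>] by (simp add: sigma_formula_ev \<phi> \<psi> \<beta> slin)
qed (rule sigma_formula_ev[OF \<phi> \<psi>])

lemma sigma_Hom:
  assumes \<phi>: "\<phi> \<in> carr X" and \<psi>: "\<psi> \<in> carr Y"
  shows "\<sigma> \<phi> \<psi> \<in> carr (Hom T T')"
proof -
  have "(\<lambda>t. \<sigma> \<phi> \<psi> t) \<in> carr (Hom (M \<otimes>\<^sub>v N) (M' \<otimes>\<^sub>v N'))"
    unfolding sigma_tensor_def by (rule sw_props(1)[OF is_vs_tensor sigma_formula_bilin[OF assms]])
  then show ?thesis by (simp add: Hom_def lin_def T_eqs)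
qed

lemma sigma_pure:
  assumes "\<phi> \<in> carr X" "\<psi> \<in> carr Y" "m \<in> carr M" "n \<in> carr N"
  shows "\<sigma> \<phi> \<psi> (m \<otimes>\<^sub>1 n) = sigma_formula H M M' N N' \<phi> \<psi> m n"
  unfolding sigma_tensor_def by (rule sw_props(2)[OF is_vs_tensor sigma_formula_bilin[OF assms(1,2)] assms(3,4)])

text \<open>The working form of the definition. An arbitrary functional \<open>v\<close> is allowed
  so that a coaction, an action or a further map can be applied to the result.\<close>

lemma sigma_lf:
  assumes \<phi>: "\<phi> \<in> carr X" and \<psi>: "\<psi> \<in> carr Y" and m: "m \<in> carr M" and n: "n \<in> carr N" and v: "lf T' v"
  shows "v (ev (\<sigma> \<phi> \<psi>) (m \<otimes>\<^sub>1 n)) = LY \<psi> (\<lambda>y h. RM m (\<lambda>x a.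
      v (ev \<phi> (PM (lact M h x)) \<otimes>\<^sub>2 ev y (lact N a n))))"
proof -
  have v': "lf (M' \<otimes>\<^sub>v N') v" using v by (simp add: lf_def T_eqs)
  let ?u = "LY \<psi> (\<lambda>y h. RM m (\<lambda>x a. ev \<phi> (PM (lact M h x)) \<otimes>\<^sub>2 ev y (lact N a n)))"
  have cl: "RM m (\<lambda>x a. ev \<phi> (PM (lact M h x)) \<otimes>\<^sub>2 ev y (lact N a n)) \<in> carr (M' \<otimes>\<^sub>v N')"
    if "y \<in> carr Y" for y h
    by (rule SS_closed[OF is_vs_tensor]) (simp add: that slin \<phi> n)
  have "sigma_formula H M M' N N' \<phi> \<psi> m n = ?u"
    by (rule tensor_eqI[OF A.vsN sigma_formula_ev(1)[OF \<phi> \<psi> m n] SS_closed[OF is_vs_tensor cl]])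
      (simp_all add: sigma_formula_ev(2)[OF \<phi> \<psi> m n] SS_apply ptens_ev)
  then have "v (ev (\<sigma> \<phi> \<psi>) (m \<otimes>\<^sub>1 n)) = v ?u"
    by (simp add: ev_def[of "\<sigma> \<phi> \<psi>"] sigma_pure \<phi> \<psi> m n)
  also have "\<dots> = LY \<psi> (\<lambda>y h. v (RM m (\<lambda>x a. ev \<phi> (PM (lact M h x)) \<otimes>\<^sub>2 ev y (lact N a n))))"
    by (rule SS_lf[OF is_vs_tensor v' cl])
  also have "\<dots> = LY \<psi> (\<lambda>y h. RM m (\<lambda>x a. v (ev \<phi> (PM (lact M h x)) \<otimes>\<^sub>2 ev y (lact N a n))))"
    by (intro SS_cong refl SS_lf[OF is_vs_tensor v']) (simp add: slin \<phi> n)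
  finally show ?thesis .
qed

lemma pure_eq:
  assumes v: "lf T v" "lf T w" and t: "t \<in> carr T"
    and e: "\<And>m n. m \<in> carr M \<Longrightarrow> n \<in> carr N \<Longrightarrow> v (m \<otimes>\<^sub>1 n) = w (m \<otimes>\<^sub>1 n)"
  shows "v t = w t"
proof (rule lf_tensor_eqI[OF A.vsM, where v = v and w = w])
  show "lf (M \<otimes>\<^sub>v N) v" "lf (M \<otimes>\<^sub>v N) w" using v by (simp_all add: lf_def T_eqs)
  show "t \<in> carr (M \<otimes>\<^sub>v N)" using t by (simp add: T_eqs)
qed (rule e)

lemmas glin = G.lin slin homspD[OF G.B.R.homsp_Hom] D.T.R.linT D.T.L.linT E.T.R.linT E.T.L.linT

lemma Hom_pure_eqI:
  assumes f: "f \<in> carr (Hom T T')" and g: "g \<in> carr (Hom T T')"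
    and e: "\<And>v m n. lf T' v \<Longrightarrow> m \<in> carr M \<Longrightarrow> n \<in> carr N \<Longrightarrow> v (ev f (m \<otimes>\<^sub>1 n)) = v (ev g (m \<otimes>\<^sub>1 n))"
  shows "f = g"
proof (rule hom_eqI[OF G.B.R.homsp_Hom f g])
  note hH = homspD[OF G.B.R.homsp_Hom]
  fix t assume t: "t \<in> carr T"
  show "ev f t = ev g t"
  proof (rule lf_sep[OF G.vsN])
    fix v assume v: "lf T' v"
    show "v (ev f t) = v (ev g t)"
      by (rule pure_eq[where v = "\<lambda>t. v (ev f t)" and w = "\<lambda>t. v (ev g t)"])
        (simp_all add: lf_def hH f g lfD[OF v] t e[OF v])
  qed
qed

lemma sigma_add1: "\<phi> \<in> carr X \<Longrightarrow> \<phi>' \<in> carr X \<Longrightarrow> \<psi> \<in> carr Y \<Longrightarrow> \<sigma> (\<phi> + \<phi>') \<psi> = \<sigma> \<phi> \<psi> + \<sigma> \<phi>' \<psi>"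
  and sigma_scl1: "\<phi> \<in> carr X \<Longrightarrow> \<psi> \<in> carr Y \<Longrightarrow> \<sigma> (scl X c \<phi>) \<psi> = scl (Hom T T') c (\<sigma> \<phi> \<psi>)"
  and sigma_add2: "\<phi> \<in> carr X \<Longrightarrow> \<psi>' \<in> carr Y \<Longrightarrow> \<psi> \<in> carr Y \<Longrightarrow> \<sigma> \<phi> (\<psi> + \<psi>') = \<sigma> \<phi> \<psi> + \<sigma> \<phi> \<psi>'"
  and sigma_scl2: "\<phi> \<in> carr X \<Longrightarrow> \<psi> \<in> carr Y \<Longrightarrow> \<sigma> \<phi> (scl Y c \<psi>) = scl (Hom T T') c (\<sigma> \<phi> \<psi>)"
proof -
  note hH = homspD[OF G.B.R.homsp_Hom] and * = Hom_pure_eqI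
  show "\<sigma> (\<phi> + \<phi>') \<psi> = \<sigma> \<phi> \<psi> + \<sigma> \<phi>' \<psi>" if "\<phi> \<in> carr X" "\<phi>' \<in> carr X" "\<psi> \<in> carr Y"
    by (rule *) (use that in \<open>simp_all add: sigma_Hom slin hH sigma_lf D.T.R.linT0 E.T.R.linT0 lf_def\<close>)
  show "\<sigma> (scl X c \<phi>) \<psi> = scl (Hom T T') c (\<sigma> \<phi> \<psi>)" if "\<phi> \<in> carr X" "\<psi> \<in> carr Y"
    by (rule *) (use that in \<open>simp_all add: sigma_Hom slin hH sigma_lf D.T.R.linT0 E.T.R.linT0 lf_def\<close>)
  show "\<sigma> \<phi> (\<psi> + \<psi>') = \<sigma> \<phi> \<psi> + \<sigma> \<phi> \<psi>'" if "\<phi> \<in> carr X" "\<psi>' \<in> carr Y" "\<psi> \<in> carr Y"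
    by (rule *) (use that in \<open>simp_all add: sigma_Hom slin hH sigma_lf D.T.R.linT0 E.T.R.linT0 lf_def\<close>)
  show "\<sigma> \<phi> (scl Y c \<psi>) = scl (Hom T T') c (\<sigma> \<phi> \<psi>)" if "\<phi> \<in> carr X" "\<psi> \<in> carr Y"
    by (rule *) (use that in \<open>simp_all add: sigma_Hom slin hH sigma_lf D.T.R.linT0 E.T.R.linT0 lf_def\<close>)
qed

end

lemma lin_tensor_eqI:
  assumes A: "is_vs A" and W: "is_vs W" and f: "lin (A \<otimes>\<^sub>v B) W f" and g: "lin (A \<otimes>\<^sub>v B) W g"
    and t: "t \<in> carr (A \<otimes>\<^sub>v B)"
    and e: "\<And>a b. a \<in> carr A \<Longrightarrow> b \<in> carr B \<Longrightarrow> f (a \<otimes>\<^bsub>A,B\<^esub> b) = g (a \<otimes>\<^bsub>A,B\<^esub> b)"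
  shows "f t = g t"
proof (rule lf_sep[OF W])
  fix v assume v: "lf W v"
  show "v (f t) = v (g t)"
  proof (rule lf_tensor_eqI[OF A _ _ t, where v = "\<lambda>t. v (f t)" and w = "\<lambda>t. v (g t)"])
    show "lf (A \<otimes>\<^sub>v B) (\<lambda>t. v (f t))" "lf (A \<otimes>\<^sub>v B) (\<lambda>t. v (g t))"
      using linD[OF f] linD[OF g] by (simp_all add: lf_def[of "A \<otimes>\<^sub>v B"] lfD[OF v])
  qed (simp only: e)
qed

sublocale sigma_ctx \<subseteq> HP: bimod_pair H "HOM H M M'" "HOM H N N'"
  by (rule bimod_pair.intro[OF hopf bijS A.bicov_HOM C.bicov_HOM])

section \<open>Rationality and colinearity of the tensor product of morphisms\<close>

context sigma_ctx
begin

abbreviation "rX \<equiv> rrM H X"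
abbreviation "rY \<equiv> rrM H Y"
abbreviation "lX \<equiv> llM H X"
abbreviation "dl \<equiv> dlH H"

text \<open>The candidate coactions
  \<open>\<sigma> \<phi>_0 \<psi>_0 \<otimes> \<phi>_1 \<psi>_1\<close> and its left analogue. They
  are forced by the goal that the map be colinear for the diagonal coactions.\<close>

abbreviation "coR \<phi> \<psi> \<equiv> sbind X H (rX \<phi>) (\<lambda>p k. sbind Y H (rY \<psi>) (\<lambda>q k'. [(\<sigma> p q, k * k')]))"
abbreviation "coL \<phi> \<psi> \<equiv> sbind X H (lX \<phi>) (\<lambda>p k. sbind Y H (lY \<psi>) (\<lambda>q k'. [(\<sigma> p q, k * k')]))"
abbreviation "RX t \<equiv> SS X H (rX t)"
abbreviation "LX t \<equiv> SS X H (lX t)"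
abbreviation "RY t \<equiv> SS Y H (rY t)"
abbreviation "RT t \<equiv> SS T H (rrM H T t)"
abbreviation "LT t \<equiv> SS T H (llM H T t)"
abbreviation "RT' t \<equiv> SS T' H (rrM H T' t)"
abbreviation "LT' t \<equiv> SS T' H (llM H T' t)"

lemmas expand = D.T.R.rrT_pure D.T.L.rrT_pure E.T.R.rrT_pure E.T.L.rrT_pure A.X.R.hr_mes A.X.L.hr_mes C.X.R.hr_mes C.X.L.hr_mes
  A.B.M.R.rr_P C.B.M.R.rr_P A.B.M.R.rr_la A.B.M.L.rr_la C.B.M.R.rr_la C.B.M.L.rr_la dlcS

text \<open>
  In the rearrangements below each rewriting step moves one sum inwards as far as the dependencies
  between the bound variables allow; this brings both sides into the same order.
\<close>

lemma sigma_mesR: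
  assumes W: "homsp T T' W" "\<And>p q. p \<in> carr X \<Longrightarrow> q \<in> carr Y \<Longrightarrow> \<sigma> p q \<in> carr W"
    and \<phi>: "\<phi> \<in> carr X" and \<psi>: "\<psi> \<in> carr Y"
  shows "G.B.R.mes W (\<sigma> \<phi> \<psi>) (coR \<phi> \<psi>)"
  unfolding G.B.R.mes_def
proof (intro ballI allI impI)
  fix t f assume t: "t \<in> carr T" and f: "bf T' H f"
  note [simp] = bfD[OF f] and l = glin \<phi> \<psi> homspD[OF W(1)] W(2)
  let ?v = "\<lambda>t. RT' (ev (\<sigma> \<phi> \<psi>) t) f"
    and ?w = "\<lambda>t. RT t (\<lambda>x a. SS W H (coR \<phi> \<psi>) (\<lambda>p h. f (ev p x) (h * a)))"
  show "?v t = ?w t"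
  proof (rule pure_eq[OF _ _ t, where v = ?v and w = ?w])
    show "lf T ?v" by (simp add: l f)
    show "lf T ?w" by (simp add: l f)
    fix m n assume m: "m \<in> carr M" and n: "n \<in> carr N"
    have "?v (m \<otimes>\<^sub>1 n) = LY \<psi> (\<lambda>y h. RM m (\<lambda>x a.
      RT' (ev \<phi> (PM (lact M h x)) \<otimes>\<^sub>2 ev y (lact N a n)) f))"
      by (rule sigma_lf[OF \<phi> \<psi> m n]) (simp add: l f)
    \<comment> \<open>The argument of \<open>\<phi>\<close> is right coinvariant by
      \<open>rr_P\<close>, so the coaction of its image contributes just the coaction of
      \<open>\<phi>\<close> itself.\<close>
    also have "\<dots> = LY \<psi> (\<lambda>y h. RM m (\<lambda>x a. RX \<phi> (\<lambda>p k. SD a (\<lambda>b c. RN n (\<lambda>z d.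
      RY y (\<lambda>q k'. f (ev p (PM (lact M h x)) \<otimes>\<^sub>2 ev q (lact N b z)) (k * (k' * (c * d)))))))))"
      by (simp add: expand l m n f)
    finally have L: "?v (m \<otimes>\<^sub>1 n) = \<dots>" .
    \<comment> \<open>The formula takes the left coaction of the components of the right coaction of
      \<open>\<psi>\<close>; the commutation law for the two coactions of \<open>HOM\<close>
      exchanges their order.\<close>
    have "?w (m \<otimes>\<^sub>1 n)
      = RM m (\<lambda>x a. RN n (\<lambda>z d. RX \<phi> (\<lambda>p k. LY \<psi> (\<lambda>q h.
        RY q (\<lambda>y k'. RM x (\<lambda>x' b. f (ev p (PM (lact M h x')) \<otimes>\<^sub>2 ev y (lact N b z)) (k * (k' * (a * d)))))))))"
      using sigma_lf[of _ _ _ _ "\<lambda>u. f u (k * (k' * (a * d)))" for k k' a d]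
      by (simp add: D.T.R.rrT_pure l m n C.XB.comm)
    also have "\<dots> = RN n (\<lambda>z d. RX \<phi> (\<lambda>p k. LY \<psi> (\<lambda>q h. RY q (\<lambda>y k'.
        RM m (\<lambda>x a. RM x (\<lambda>x' b. f (ev p (PM (lact M h x')) \<otimes>\<^sub>2 ev y (lact N b z)) (k * (k' * (a * d)))))))))"
      by (simp only: SS_swap[of M H "rM m"])
    also have "\<dots> = RN n (\<lambda>z d. RX \<phi> (\<lambda>p k. LY \<psi> (\<lambda>q h. RY q (\<lambda>y k'.
        RM m (\<lambda>x w. SD w (\<lambda>b a. f (ev p (PM (lact M h x)) \<otimes>\<^sub>2 ev y (lact N b z)) (k * (k' * (a * d)))))))))"
      by (simp add: A.B.M.R.rr_coassoc l m n)
    finally have R: "?w (m \<otimes>\<^sub>1 n) = \<dots>" .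
    show "?v (m \<otimes>\<^sub>1 n) = ?w (m \<otimes>\<^sub>1 n)"
      unfolding L R
      by ((simp only: SS_swap[of H H "dl w" for w])?, (simp only: SS_swap[of M H "rM m"])?,
        (simp only: SS_swap[of Y H "rY y" for y])?, (simp only: SS_swap[of Y H "lY \<psi>"])?,
        (simp only: SS_swap[of X H "rX \<phi>"])?, (simp only: SS_swap[of N H "rN n"])?)
  qed
qed

text \<open>The argument of \<open>\<phi>\<close> is not left coinvariant: its left coaction
  contains an antipode. This must be cancelled against the leg of \<open>m\<close> that acts on
  \<open>n\<close>, so coassociativity is first used to put that leg next to it, and then
  \<open>ll_P_rr\<close> applies.\<close>

lemma sigma_mesL:
  assumes W: "homsp T T' W" "\<And>p q. p \<in> carr X \<Longrightarrow> q \<in> carr Y \<Longrightarrow> \<sigma> p q \<in> carr W"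
    and \<phi>: "\<phi> \<in> carr X" and \<psi>: "\<psi> \<in> carr Y"
  shows "G.B.L.mes W (\<sigma> \<phi> \<psi>) (coL \<phi> \<psi>)"
  unfolding G.B.L.mes_def
proof (intro ballI allI impI)
  fix t f assume t: "t \<in> carr T" and f: "bf T' H f"
  note [simp] = bfD[OF f] and l = glin \<phi> \<psi> homspD[OF W(1)] W(2)
  let ?v = "\<lambda>t. LT' (ev (\<sigma> \<phi> \<psi>) t) f"
    and ?w = "\<lambda>t. LT t (\<lambda>x a. SS W H (coL \<phi> \<psi>) (\<lambda>p h. f (ev p x) (h * a)))"
  show "?v t = ?w t"
  proof (rule pure_eq[OF _ _ t, where v = ?v and w = ?w])
    show "lf T ?v" by (simp add: l f)
    show "lf T ?w" by (simp add: l f)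
    fix m n assume m: "m \<in> carr M" and n: "n \<in> carr N"
    have "?v (m \<otimes>\<^sub>1 n) = LY \<psi> (\<lambda>y h. RM m (\<lambda>x a.
      LT' (ev \<phi> (PM (lact M h x)) \<otimes>\<^sub>2 ev y (lact N a n)) f))"
      by (rule sigma_lf[OF \<phi> \<psi> m n]) (simp add: l f)
    also have "\<dots> = LY \<psi> (\<lambda>y h. RM m (\<lambda>x a. LM (PM (lact M h x)) (\<lambda>u b'. LX \<phi> (\<lambda>p k.
      SD a (\<lambda>c b. LN n (\<lambda>z d. LY y (\<lambda>q k'.
        f (ev p u \<otimes>\<^sub>2 ev q (lact N b z)) (k * (b' * (k' * (c * d))))))))))) "
      by (simp add: expand l m n f)
    also have "\<dots> = LX \<phi> (\<lambda>p k. LN n (\<lambda>z d. LY \<psi> (\<lambda>y h. LY y (\<lambda>q k'.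
      RM m (\<lambda>x a. SD a (\<lambda>c b. LM (PM (lact M h x)) (\<lambda>u b'.
        f (ev p u \<otimes>\<^sub>2 ev q (lact N b z)) (k * (b' * (k' * (c * d))))))))))) "
      by ((simp only: SS_swap[of M H "lM (PM z)" for z])?, (simp only: SS_swap[of H H "dl a" for a])?,
        (simp only: SS_swap[of M H "rM m"])?, (simp only: SS_swap[of Y H "lY y" for y])?,
        (simp only: SS_swap[of Y H "lY \<psi>"])?,
        (simp only: SS_swap[of X H "lX \<phi>"])?, (simp only: SS_swap[of N H "lN n"])?)
    also have "\<dots> = LX \<phi> (\<lambda>p k. LN n (\<lambda>z d. LY \<psi> (\<lambda>q e. SD e (\<lambda>h k'.
      RM m (\<lambda>x' b. RM x' (\<lambda>x c. LM (PM (lact M h x)) (\<lambda>u b'.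
        f (ev p u \<otimes>\<^sub>2 ev q (lact N b z)) (k * (b' * (k' * (c * d))))))))))) "
      by (simp add: C.XB.L.rr_coassoc[OF \<psi>] dlcS l n A.B.M.R.rr_coassoc[OF m] l n)
    also have "\<dots> = LX \<phi> (\<lambda>p k. LN n (\<lambda>z d. LY \<psi> (\<lambda>q e. RM m (\<lambda>x' b.
      SD e (\<lambda>h k'. RM x' (\<lambda>x c. LM (PM (lact M h x)) (\<lambda>u b'.
        f (ev p u \<otimes>\<^sub>2 ev q (lact N b z)) (k * (b' * (k' * (c * d))))))))))) "
      by (simp only: SS_swap[of H H "dl e" M H "rM m" for e])
    \<comment> \<open>The coproduct of \<open>e\<close> and the coaction of \<open>x'\<close>
      recombine into the coaction of \<open>lact M e x'\<close>, which is the shape required by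
      \<open>ll_P_rr\<close>.\<close>
    also have "\<dots> = LX \<phi> (\<lambda>p k. LN n (\<lambda>z d. LY \<psi> (\<lambda>q e. RM m (\<lambda>x' b.
      RM (lact M e x') (\<lambda>x c. LM (PM x) (\<lambda>u b'.
        f (ev p u \<otimes>\<^sub>2 ev q (lact N b z)) (k * (b' * (c * d)))))))))"
      by (simp add: A.B.M.R.rr_la l n)
    also have "\<dots> = LX \<phi> (\<lambda>p k. LN n (\<lambda>z d. LY \<psi> (\<lambda>q e. RM m (\<lambda>x' b.
      LM (lact M e x') (\<lambda>u w. f (ev p (PM u) \<otimes>\<^sub>2 ev q (lact N b z)) (k * (w * d)))))))"
      using A.B.M.ll_P_rr[of _ "\<lambda>u w. f (ev p u \<otimes>\<^sub>2 ev q (lact N b z)) (k * (w * d))" for p q b z k d]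
      by (simp add: l n del: A.B.M.R.rr_la)
    also have "\<dots> = LX \<phi> (\<lambda>p k. LN n (\<lambda>z d. LY \<psi> (\<lambda>q e. RM m (\<lambda>x' b.
      SD e (\<lambda>k' h. LM x' (\<lambda>u w. f (ev p (PM (lact M h u)) \<otimes>\<^sub>2 ev q (lact N b z)) (k * (k' * (w * d)))))))))"
      by (simp add: A.B.M.L.rr_la dlcS l n)
    finally have L: "?v (m \<otimes>\<^sub>1 n) = \<dots>" .
    have "?w (m \<otimes>\<^sub>1 n)
      = LM m (\<lambda>x a. LN n (\<lambda>z d. LX \<phi> (\<lambda>p k. LY \<psi> (\<lambda>y e.
        SD e (\<lambda>k' h. RM x (\<lambda>x' b. f (ev p (PM (lact M h x')) \<otimes>\<^sub>2 ev y (lact N b z)) (k * (k' * (a * d)))))))))"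
      using sigma_lf[of _ _ _ _ "\<lambda>u. f u (k * (k' * (a * d)))" for k k' a d]
      by (simp add: D.T.L.rrT_pure l m n C.XB.L.rr_coassoc[OF \<psi>] dlcS l)
    also have "\<dots> = LN n (\<lambda>z d. LX \<phi> (\<lambda>p k. LY \<psi> (\<lambda>y e. SD e (\<lambda>k' h.
        LM m (\<lambda>x a. RM x (\<lambda>x' b. f (ev p (PM (lact M h x')) \<otimes>\<^sub>2 ev y (lact N b z)) (k * (k' * (a * d)))))))))"
      by (simp only: SS_swap[of M H "lM m"])
    also have "\<dots> = LN n (\<lambda>z d. LX \<phi> (\<lambda>p k. LY \<psi> (\<lambda>y e. SD e (\<lambda>k' h.
        RM m (\<lambda>x b. LM x (\<lambda>x' a. f (ev p (PM (lact M h x')) \<otimes>\<^sub>2 ev y (lact N b z)) (k * (k' * (a * d)))))))))"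
      by (simp add: A.B.M.comm[OF m, symmetric] l)
    finally have R: "?w (m \<otimes>\<^sub>1 n) = \<dots>" .
    show "?v (m \<otimes>\<^sub>1 n) = ?w (m \<otimes>\<^sub>1 n)"
      unfolding L R
      by ((simp only: SS_swap[of M H "lM x" for x])?, (simp only: SS_swap[of M H "rM m"])?,
        (simp only: SS_swap[of H H "dl e" for e])?, (simp only: SS_swap[of Y H "lY \<psi>"])?,
        (simp only: SS_swap[of X H "lX \<phi>"])?, (simp only: SS_swap[of N H "lN n"])?)
  qed
qed

text \<open>The two preceding lemmas are used twice. Over \<open>Hom\<close> they show rationality;
  once it is known, the same lists are read over \<open>Z\<close> and give the coactions in
  \<open>sigma_rr\<close> and \<open>sigma_ll\<close>.\<close>

lemma sigma_in:
  assumes \<phi>: "\<phi> \<in> carr X" and \<psi>: "\<psi> \<in> carr Y"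
  shows "\<sigma> \<phi> \<psi> \<in> carr Z"
proof -
  note h = G.B.R.homsp_Hom
  from G.B.R.mes_imp_adr[OF h sigma_mesR[OF h sigma_Hom \<phi> \<psi>]] G.B.L.mes_imp_adr[OF h sigma_mesL[OF h sigma_Hom \<phi> \<psi>]]
    sigma_Hom[OF \<phi> \<psi>]
  show ?thesis unfolding G.carr_HOM G.B.rat_def by blast
qed

lemma sigma_rr:
  assumes \<phi>: "\<phi> \<in> carr X" and \<psi>: "\<psi> \<in> carr Y" and F: "bf Z H F"
  shows "SS Z H (rrM H Z (\<sigma> \<phi> \<psi>)) F = RX \<phi> (\<lambda>p k. RY \<psi> (\<lambda>q k'. F (\<sigma> p q) (k * k')))"
  using G.X.R.hr_eqI[OF sigma_in[OF \<phi> \<psi>] G.B.R.mes_imp_adr[OF G.X.homspX sigma_mesR[OF G.X.homspX sigma_in \<phi> \<psi>]] F]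
  by (simp add: sigma_in A.carrH)

lemma sigma_ll:
  assumes \<phi>: "\<phi> \<in> carr X" and \<psi>: "\<psi> \<in> carr Y" and F: "bf Z H F"
  shows "SS Z H (llM H Z (\<sigma> \<phi> \<psi>)) F = LX \<phi> (\<lambda>p k. LY \<psi> (\<lambda>q k'. F (\<sigma> p q) (k * k')))"
  using G.X.L.hr_eqI[OF sigma_in[OF \<phi> \<psi>] G.B.L.mes_imp_adr[OF G.X.homspX sigma_mesL[OF G.X.homspX sigma_in \<phi> \<psi>]] F]
  by (simp add: sigma_in A.carrH)

end

text \<open>The one-entry list with second factor 1 satisfies \<open>mes\<close> at sight on both
  sides, so the identity is rational and coinvariant. Its left coaction enters the outer factor of
  the decomposition.\<close>

lemma id_HOM:
  fixes H :: "('k::field, 'h::ring_1) hopf" and M :: "('k, 'h, 'm::ab_group_add) bimod"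
  assumes "hopf_algebra H" "bij (antipode H)" "bicovariant_bimodule H M"
  shows "ext0 M id \<in> carr (HOM H M M)"
    and "bf (HOM H M M) H F \<Longrightarrow> SS (HOM H M M) H (llM H (HOM H M M) (ext0 M id)) F = F (ext0 M id) 1"
proof -
  interpret I: bimod_pair H M M by (rule bimod_pair.intro[OF assms assms(3)])
  have e: "ev (ext0 M id) m = m" if "m \<in> carr M" for m using that by (simp add: ev_def ext0_def)
  have h: "ext0 M id \<in> carr (Hom M M)" by (auto simp: Hom_def lin_def ext0_def I.lin)
  have mes: "I.B.R.mes W (ext0 M id) [(ext0 M id, 1)]" "I.B.L.mes W (ext0 M id) [(ext0 M id, 1)]"
    if "ext0 M id \<in> carr W" for W :: "('k, 'm \<Rightarrow> 'm, 'w) vs_scheme"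
    using that by (simp_all add: I.B.R.mes_def I.B.L.mes_def e I.lin)
  note hs = I.B.R.homsp_Hom
  have "ext0 M id \<in> I.B.rat"
    unfolding I.B.rat_def using h I.B.R.mes_imp_adr[OF hs mes(1)[OF h]] I.B.L.mes_imp_adr[OF hs mes(2)[OF h]] by blast
  then show i: "ext0 M id \<in> carr (HOM H M M)" by (simp add: I.carr_HOM)
  show "SS (HOM H M M) H (llM H (HOM H M M) (ext0 M id)) F = F (ext0 M id) 1" if "bf (HOM H M M) H F"
    using I.X.L.hr_eqI[OF i I.B.L.mes_imp_adr[OF I.X.homspX mes(2)[OF i]] that] i by (simp add: I.carrH)
qed

lemma Hom_comp:
  assumes B: "is_vs B" and f: "f \<in> carr (Hom A B)" and g: "g \<in> carr (Hom B C)"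
  shows "g \<circ> f \<in> carr (Hom A C)"
proof -
  have "lin B C g" using g by (simp add: Hom_def)
  \<comment> \<open>Outside \<open>A\<close> the composite takes the value \<open>g 0\<close>, which
    has to vanish for the normalisation in \<open>Hom\<close>.\<close>
  from lin_add[OF this vs_0[OF B] vs_0[OF B]] have "g 0 = 0" by (rule add_hom_0)
  then show ?thesis using f g by (auto simp: Hom_def lin_def)
qed

lemma tassoc_pure:
  assumes v: "is_vs A" "is_vs B" "is_vs C" and "a \<in> carr A" "b \<in> carr B" "c \<in> carr C"
  shows "tassoc A B C ((a \<otimes>\<^bsub>A,B\<^esub> b) \<otimes>\<^bsub>A \<otimes>\<^sub>v B,C\<^esub> c) = a \<otimes>\<^bsub>A,B \<otimes>\<^sub>v C\<^esub> (b \<otimes>\<^bsub>B,C\<^esub> c)"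
proof -
  have "bilin A B (A \<otimes>\<^sub>v (B \<otimes>\<^sub>v C)) (\<lambda>a b. a \<otimes>\<^bsub>A,B \<otimes>\<^sub>v C\<^esub> (b \<otimes>\<^bsub>B,C\<^esub> c))"
    using assms(6) tmap_bilin[OF v(1,2,1) lin_id, of "B \<otimes>\<^sub>v C" "\<lambda>b. b \<otimes>\<^bsub>B,C\<^esub> c"]
    by (simp add: lin_def ptensD)
  from sw_props(2)[OF is_vs_tensor tassoc_bilin(1)[OF v]] sw_props(2)[OF is_vs_tensor this]
  show ?thesis unfolding tassoc_def using assms by simp
qed

lemma tassoc_lin:
  assumes v: "is_vs A" "is_vs B" "is_vs C"
  shows "lin ((A \<otimes>\<^sub>v B) \<otimes>\<^sub>v C) (A \<otimes>\<^sub>v (B \<otimes>\<^sub>v C)) (tassoc A B C)"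
  using sw_props(1)[OF is_vs_tensor tassoc_bilin(1)[OF v]] unfolding tassoc_def[abs_def] by (simp add: Hom_def)

section \<open>Bimodule linearity, the morphism property, decomposition and associativity\<close>

context sigma_ctx
begin

lemma sigma_lact: "\<phi> \<in> carr X \<Longrightarrow> \<psi> \<in> carr Y \<Longrightarrow> \<sigma> (lact X a \<phi>) \<psi> = lact Z a (\<sigma> \<phi> \<psi>)"
proof (rule Hom_pure_eqI)
  assume \<phi>: "\<phi> \<in> carr X" and \<psi>: "\<psi> \<in> carr Y"
  note Z = G.HOM_sub[folded G.carr_HOM(1)]
  show "\<sigma> (lact X a \<phi>) \<psi> \<in> carr (Hom T T')" "lact Z a (\<sigma> \<phi> \<psi>) \<in> carr (Hom T T')"
    by (rule sigma_Hom Z; simp add: slin G.XB.R.linV sigma_in \<phi> \<psi>)+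
  fix v m n assume v: "lf T' v" and m: "m \<in> carr M" and n: "n \<in> carr N"
  note l = glin \<phi> \<psi> m n lfD[OF v]
  have "v (ev (lact Z a (\<sigma> \<phi> \<psi>)) (m \<otimes>\<^sub>1 n)) = v (lact T' a (ev (\<sigma> \<phi> \<psi>) (m \<otimes>\<^sub>1 n)))" (is "?l = _")
    by (simp add: G.ev_lact_HOM l)
  also have "\<dots> = LY \<psi> (\<lambda>y h. RM m (\<lambda>x c.
      v (lact T' a (ev \<phi> (PM (lact M h x)) \<otimes>\<^sub>2 ev y (lact N c n)))))"
    by (rule sigma_lf[OF \<phi> \<psi> m n, where v = "\<lambda>u. v (lact T' a u)"]) (simp add: l)
  also have "\<dots> = v (ev (\<sigma> (lact X a \<phi>) \<psi>) (m \<otimes>\<^sub>1 n))" (is "_ = ?r")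
    using sigma_lf[OF _ \<psi> m n v, of "lact X a \<phi>"] by (simp add: l E.T.R.laT_pure A.ev_lact_HOM)
  finally show "?r = ?l" ..
qed

text \<open>The left coaction of \<open>\<psi> a\<close> is
  \<open>\<psi>_{-1} a_1 \<otimes> \<psi>_0 a_2\<close>. Its legs act on \<open>m_0\<close> inside
  \<open>P\<close> and on the argument of \<open>\<psi>_0\<close>, just as the two legs in the right
  coaction of \<open>a m\<close> do.\<close>

lemma sigma_ract: "\<phi> \<in> carr X \<Longrightarrow> \<psi> \<in> carr Y \<Longrightarrow> \<sigma> \<phi> (ract Y \<psi> a) = ract Z (\<sigma> \<phi> \<psi>) a"
proof (rule Hom_pure_eqI)
  assume \<phi>: "\<phi> \<in> carr X" and \<psi>: "\<psi> \<in> carr Y"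
  note Z = G.HOM_sub[folded G.carr_HOM(1)]
  show "\<sigma> \<phi> (ract Y \<psi> a) \<in> carr (Hom T T')" "ract Z (\<sigma> \<phi> \<psi>) a \<in> carr (Hom T T')"
    by (rule sigma_Hom Z; simp add: slin G.XB.R.linV sigma_in \<phi> \<psi>)+
  fix v m n assume v: "lf T' v" and m: "m \<in> carr M" and n: "n \<in> carr N"
  note l = glin \<phi> \<psi> m n lfD[OF v]
  have "v (ev (ract Z (\<sigma> \<phi> \<psi>) a) (m \<otimes>\<^sub>1 n)) = v (ev (\<sigma> \<phi> \<psi>) (lact M a m \<otimes>\<^sub>1 n))" (is "?l = _")
    by (simp add: G.ev_ract_HOM D.T.R.laT_pure l)
  also have "\<dots> = LY \<psi> (\<lambda>y h. RM (lact M a m) (\<lambda>x c.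
      v (ev \<phi> (PM (lact M h x)) \<otimes>\<^sub>2 ev y (lact N c n))))"
    by (rule sigma_lf[OF \<phi> \<psi> _ n v]) (simp add: l)
  also have "\<dots> = LY (ract Y \<psi> a) (\<lambda>y h. RM m (\<lambda>x c.
      v (ev \<phi> (PM (lact M h x)) \<otimes>\<^sub>2 ev y (lact N c n))))"
    by (simp add: A.B.M.R.rr_la A.B.M.R.la_mult l C.XB.L.rr_ra dlcS C.ev_ract_HOM C.B.M.R.la_mult)
  also have "\<dots> = v (ev (\<sigma> \<phi> (ract Y \<psi> a)) (m \<otimes>\<^sub>1 n))" (is "_ = ?r")
    by (rule sigma_lf[OF \<phi> _ m n v, symmetric]) (simp add: l)
  finally show "?r = ?l" ..
qed

abbreviation "XY \<equiv> bitensor H X Y"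
abbreviation "sm \<equiv> sigma_map H M M' N N'"

lemma XY_eqs: "carr XY = carr (X \<otimes>\<^sub>v Y)" "scl XY = scl (X \<otimes>\<^sub>v Y)"
  by (simp_all add: HP.T_simps)

lemma sigma_bilin: "bilin X Y Z \<sigma>"
  by (simp add: bilin_def lin_def sigma_in sigma_add1 sigma_add2 sigma_scl1 sigma_scl2 G.scl_HOM)

lemma sm_pure: "p \<in> carr X \<Longrightarrow> q \<in> carr Y \<Longrightarrow> sm (p \<otimes>\<^bsub>X,Y\<^esub> q) = \<sigma> p q"
  unfolding sigma_map_def by (rule sw_props(2)[OF G.XB.R.vsV sigma_bilin])

lemma sm_lin: "lin XY Z sm"
  using sw_props(1)[OF G.XB.R.vsV sigma_bilin] unfolding sigma_map_def[abs_def]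
  by (simp add: Hom_def lin_def XY_eqs)

lemma sm_eqI:
  assumes "is_vs W" "lin XY W f" "lin XY W g" "t \<in> carr XY"
    and "\<And>p q. p \<in> carr X \<Longrightarrow> q \<in> carr Y \<Longrightarrow> f (p \<otimes>\<^bsub>X,Y\<^esub> q) = g (p \<otimes>\<^bsub>X,Y\<^esub> q)"
  shows "f t = g t"
proof (rule lin_tensor_eqI[OF A.XB.R.vsV assms(1), where f = f and g = g])
  show "lin (X \<otimes>\<^sub>v Y) W f" "lin (X \<otimes>\<^sub>v Y) W g" "t \<in> carr (X \<otimes>\<^sub>v Y)"
    using assms(2-4) by (simp_all add: lin_def XY_eqs)
qed (rule assms(5))

text \<open>All conditions are linear in the element of the tensor product, so they are tested on
  pure tensors, where \<open>sigma_lact\<close>, \<open>sigma_ract\<close>, \<open>sigma_rr\<close>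
  and \<open>sigma_ll\<close> apply.\<close>

lemma sigma_morphism: "bicovariant_morphism H XY Z sm"
proof (intro bicovariant_morphism.intro HP.bicov_T G.bicov_HOM bicovariant_morphism_axioms.intro)
  note l = linD[OF sm_lin] HP.TB.R.linV HP.TB.L.linV G.XB.R.linV G.XB.L.linV A.XB.R.linV C.XB.R.linV slin
  show "lin XY Z sm" by (rule sm_lin)
  fix t assume t: "t \<in> carr XY"
  show "sm (lact XY a t) = lact Z a (sm t)" for a
    by (rule sm_eqI[OF G.XB.R.vsV _ _ t]) (simp_all add: lin_def l HP.T.R.laT_pure sm_pure sigma_lact)
  show "sm (ract XY t a) = ract Z (sm t) a" for a
    by (rule sm_eqI[OF G.XB.R.vsV _ _ t]) (simp_all add: lin_def l HP.T.R.raT_pure sm_pure sigma_ract)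
  have Zin: "rcoact Z z \<in> carr (Z \<otimes>\<^sub>v H)" "lcoact Z z \<in> carr (H \<otimes>\<^sub>v Z)" if "z \<in> carr Z" for z
    using that by (simp_all add: G.HOM_rcoact G.HOM_lcoact G.carr_HOM)
  note vs = HP.TB.R.vsV A.vsH G.XB.R.vsV
  show "rcoact Z (sm t) = tmap XY H Z H sm id (rcoact XY t)"
  proof (rule tensor_eqI[OF vs(3) Zin(1)[OF l(1)[OF t]] tmap_in[OF vs sm_lin lin_id HP.T_coact(1)[OF t]]])
    fix F assume F: "bf Z H F"
    have "rcoact Z (sm t) F = SS Z H (rrM H Z (sm t)) F"
      by (simp add: rrM_def rep_ev vs F Zin linD[OF sm_lin] t)
    also have "\<dots> = SS XY H (rrM H XY t) (\<lambda>u k. F (sm u) k)"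
    proof (rule lf_tensor_eqI[OF A.XB.R.vsV, where v = "\<lambda>t. SS Z H (rrM H Z (sm t)) F"
          and w = "\<lambda>t. SS XY H (rrM H XY t) (\<lambda>u k. F (sm u) k)"])
      have "lf XY (\<lambda>t. SS Z H (rrM H Z (sm t)) F)" "lf XY (\<lambda>t. SS XY H (rrM H XY t) (\<lambda>u k. F (sm u) k))"
        using bfD[OF F] by (simp_all add: l F)
      then show "lf (X \<otimes>\<^sub>v Y) (\<lambda>t. SS Z H (rrM H Z (sm t)) F)" "lf (X \<otimes>\<^sub>v Y) (\<lambda>t. SS XY H (rrM H XY t) (\<lambda>u k. F (sm u) k))"
        by (simp_all add: lf_def XY_eqs)
      show "t \<in> carr (X \<otimes>\<^sub>v Y)" using t by (simp add: XY_eqs)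
      fix p q assume "p \<in> carr X" "q \<in> carr Y"
      then show "SS Z H (rrM H Z (sm (p \<otimes>\<^bsub>X,Y\<^esub> q))) F = SS XY H (rrM H XY (p \<otimes>\<^bsub>X,Y\<^esub> q)) (\<lambda>u k. F (sm u) k)"
        using bfD[OF F] by (simp add: sm_pure sigma_rr F HP.T.R.rrT_pure l)
    qed
    also have "\<dots> = tmap XY H Z H sm id (rcoact XY t) F" (is "_ = ?r")
      by (simp add: tmap_ev[OF vs sm_lin lin_id HP.T_coact(1)[OF t] F] rrM_def)
    finally show "rcoact Z (sm t) F = ?r" .
  qed
  show "lcoact Z (sm t) = tmap H XY H Z id sm (lcoact XY t)"
  proof (rule tensor_eqI[OF vs(2) Zin(2)[OF l(1)[OF t]] tmap_in[OF vs(2,1,2) lin_id sm_lin HP.T_coact(2)[OF t]]])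
    fix F' assume F': "bf H Z F'"
    \<comment> \<open>The flipped form matches the convention that left coaction lists keep the
      element of \<open>H\<close> in second position.\<close>
    define F where "F = (\<lambda>z h. F' h z)"
    have F: "bf Z H F" unfolding F_def by (rule G.bf_flip[OF F'])
    have "lcoact Z (sm t) F' = SS Z H (llM H Z (sm t)) F"
      by (simp add: llM_def SS_flip rep_ev vs F' Zin linD[OF sm_lin] t F_def)
    also have "\<dots> = SS XY H (llM H XY t) (\<lambda>u k. F (sm u) k)"
    proof (rule lf_tensor_eqI[OF A.XB.R.vsV, where v = "\<lambda>t. SS Z H (llM H Z (sm t)) F"
          and w = "\<lambda>t. SS XY H (llM H XY t) (\<lambda>u k. F (sm u) k)"])
      have "lf XY (\<lambda>t. SS Z H (llM H Z (sm t)) F)" "lf XY (\<lambda>t. SS XY H (llM H XY t) (\<lambda>u k. F (sm u) k))"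
        using bfD[OF F] by (simp_all add: l F)
      then show "lf (X \<otimes>\<^sub>v Y) (\<lambda>t. SS Z H (llM H Z (sm t)) F)" "lf (X \<otimes>\<^sub>v Y) (\<lambda>t. SS XY H (llM H XY t) (\<lambda>u k. F (sm u) k))"
        by (simp_all add: lf_def XY_eqs)
      show "t \<in> carr (X \<otimes>\<^sub>v Y)" using t by (simp add: XY_eqs)
      fix p q assume "p \<in> carr X" "q \<in> carr Y"
      then show "SS Z H (llM H Z (sm (p \<otimes>\<^bsub>X,Y\<^esub> q))) F = SS XY H (llM H XY (p \<otimes>\<^bsub>X,Y\<^esub> q)) (\<lambda>u k. F (sm u) k)"
        using bfD[OF F] by (simp add: sm_pure sigma_ll F HP.T.L.rrT_pure l)
    qed
    also have "\<dots> = tmap H XY H Z id sm (lcoact XY t) F'" (is "_ = ?r")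
      by (simp add: tmap_ev[OF vs(2,1,2) lin_id sm_lin HP.T_coact(2)[OF t] F'] llM_def SS_flip F_def)
    finally show "lcoact Z (sm t) F' = ?r" .
  qed
qed

lemma sigma_decompose:
  assumes \<phi>: "\<phi> \<in> carr X" and \<psi>: "\<psi> \<in> carr Y"
  shows "\<sigma> \<phi> \<psi> = sigma_tensor H M M' N' N' \<phi> (ext0 N' id) \<circ> sigma_tensor H M M N N' (ext0 M id) \<psi>"
proof -
  interpret S1: sigma_ctx H M M' N' N' by (rule sigma_ctx.intro[OF hopf bijS bM bM' bN' bN'])
  interpret S2: sigma_ctx H M M N N' by (rule sigma_ctx.intro[OF hopf bijS bM bM bN bN'])
  note i1 = id_HOM[OF hopf bijS bN'] and i2 = id_HOM(1)[OF hopf bijS bM]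
  have e1: "ev (ext0 N' id) n = n" if "n \<in> carr N'" for n using that by (simp add: ev_def ext0_def)
  have e2: "ev (ext0 M id) m = m" if "m \<in> carr M" for m using that by (simp add: ev_def ext0_def)
  show ?thesis
  proof (rule Hom_pure_eqI[OF sigma_Hom[OF \<phi> \<psi>]])
    show "S1.\<sigma> \<phi> (ext0 N' id) \<circ> S2.\<sigma> (ext0 M id) \<psi> \<in> carr (Hom T T')"
      by (rule Hom_comp[OF S2.G.vsN S2.sigma_Hom[OF i2 \<psi>] S1.sigma_Hom[OF \<phi> i1(1)]])
    fix v m n assume v: "lf T' v" and m: "m \<in> carr M" and n: "n \<in> carr N"
    note l = S1.glin S2.glin slin \<phi> \<psi> m n lfD[OF v] i1(1) i2 e1 e2 S1.sigma_Hom
    have "v (ev (S1.\<sigma> \<phi> (ext0 N' id) \<circ> S2.\<sigma> (ext0 M id) \<psi>) (m \<otimes>\<^bsub>M,N\<^esub> n))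
      = v (ev (S1.\<sigma> \<phi> (ext0 N' id)) (ev (S2.\<sigma> (ext0 M id) \<psi>) (m \<otimes>\<^bsub>M,N\<^esub> n)))" (is "?l = _")
      by (simp add: ev_def)
    also have "\<dots> = LY \<psi> (\<lambda>y h. RM m (\<lambda>x a.
        v (ev (S1.\<sigma> \<phi> (ext0 N' id)) (ev (ext0 M id) (PM (lact M h x)) \<otimes>\<^bsub>M,N'\<^esub> ev y (lact N a n)))))"
      by (rule S2.sigma_lf[OF i2 \<psi> m n, where v = "\<lambda>u. v (ev (S1.\<sigma> \<phi> (ext0 N' id)) u)"]) (simp add: l)
    also have "\<dots> = LY \<psi> (\<lambda>y h. RM m (\<lambda>x a. v (ev \<phi> (PM (lact M h x)) \<otimes>\<^bsub>M',N'\<^esub> ev y (lact N a n))))"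
    proof (intro SS_cong refl)
      fix y h x a assume y: "y \<in> carr Y" and x: "x \<in> carr M"
      let ?x = "PM (lact M h x)" and ?n = "ev y (lact N a n)"
      have "v (ev (S1.\<sigma> \<phi> (ext0 N' id)) (?x \<otimes>\<^bsub>M,N'\<^esub> ?n)) = SS S1.Y H (S1.lY (ext0 N' id)) (\<lambda>i k. RM ?x (\<lambda>x0 x1.
        v (ev \<phi> (PM (lact M k x0)) \<otimes>\<^bsub>M',N'\<^esub> ev i (lact N' x1 ?n))))"
        by (rule S1.sigma_lf[OF \<phi> i1(1) _ _ v]) (simp_all add: l x y)
      also have "\<dots> = RM ?x (\<lambda>x0 x1. v (ev \<phi> (PM (lact M 1 x0)) \<otimes>\<^bsub>M',N'\<^esub> ev (ext0 N' id) (lact N' x1 ?n)))"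
        by (rule i1(2)) (simp add: l x y)
      \<comment> \<open>The coaction of \<open>?x\<close> is \<open>?x \<otimes> 1\<close> because
        \<open>?x\<close> is a value of \<open>P\<close>, so nothing acts on \<open>?n\<close>, and
        the second projection is absorbed by idempotence.\<close>
      also have "\<dots> = v (ev \<phi> ?x \<otimes>\<^bsub>M',N'\<^esub> ?n)"
        by (simp add: A.B.M.R.rr_P l x y A.B.M.R.la_one C.B.N.R.la_one A.B.M.R.P_P)
      finally show "v (ev (S1.\<sigma> \<phi> (ext0 N' id)) (ev (ext0 M id) ?x \<otimes>\<^bsub>M,N'\<^esub> ?n)) = v (ev \<phi> ?x \<otimes>\<^bsub>M',N'\<^esub> ?n)"
        by (simp add: l x)
    qed
    also have "\<dots> = v (ev (\<sigma> \<phi> \<psi>) (m \<otimes>\<^bsub>M,N\<^esub> n))" (is "_ = ?r")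
      by (rule sigma_lf[OF \<phi> \<psi> m n v, symmetric])
    finally show "?r = ?l" ..
  qed
qed

text \<open>
  \<open>P(m \<otimes> n) = m\<^sub>0 \<otimes> P(n) S(m\<^sub>1)\<close>, and \<open>\<psi>\<close> is applied to \<open>m\<^sub>1 P(n) S(m\<^sub>2) = P(m\<^sub>1 n)\<close>.
\<close>

lemma sigma_P:
  assumes \<phi>: "\<phi> \<in> carr X" and \<psi>: "\<psi> \<in> carr Y" and m: "m \<in> carr M" and n: "n \<in> carr N" and v: "lf T' v"
  shows "v (ev (\<sigma> \<phi> \<psi>) (D.TB.R.P (m \<otimes>\<^sub>1 n))) = LY \<psi> (\<lambda>y k. RM m (\<lambda>x a.
      v (ev \<phi> (PM (lact M k x)) \<otimes>\<^sub>2 ev y (PN (lact N a n)))))"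
proof -
  note l = glin \<phi> \<psi> m n lfD[OF v] sigma_Hom
  let ?v = "\<lambda>u. v (ev (\<sigma> \<phi> \<psi>) u)"
  have lv: "lf T ?v" by (simp add: l)
  have "?v (D.TB.R.P (m \<otimes>\<^sub>1 n)) = RM m (\<lambda>x c. ?v (x \<otimes>\<^sub>1 ract N (PN n) (Sa c)))"
    using C.B.M.R.P_ev[of "\<lambda>z. ?v (x \<otimes>\<^sub>1 ract N z (Sa c))" n for x c]
    by (simp add: D.TB.R.P_ev[OF lv] D.T.R.rrT_pure D.T.R.raT_pure A.B.M.R.S_mult C.B.M.R.ra_mult l l)
  also have "\<dots> = RM m (\<lambda>x c. LY \<psi> (\<lambda>y k. RM x (\<lambda>z a.
      v (ev \<phi> (PM (lact M k z)) \<otimes>\<^sub>2 ev y (lact N a (ract N (PN n) (Sa c)))))))"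
    by (intro SS_cong refl sigma_lf[OF \<phi> \<psi> _ _ v]) (simp_all add: l)
  also have "\<dots> = LY \<psi> (\<lambda>y k. RM m (\<lambda>x c. RM x (\<lambda>z a.
      v (ev \<phi> (PM (lact M k z)) \<otimes>\<^sub>2 ev y (lact N a (ract N (PN n) (Sa c)))))))"
    by (rule SS_swap)
  also have "\<dots> = LY \<psi> (\<lambda>y k. RM m (\<lambda>x a. v (ev \<phi> (PM (lact M k x)) \<otimes>\<^sub>2 ev y (PN (lact N a n)))))"
    using C.B.M.R.P_ad[OF n, of "\<lambda>z. v (ev \<phi> (PM (lact M k x)) \<otimes>\<^sub>2 ev y z)" for k x y]
    by (simp add: A.B.M.R.rr_coassoc[OF m] l l)
  finally show ?thesis .
qed

text \<open>The left side projects an element of \<open>M \<otimes> N\<close>, which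
  \<open>sigma_P\<close> rewrites through the projections of the factors; the right side needs the
  left coaction of a tensor product of morphisms, which is \<open>sigma_ll\<close>. Both are brought
  to one sum over the coactions of \<open>\<psi>\<close>, \<open>\<chi>\<close>, \<open>m\<close>
  and \<open>n\<close>.\<close>

lemma sigma_assoc:
  fixes Q :: "('k, 'h, 'q::ab_group_add) bimod" and Q' :: "('k, 'h, 'q'::ab_group_add) bimod"
  assumes bQ: "bicovariant_bimodule H Q" and bQ': "bicovariant_bimodule H Q'"
    and \<phi>: "\<phi> \<in> carr X" and \<psi>: "\<psi> \<in> carr Y" and \<chi>: "\<chi> \<in> carr (HOM H Q Q')"
    and t: "t \<in> carr ((M \<otimes>\<^sub>v N) \<otimes>\<^sub>v Q)"
  shows "tassoc M' N' Q' (sigma_tensor H T T' Q Q' (\<sigma> \<phi> \<psi>) \<chi> t)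
    = sigma_tensor H M M' (bitensor H N Q) (bitensor H N' Q') \<phi> (sigma_tensor H N N' Q Q' \<psi> \<chi>) (tassoc M N Q t)"
proof -
  interpret U: sigma_ctx H N N' Q Q' by (rule sigma_ctx.intro[OF hopf bijS bN bN' bQ bQ'])
  interpret V: sigma_ctx H T T' Q Q' by (rule sigma_ctx.intro[OF hopf bijS D.bicov_T E.bicov_T bQ bQ'])
  interpret K: sigma_ctx H M M' "bitensor H N Q" "bitensor H N' Q'"
    by (rule sigma_ctx.intro[OF hopf bijS bM bM' U.D.bicov_T U.E.bicov_T])
  let ?Q = "HOM H Q Q'" and ?lQ = "llM H (HOM H Q Q')"
  note vs = A.vsM C.vsM U.C.vsM A.vsN C.vsN U.C.vsN
  note \<sigma>1 = sigma_in[OF \<phi> \<psi>] and \<sigma>2 = U.sigma_in[OF \<psi> \<chi>]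
  have eqs: "T \<otimes>\<^sub>v Q = (M \<otimes>\<^sub>v N) \<otimes>\<^sub>v Q" "T' \<otimes>\<^sub>v Q' = (M' \<otimes>\<^sub>v N') \<otimes>\<^sub>v Q'"
    "M \<otimes>\<^sub>v bitensor H N Q = M \<otimes>\<^sub>v (N \<otimes>\<^sub>v Q)" "M' \<otimes>\<^sub>v bitensor H N' Q' = M' \<otimes>\<^sub>v (N' \<otimes>\<^sub>v Q')"
    by (rule tensor_vs_cong; simp add: T_eqs U.T_eqs)+
  have peqs: "s \<otimes>\<^bsub>M \<otimes>\<^sub>v N,Q\<^esub> z = s \<otimes>\<^bsub>T,Q\<^esub> z" "s' \<otimes>\<^bsub>M' \<otimes>\<^sub>v N',Q'\<^esub> z' = s' \<otimes>\<^bsub>T',Q'\<^esub> z'"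
    "x \<otimes>\<^bsub>M,N \<otimes>\<^sub>v Q\<^esub> y = x \<otimes>\<^bsub>M,bitensor H N Q\<^esub> y" "x' \<otimes>\<^bsub>M',N' \<otimes>\<^sub>v Q'\<^esub> y' = x' \<otimes>\<^bsub>M',bitensor H N' Q'\<^esub> y'"
    for s z s' z' x y x' y'
    by (rule ptens_vs_cong; simp add: T_eqs U.T_eqs)+
  have VH: "lin ((M \<otimes>\<^sub>v N) \<otimes>\<^sub>v Q) ((M' \<otimes>\<^sub>v N') \<otimes>\<^sub>v Q') (V.\<sigma> (\<sigma> \<phi> \<psi>) \<chi>)"
    using V.sigma_Hom[OF \<sigma>1 \<chi>] by (simp add: Hom_def lin_def V.T_eqs eqs)
  have KH: "lin (M \<otimes>\<^sub>v (N \<otimes>\<^sub>v Q)) (M' \<otimes>\<^sub>v (N' \<otimes>\<^sub>v Q')) (K.\<sigma> \<phi> (U.\<sigma> \<psi> \<chi>))"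
    using K.sigma_Hom[OF \<phi> \<sigma>2] by (simp add: Hom_def lin_def K.T_eqs eqs)
  note tl = linD[OF tassoc_lin[OF vs(1-3)]] linD[OF tassoc_lin[OF vs(4-6)]] linD[OF VH] linD[OF KH]
  show ?thesis
  proof (rule tensor_eqI[OF vs(4)])
    show "tassoc M' N' Q' (V.\<sigma> (\<sigma> \<phi> \<psi>) \<chi> t) \<in> carr (M' \<otimes>\<^sub>v (N' \<otimes>\<^sub>v Q'))"
      "K.\<sigma> \<phi> (U.\<sigma> \<psi> \<chi>) (tassoc M N Q t) \<in> carr (M' \<otimes>\<^sub>v (N' \<otimes>\<^sub>v Q'))"
      using t by (simp_all add: tl)
    fix \<beta> assume \<beta>0: "bf M' (N' \<otimes>\<^sub>v Q') \<beta>"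
    then have \<beta>: "bf M' (bitensor H N' Q') \<beta>" by (simp add: bf_def lf_def U.T_eqs)
    \<comment> \<open>Composing the test form with the associator turns it into a functional on the
      source of the associator, so that \<open>sigma_lf\<close> applies to the left side.\<close>
    define w where "w = (\<lambda>s. tassoc M' N' Q' s \<beta>)"
    have w0: "lf (T' \<otimes>\<^sub>v Q') w" unfolding w_def eqs by (simp add: lf_def tl)
    then have w: "lf V.T' w" by (simp add: lf_def V.T_eqs)
    have wp: "w ((x \<otimes>\<^bsub>M',N'\<^esub> y) \<otimes>\<^bsub>T',Q'\<^esub> z) = \<beta> x (y \<otimes>\<^bsub>N',Q'\<^esub> z)"
      if "x \<in> carr M'" "y \<in> carr N'" "z \<in> carr Q'" for x y z
      using tassoc_pure[OF vs(4-6) that] by (simp add: w_def peqs ptens_ev \<beta>)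
    have wl: "lf T' (\<lambda>s. w (s \<otimes>\<^bsub>T',Q'\<^esub> z))" if "z \<in> carr Q'" for z
      using that by (simp add: lf_def ptensD lfD[OF w0])
    note b = bfD[OF \<beta>]
    let ?f = "\<lambda>t. w (V.\<sigma> (\<sigma> \<phi> \<psi>) \<chi> t)" and ?g = "\<lambda>t. K.\<sigma> \<phi> (U.\<sigma> \<psi> \<chi>) (tassoc M N Q t) \<beta>"
    have pure: "?f ((m \<otimes>\<^bsub>M,N\<^esub> n) \<otimes>\<^bsub>T,Q\<^esub> z) = ?g ((m \<otimes>\<^bsub>M,N\<^esub> n) \<otimes>\<^bsub>T,Q\<^esub> z)"
      if m: "m \<in> carr M" and n: "n \<in> carr N" and z: "z \<in> carr Q" for m n z
    proof -
      note l = glin U.glin \<phi> \<psi> \<chi> \<sigma>1 \<sigma>2 m n z b U.sigma_Hom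
      have "?f ((m \<otimes>\<^bsub>M,N\<^esub> n) \<otimes>\<^bsub>T,Q\<^esub> z) = w (ev (V.\<sigma> (\<sigma> \<phi> \<psi>) \<chi>) ((m \<otimes>\<^bsub>M,N\<^esub> n) \<otimes>\<^bsub>T,Q\<^esub> z))"
        by (simp add: ev_def)
      also have "\<dots> = SS ?Q H (?lQ \<chi>) (\<lambda>y h. RT (m \<otimes>\<^bsub>M,N\<^esub> n) (\<lambda>s a.
          w (ev (\<sigma> \<phi> \<psi>) (D.TB.R.P (lact T h s)) \<otimes>\<^bsub>T',Q'\<^esub> ev y (lact Q a z))))"
        by (rule V.sigma_lf[OF \<sigma>1 \<chi> _ z w]) (simp add: l)
      also have "\<dots> = SS ?Q H (?lQ \<chi>) (\<lambda>y h. RM m (\<lambda>x a. RN n (\<lambda>u b.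
          w (ev (\<sigma> \<phi> \<psi>) (D.TB.R.P (lact T h (x \<otimes>\<^bsub>M,N\<^esub> u))) \<otimes>\<^bsub>T',Q'\<^esub> ev y (lact Q (a * b) z)))))"
      proof (rule SS_cong[OF refl], rule D.T.R.rrT_pure[OF m n])
        fix y h assume y: "y \<in> carr ?Q"
        have "lf T (\<lambda>s. w (ev (\<sigma> \<phi> \<psi>) (D.TB.R.P (lact T h s)) \<otimes>\<^bsub>T',Q'\<^esub> ev y (lact Q a z)))" for a
          using lfD[OF wl[of "ev y (lact Q a z)"]] y by (simp add: l D.TB.R.linV G.X.R.hX sigma_Hom)
        moreover have "lf H (\<lambda>a. w (s \<otimes>\<^bsub>T',Q'\<^esub> ev y (lact Q a z)))" if "s \<in> carr T'" for s
          using that y by (simp add: l ptensD lfD[OF w0])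
        ultimately show "bf T H (\<lambda>s a. w (ev (\<sigma> \<phi> \<psi>) (D.TB.R.P (lact T h s)) \<otimes>\<^bsub>T',Q'\<^esub> ev y (lact Q a z)))"
          by (simp add: bf_def D.TB.R.linV G.X.R.hX \<sigma>1)
      qed
      \<comment> \<open>Here \<open>sigma_P\<close> replaces the projection of the tensor product by
        \<open>PM\<close> and \<open>PN\<close>.\<close>
      also have "\<dots> = SS ?Q H (?lQ \<chi>) (\<lambda>y h. RM m (\<lambda>x a. RN n (\<lambda>u b. LY \<psi> (\<lambda>p k.
          RM (lact M h x) (\<lambda>x' g. \<beta> (ev \<phi> (PM (lact M k x'))) (ev p (PN (lact N g u)) \<otimes>\<^bsub>N',Q'\<^esub> ev y (lact Q (a * b) z)))))))"
      proof (intro SS_cong refl)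
        fix y h x a u b assume y: "y \<in> carr ?Q" and x: "x \<in> carr M" and u: "u \<in> carr N"
        have "w (ev (\<sigma> \<phi> \<psi>) (D.TB.R.P (lact M h x \<otimes>\<^bsub>M,N\<^esub> u)) \<otimes>\<^bsub>T',Q'\<^esub> ev y (lact Q (a * b) z))
          = LY \<psi> (\<lambda>p k. RM (lact M h x) (\<lambda>x' g.
             w ((ev \<phi> (PM (lact M k x')) \<otimes>\<^bsub>M',N'\<^esub> ev p (PN (lact N g u))) \<otimes>\<^bsub>T',Q'\<^esub> ev y (lact Q (a * b) z))))"
          by (rule sigma_P[OF \<phi> \<psi> _ u wl]) (simp_all add: l x y)
        then show "w (ev (\<sigma> \<phi> \<psi>) (D.TB.R.P (lact T h (x \<otimes>\<^bsub>M,N\<^esub> u))) \<otimes>\<^bsub>T',Q'\<^esub> ev y (lact Q (a * b) z))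
          = LY \<psi> (\<lambda>p k. RM (lact M h x) (\<lambda>x' g.
             \<beta> (ev \<phi> (PM (lact M k x'))) (ev p (PN (lact N g u)) \<otimes>\<^bsub>N',Q'\<^esub> ev y (lact Q (a * b) z))))"
          by (simp add: D.T.R.laT_pure x u y wp l)
      qed
      \<comment> \<open>Covariance splits \<open>h\<close> into its coproduct; these are the two
        legs of \<open>\<chi>\<close> that the other side obtains from an iterated left
        coaction.\<close>
      also have "\<dots> = SS ?Q H (?lQ \<chi>) (\<lambda>y h. RM m (\<lambda>x a. RN n (\<lambda>u b. LY \<psi> (\<lambda>p k. SD h (\<lambda>c d.
          RM x (\<lambda>x' g. \<beta> (ev \<phi> (PM (lact M k (lact M c x')))) (ev p (PN (lact N (d * g) u)) \<otimes>\<^bsub>N',Q'\<^esub> ev y (lact Q (a * b) z))))))))"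
        by (simp add: A.B.M.R.rr_la l)
      also have "\<dots> = SS ?Q H (?lQ \<chi>) (\<lambda>y h. RN n (\<lambda>u b. LY \<psi> (\<lambda>p k. SD h (\<lambda>c d.
          RM m (\<lambda>x a. RM x (\<lambda>x' g. \<beta> (ev \<phi> (PM (lact M k (lact M c x')))) (ev p (PN (lact N (d * g) u)) \<otimes>\<^bsub>N',Q'\<^esub> ev y (lact Q (a * b) z))))))))"
        by (simp only: SS_swap[of M H "rM m"])
      also have "\<dots> = SS ?Q H (?lQ \<chi>) (\<lambda>y h. RN n (\<lambda>u b. LY \<psi> (\<lambda>p k. SD h (\<lambda>c d.
          RM m (\<lambda>x w. SD w (\<lambda>g a. \<beta> (ev \<phi> (PM (lact M k (lact M c x)))) (ev p (PN (lact N (d * g) u)) \<otimes>\<^bsub>N',Q'\<^esub> ev y (lact Q (a * b) z))))))))"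
        by (simp add: A.B.M.R.rr_coassoc[OF m] l)
      finally have L: "?f ((m \<otimes>\<^bsub>M,N\<^esub> n) \<otimes>\<^bsub>T,Q\<^esub> z) = \<dots>" .
      have "?g ((m \<otimes>\<^bsub>M,N\<^esub> n) \<otimes>\<^bsub>T,Q\<^esub> z) = ev (K.\<sigma> \<phi> (U.\<sigma> \<psi> \<chi>)) (m \<otimes>\<^bsub>M,bitensor H N Q\<^esub> (n \<otimes>\<^bsub>N,Q\<^esub> z)) \<beta>"
        using tassoc_pure[OF vs(1-3) m n z] by (simp add: ev_def peqs)
      also have "\<dots> = SS U.Z H (llM H U.Z (U.\<sigma> \<psi> \<chi>)) (\<lambda>y h. RM m (\<lambda>x a.
          (ev \<phi> (PM (lact M h x)) \<otimes>\<^bsub>M',bitensor H N' Q'\<^esub> ev y (lact (bitensor H N Q) a (n \<otimes>\<^bsub>N,Q\<^esub> z))) \<beta>))"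
        by (rule K.sigma_lf[OF \<phi> \<sigma>2 m, where v = "\<lambda>u. u \<beta>"]) (simp_all add: l lf_def K.T_eqs)
      also have "\<dots> = SS U.Z H (llM H U.Z (U.\<sigma> \<psi> \<chi>)) (\<lambda>y h. RM m (\<lambda>x a.
          \<beta> (ev \<phi> (PM (lact M h x))) (ev y (lact N a n \<otimes>\<^bsub>N,Q\<^esub> z))))"
        by (simp add: ptens_ev \<beta> U.D.T.R.laT_pure l)
      \<comment> \<open>Left colinearity enters here: the coaction of the inner tensor product is
        the product of those of \<open>\<psi>\<close> and \<open>\<chi>\<close>.\<close>
      also have "\<dots> = LY \<psi> (\<lambda>p k. SS ?Q H (?lQ \<chi>) (\<lambda>q k'. RM m (\<lambda>x a.
          \<beta> (ev \<phi> (PM (lact M (k * k') x))) (ev (U.\<sigma> p q) (lact N a n \<otimes>\<^bsub>N,Q\<^esub> z)))))"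
        by (rule U.sigma_ll[OF \<psi> \<chi>]) (simp add: l U.G.X.R.hX)
      also have "\<dots> = LY \<psi> (\<lambda>p k. SS ?Q H (?lQ \<chi>) (\<lambda>q k'. RM m (\<lambda>x a.
          SS ?Q H (?lQ q) (\<lambda>y h. RN (lact N a n) (\<lambda>u b.
            \<beta> (ev \<phi> (PM (lact M (k * k') x))) (ev p (PN (lact N h u)) \<otimes>\<^bsub>N',Q'\<^esub> ev y (lact Q b z)))))))"
        using U.sigma_lf[of _ _ _ _ "\<beta> (ev \<phi> (PM (lact M (k * k') x)))" for k k' x] by (simp add: l)
      also have "\<dots> = LY \<psi> (\<lambda>p k. SS ?Q H (?lQ \<chi>) (\<lambda>q k'. RM m (\<lambda>x a.
          SS ?Q H (?lQ q) (\<lambda>y h. SD a (\<lambda>c d. RN n (\<lambda>u b.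
            \<beta> (ev \<phi> (PM (lact M k (lact M k' x)))) (ev p (PN (lact N (h * c) u)) \<otimes>\<^bsub>N',Q'\<^esub> ev y (lact Q (d * b) z))))))))"
        by (simp add: C.B.M.R.rr_la C.B.M.R.la_mult A.B.M.R.la_mult l)
      also have "\<dots> = LY \<psi> (\<lambda>p k. RM m (\<lambda>x a. SS ?Q H (?lQ \<chi>) (\<lambda>q k'.
          SS ?Q H (?lQ q) (\<lambda>y h. SD a (\<lambda>c d. RN n (\<lambda>u b.
            \<beta> (ev \<phi> (PM (lact M k (lact M k' x)))) (ev p (PN (lact N (h * c) u)) \<otimes>\<^bsub>N',Q'\<^esub> ev y (lact Q (d * b) z))))))))"
        by (simp only: SS_swap[of ?Q H "?lQ \<chi>"])
      \<comment> \<open>One leg of \<open>\<chi>\<close> comes from the coaction of the inner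
        product and the other from its defining formula; coassociativity makes them the coproduct of
        a single \<open>e\<close>.\<close>
      also have "\<dots> = LY \<psi> (\<lambda>p k. RM m (\<lambda>x a. SS ?Q H (?lQ \<chi>) (\<lambda>y e.
          SD e (\<lambda>k' h. SD a (\<lambda>c d. RN n (\<lambda>u b.
            \<beta> (ev \<phi> (PM (lact M k (lact M k' x)))) (ev p (PN (lact N (h * c) u)) \<otimes>\<^bsub>N',Q'\<^esub> ev y (lact Q (d * b) z))))))))"
        by (simp add: U.C.XB.L.rr_coassoc[OF \<chi>] dlcS l)
      finally have R: "?g ((m \<otimes>\<^bsub>M,N\<^esub> n) \<otimes>\<^bsub>T,Q\<^esub> z) = \<dots>" .
      show ?thesis
        unfolding L R
        by ((simp only: SS_swap[of M H "rM m"])?, (simp only: SS_swap[of Y H "lY \<psi>"])?,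
            (simp only: SS_swap[of N H "rN n"])?)
    qed
    have "?f t = ?g t"
    proof (rule lf_tensor_eqI[OF is_vs_tensor, where v = ?f and w = ?g])
      show lf: "lf ((M \<otimes>\<^sub>v N) \<otimes>\<^sub>v Q) ?f" "lf ((M \<otimes>\<^sub>v N) \<otimes>\<^sub>v Q) ?g"
        using w0 by (simp_all add: lf_def eqs tl)
      show "t \<in> carr ((M \<otimes>\<^sub>v N) \<otimes>\<^sub>v Q)" by (rule t)
      fix s z assume s: "s \<in> carr (M \<otimes>\<^sub>v N)" and z: "z \<in> carr Q"
      show "?f (s \<otimes>\<^bsub>M \<otimes>\<^sub>v N,Q\<^esub> z) = ?g (s \<otimes>\<^bsub>M \<otimes>\<^sub>v N,Q\<^esub> z)"
      proof (rule lf_tensor_eqI[OF vs(1), where v = "\<lambda>s. ?f (s \<otimes>\<^bsub>M \<otimes>\<^sub>v N,Q\<^esub> z)" and w = "\<lambda>s. ?g (s \<otimes>\<^bsub>M \<otimes>\<^sub>v N,Q\<^esub> z)"])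
        show "lf (M \<otimes>\<^sub>v N) (\<lambda>s. ?f (s \<otimes>\<^bsub>M \<otimes>\<^sub>v N,Q\<^esub> z))" "lf (M \<otimes>\<^sub>v N) (\<lambda>s. ?g (s \<otimes>\<^bsub>M \<otimes>\<^sub>v N,Q\<^esub> z))"
          using lfD[OF lf(1)] lfD[OF lf(2)] z by (simp_all add: lf_def[of "M \<otimes>\<^sub>v N"] ptensD)
      qed (use s z pure in \<open>simp_all add: peqs\<close>)
    qed
    then show "tassoc M' N' Q' (V.\<sigma> (\<sigma> \<phi> \<psi>) \<chi> t) \<beta> = K.\<sigma> \<phi> (U.\<sigma> \<psi> \<chi>) (tassoc M N Q t) \<beta>"
      by (simp add: w_def)
  qed
qed

end

theorem theorem2p13:
  fixes H :: "('k::field, 'h::ring_1) hopf"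
    and M :: "('k, 'h, 'm::ab_group_add) bimod" and M' :: "('k, 'h, 'm'::ab_group_add) bimod"
    and N :: "('k, 'h, 'n::ab_group_add) bimod" and N' :: "('k, 'h, 'n'::ab_group_add) bimod"
  assumes "hopf_algebra H" and "bij (antipode H)"
    and "bicovariant_bimodule H M" and "bicovariant_bimodule H M'"
    and "bicovariant_bimodule H N" and "bicovariant_bimodule H N'"
  shows
    "(\<forall>\<phi>\<in>carr (HOM H M M'). \<forall>\<psi>\<in>carr (HOM H N N').
        sigma_tensor H M M' N N' \<phi> \<psi> \<in> carr (HOM H (bitensor H M N) (bitensor H M' N')) \<and>
        (\<forall>m\<in>carr M. \<forall>n\<in>carr N.
           sigma_tensor H M M' N N' \<phi> \<psi> (m \<otimes>\<^bsub>M,N\<^esub> n) = sigma_formula H M M' N N' \<phi> \<psi> m n) \<and>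
        sigma_map H M M' N N' (\<phi> \<otimes>\<^bsub>HOM H M M',HOM H N N'\<^esub> \<psi>) = sigma_tensor H M M' N N' \<phi> \<psi>)
     \<and> bicovariant_morphism H (bitensor H (HOM H M M') (HOM H N N'))
         (HOM H (bitensor H M N) (bitensor H M' N')) (sigma_map H M M' N N')
     \<and> (\<forall>\<phi>\<in>carr (HOM H M M'). \<forall>\<psi>\<in>carr (HOM H N N').
          sigma_tensor H M M' N N' \<phi> \<psi> =
          sigma_tensor H M M' N' N' \<phi> (ext0 N' id) \<circ> sigma_tensor H M M N N' (ext0 M id) \<psi>)
     \<and> (\<forall>(Q :: ('k, 'h, 'q::ab_group_add) bimod) (Q' :: ('k, 'h, 'q'::ab_group_add) bimod).
          bicovariant_bimodule H Q \<longrightarrow> bicovariant_bimodule H Q' \<longrightarrow>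
          (\<forall>\<phi>\<in>carr (HOM H M M'). \<forall>\<psi>\<in>carr (HOM H N N'). \<forall>\<chi>\<in>carr (HOM H Q Q').
           \<forall>t\<in>carr ((M \<otimes>\<^sub>v N) \<otimes>\<^sub>v Q).
             tassoc M' N' Q'
               (sigma_tensor H (bitensor H M N) (bitensor H M' N') Q Q'
                  (sigma_tensor H M M' N N' \<phi> \<psi>) \<chi> t) =
             sigma_tensor H M M' (bitensor H N Q) (bitensor H N' Q')
               \<phi> (sigma_tensor H N N' Q Q' \<psi> \<chi>) (tassoc M N Q t)))"
proof -
  interpret sigma_ctx H M M' N N' by (rule sigma_ctx.intro[OF assms])
  show ?thesis
    by (intro conjI ballI allI impI sigma_in sigma_pure sm_pure sigma_morphism sigma_decompose sigma_assoc)
qed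

end
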